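(* Let $\lambda>\lambda_0$ and let $u_{\lambda_0}$ be a Lipschitz viscosity solution of $a u''+H(x,u')=\lambda_0$ in $\mathbb R$. (a) There exists a unique viscosity solution $u^+_\lambda$ of $a u''+H(x,u')=\lambda$ in $\mathbb R$ with $(u^+_\lambda)'>u'_{\lambda_0}$ a.e. on $\mathbb R$ and $u^+_\lambda(0)=0$. It is of class $C^1$ on $\mathbb R$, of class $C^2$ on $A$, satisfies $(u^+_\lambda)'(x)=p^+_\lambda(x)$ for all $x\in\{a=0\}$ (in particular it is a classical pointwise solution), and does not depend on the choice of $u_{\lambda_0}$. (b) There exists a unique viscosity solution $u^-_\lambda$ of the same equation with $(u^-_\lambda)'<u'_{\lambda_0}$ a.e. on $\mathbb R$ and $u^-_\lambda(0)=0$. It is $C^1$ on $\mathbb R$, $C^2$ on $A$, satisfies $(u^-_\lambda)'=p^-_\lambda$ on $\{a=0\}$, and does not depend on the choice of $u_{\lambda_0}$.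
   Context: Deterministic setting: $a:\mathbb R\to[0,1]$ with $\sqrt a$ $\kappa$-Lipschitz and (A1$'$): $a\not\equiv0$ and every connected component of $A:=\{a>0\}$ is a bounded interval. $H:\mathbb R\times\mathbb R\to\mathbb R$ in $\mathscr H_{sqc}(\alpha_0,\alpha_1,\gamma,\eta)$, $\gamma>2$, $\eta>0$: (H1) $\alpha_0|p|^\gamma-1/\alpha_0\le H(x,p)\le\alpha_1(|p|^\gamma+1)$, (H2) $|H(x,p)-H(x,q)|\le\alpha_1(|p|+|q|+1)^{\gamma-1}|p-q|$, (H3) $|H(x,p)-H(y,p)|\le\alpha_1(|p|^\gamma+1)|x-y|$, $H(x,\cdot)$ strictly quasiconvex with unique minimizer $\hat p(x)$, $H(x,p_1)-H(x,p_2)\ge\eta|p_1-p_2|$ for $p_1<p_2\le\hat p(x)$, $H(x,p_2)-H(x,p_1)\ge\eta|p_1-p_2|$ for $p_2>p_1\ge\hat p(x)$. $\hat\lambda(x):=\min_pH(x,p)$; for $\lambda\ge\hat\lambda(x)$, $\{p:H(x,p)\le\lambda\}=[p^-_\lambda(x),p^+_\lambda(x)]$. Viscosity conventions: supersolution if $a\varphi''+H(x,\varphi')\le\lambda$ for $C^2$ $\varphi$ touching from below; subsolution if $\ge\lambda$ from above. $\lambda_0:=\inf\{\lambda:\ a u''+H(x,u')=\lambda$ admits a continuous viscosity supersolution on $\mathbb R\}$. *)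

theory Defs
  imports "HOL-Analysis.Analysis"
begin

definition C2_on :: "real set \<Rightarrow> (real \<Rightarrow> real) \<Rightarrow> bool" where
  "C2_on S f \<longleftrightarrow> (\<exists>f' f''. (\<forall>x\<in>S. (f has_real_derivative f' x) (at x))
      \<and> (\<forall>x\<in>S. (f' has_real_derivative f'' x) (at x)) \<and> continuous_on S f'')"

definition H_sqc :: "real \<Rightarrow> real \<Rightarrow> real \<Rightarrow> real \<Rightarrow> (real \<Rightarrow> real \<Rightarrow> real) \<Rightarrow> bool" where
  "H_sqc \<alpha>0 \<alpha>1 \<gamma> \<eta> H \<longleftrightarrow>
     0 < \<alpha>0 \<and> 0 < \<alpha>1 \<and>
     (\<forall>x p. \<alpha>0 * \<bar>p\<bar> powr \<gamma> - 1 / \<alpha>0 \<le> H x p \<and> H x p \<le> \<alpha>1 * (\<bar>p\<bar> powr \<gamma> + 1)) \<and>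
     (\<forall>x p q. \<bar>H x p - H x q\<bar> \<le> \<alpha>1 * (\<bar>p\<bar> + \<bar>q\<bar> + 1) powr (\<gamma> - 1) * \<bar>p - q\<bar>) \<and>
     (\<forall>x y p. \<bar>H x p - H y p\<bar> \<le> \<alpha>1 * (\<bar>p\<bar> powr \<gamma> + 1) * \<bar>x - y\<bar>) \<and>
     (\<forall>x p q t. p \<noteq> q \<and> 0 < t \<and> t < 1 \<longrightarrow>
         H x (t * p + (1 - t) * q) < max (H x p) (H x q)) \<and>
     (\<forall>x. \<exists>!ph. (\<forall>p. H x ph \<le> H x p) \<and>
         (\<forall>p1 p2. p1 < p2 \<and> p2 \<le> ph \<longrightarrow> H x p1 - H x p2 \<ge> \<eta> * \<bar>p1 - p2\<bar>) \<and>
         (\<forall>p1 p2. p2 > p1 \<and> p1 \<ge> ph \<longrightarrow> H x p2 - H x p1 \<ge> \<eta> * \<bar>p1 - p2\<bar>))"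

text \<open>Endpoints of the sublevel set {p. H x p \<le> lambda} = [p^-, p^+].\<close>
definition p_plus :: "(real \<Rightarrow> real \<Rightarrow> real) \<Rightarrow> real \<Rightarrow> real \<Rightarrow> real" where
  "p_plus H lam x = Sup {p. H x p \<le> lam}"

definition p_minus :: "(real \<Rightarrow> real \<Rightarrow> real) \<Rightarrow> real \<Rightarrow> real \<Rightarrow> real" where
  "p_minus H lam x = Inf {p. H x p \<le> lam}"

definition visc_super :: "(real \<Rightarrow> real) \<Rightarrow> (real \<Rightarrow> real \<Rightarrow> real) \<Rightarrow> real \<Rightarrow> (real \<Rightarrow> real) \<Rightarrow> bool" where
  "visc_super a H lam u \<longleftrightarrow> continuous_on UNIV u \<and>
     (\<forall>\<phi> x0. C2_on UNIV \<phi> \<and> \<phi> x0 = u x0 \<and> (\<forall>\<^sub>F x in at x0. \<phi> x \<le> u x) \<longrightarrow>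
        a x0 * deriv (deriv \<phi>) x0 + H x0 (deriv \<phi> x0) \<le> lam)"

definition visc_sub :: "(real \<Rightarrow> real) \<Rightarrow> (real \<Rightarrow> real \<Rightarrow> real) \<Rightarrow> real \<Rightarrow> (real \<Rightarrow> real) \<Rightarrow> bool" where
  "visc_sub a H lam u \<longleftrightarrow> continuous_on UNIV u \<and>
     (\<forall>\<phi> x0. C2_on UNIV \<phi> \<and> \<phi> x0 = u x0 \<and> (\<forall>\<^sub>F x in at x0. u x \<le> \<phi> x) \<longrightarrow>
        a x0 * deriv (deriv \<phi>) x0 + H x0 (deriv \<phi> x0) \<ge> lam)"

definition visc_sol :: "(real \<Rightarrow> real) \<Rightarrow> (real \<Rightarrow> real \<Rightarrow> real) \<Rightarrow> real \<Rightarrow> (real \<Rightarrow> real) \<Rightarrow> bool" where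
  "visc_sol a H lam u \<longleftrightarrow> visc_sub a H lam u \<and> visc_super a H lam u"

definition lambda0 :: "(real \<Rightarrow> real) \<Rightarrow> (real \<Rightarrow> real \<Rightarrow> real) \<Rightarrow> real" where
  "lambda0 a H = Inf {lam. \<exists>u. continuous_on UNIV u \<and> visc_super a H lam u}"

end

theory Submission
  imports Defs
begin

text \<open>
  Let \<open>v\<close> solve the equation at a level \<open>mu < lam\<close> and let \<open>w\<close> solve it at level \<open>lam\<close> with \<open>w' > v'\<close>.

  Where \<open>a > 0\<close>, a continuous viscosity solution is semiconcave (because \<open>H\<close> is bounded below), hence
  locally Lipschitz, hence semiconvex, hence \<open>C\<^sup>2\<close>, and \<open>q = w'\<close> solves \<open>a q' = lam - H x q\<close>. Since
  \<open>a\<close> vanishes quadratically at its zeros, \<open>1/a\<close> is not integrable there; together with the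
  superquadratic growth of \<open>H\<close> this prevents \<open>arctan q\<close> from moving at rate \<open>1/a\<close> up to a zero, so
  near a zero \<open>z\<close> all slopes of \<open>w\<close> are close to the sublevel interval of \<open>H z\<close>. At level \<open>mu\<close> that
  interval lies strictly inside the one at level \<open>lam\<close>, so \<open>w' > v'\<close> keeps the slopes of \<open>w\<close> off the lower
  endpoint, and the subsolution property then pushes them to the upper one. Thus \<open>w'\<close> is continuous,
  equals \<open>p\<^sup>+\<close> on \<open>{a = 0}\<close>, and is determined on each component of \<open>{a > 0}\<close> by its value at
  the left endpoint, where the flow contracts near \<open>p\<^sup>+\<close>. Existence on a component is obtained as the
  decreasing limit of solutions started ever closer to the left endpoint from a large constant, with \<open>v'\<close>
  as a barrier from below. The lower solution follows by the reflection \<open>x \<mapsto> - x\<close>.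
\<close>

section \<open>Touching parabolas\<close>

text \<open>Inside the locale both \<open>v\<close> and \<open>w\<close> are merely continuous
  viscosity solutions, and \<open>v\<close> may have kinks at zeros of \<open>a\<close> where the
  sublevel set of \<open>H\<close> has interior. Two bridges deal with this. For uniqueness,
  \<open>w' > v'\<close> almost everywhere is integrated into monotonicity of \<open>w - v\<close>,
  which rests on solutions being locally Lipschitz up to the zeros. For existence, the constructed
  solution must beat every admissible \<open>v\<close> almost everywhere, which rests on the kinks
  of \<open>v\<close> being countable. Zeros of \<open>a\<close> may accumulate, so no argument can
  step from one component of \<open>{a > 0}\<close> to the next: estimates at a zero hold on a
  two-sided neighbourhood that may contain further zeros and infinitely many components. The weight
  \<open>1 + p^2\<close> in the growth condition is the one that cancels against the derivative of
  \<open>arctan\<close>. Independence of the comparison solution comes from describing the slope of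
  the upper solution by an equation, its values at the zeros and continuity, none of which mentions
  \<open>v\<close>.\<close>

lemma taylor_lower:
  fixes f f' :: "real \<Rightarrow> real"
  assumes d: "\<forall>\<^sub>F y in nhds x. (f has_real_derivative f' y) (at y)"
    and d2: "(f' has_real_derivative D) (at x)" and X: "X < D"
  shows "\<forall>\<^sub>F y in at x. f x + f' x * (y - x) + X / 2 * (y - x)\<^sup>2 \<le> f y"
proof -
  define h where "h y = f y - (f x + f' x * (y - x) + X / 2 * (y - x)\<^sup>2)" for y
  define k where "k y = f' y - f' x - X * (y - x)" for y
  obtain e where e: "e > 0" "\<And>y. dist y x < e \<Longrightarrow> (f has_real_derivative f' y) (at y)"
    using d unfolding eventually_nhds_metric by blast
  have hd: "(h has_real_derivative k y) (at y)" if "dist y x < e" for y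
    unfolding h_def k_def by (rule derivative_eq_intros e(2)[OF that] refl)+ auto
  have kd: "(k has_real_derivative (D - X)) (at x)"
    unfolding k_def by (rule derivative_eq_intros d2 refl)+ auto
  have kx: "k x = 0" and hx: "h x = 0" by (simp_all add: k_def h_def)
  obtain d1 where d1: "d1 > 0" "\<And>t. 0 < t \<Longrightarrow> t < d1 \<Longrightarrow> k x < k (x + t)"
    using DERIV_pos_inc_right[OF kd] X by auto
  obtain d2 where d2: "d2 > 0" "\<And>t. 0 < t \<Longrightarrow> t < d2 \<Longrightarrow> k (x - t) < k x"
    using DERIV_pos_inc_left[OF kd] X by auto
  define r where "r = min e (min d1 d2)"
  have r: "r > 0" using e d1 d2 by (simp add: r_def)
  have "0 \<le> h y" if y: "y \<noteq> x" "dist y x < r" for y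
  proof (cases "x < y")
    case True
    have "\<exists>z. x < z \<and> z < y \<and> h y - h x = (y - x) * k z"
      by (rule MVT2[OF True]) (use y in \<open>auto intro!: hd simp: dist_real_def r_def\<close>)
    then obtain z where z: "x < z" "z < y" "h y - h x = (y - x) * k z" by auto
    have "k z > 0" using d1(2)[of "z - x"] z y kx by (auto simp: dist_real_def r_def)
    then show ?thesis using z hx by simp
  next
    case False
    then have yx: "y < x" using y by simp
    have "\<exists>z. y < z \<and> z < x \<and> h x - h y = (x - y) * k z"
      by (rule MVT2[OF yx]) (use y in \<open>auto intro!: hd simp: dist_real_def r_def\<close>)
    then obtain z where z: "y < z" "z < x" "h x - h y = (x - y) * k z" by auto
    have "k z < 0" using d2(2)[of "x - z"] z y kx by (auto simp: dist_real_def r_def)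
    then have "(x - y) * k z \<le> 0" using z by (simp add: mult_nonneg_nonpos)
    then show ?thesis using z hx by simp
  qed
  then show ?thesis unfolding eventually_at using r by (auto simp: h_def)
qed

definition subjet :: "(real \<Rightarrow> real) \<Rightarrow> real \<Rightarrow> real \<Rightarrow> real \<Rightarrow> bool" where
  "subjet u x p X \<longleftrightarrow> (\<forall>\<^sub>F y in at x. u x + p * (y - x) + X / 2 * (y - x)\<^sup>2 \<le> u y)"

definition superjet :: "(real \<Rightarrow> real) \<Rightarrow> real \<Rightarrow> real \<Rightarrow> real \<Rightarrow> bool" where
  "superjet u x p X \<longleftrightarrow> subjet (\<lambda>y. - u y) x (- p) (- X)"

lemma superjet_altdef:
  "superjet u x p X \<longleftrightarrow> (\<forall>\<^sub>F y in at x. u y \<le> u x + p * (y - x) + X / 2 * (y - x)\<^sup>2)"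
  unfolding superjet_def subjet_def by (intro arg_cong2[where f=eventually] ext refl) auto

lemma subjet_reflect:
  assumes "subjet (\<lambda>t. u (- t)) x p X"
  shows "subjet u (- x) (- p) X"
proof -
  obtain d where d: "d > 0" "\<And>y. y \<noteq> x \<Longrightarrow> dist y x < d \<Longrightarrow>
      u (- x) + p * (y - x) + X / 2 * (y - x)\<^sup>2 \<le> u (- y)"
    using assms unfolding subjet_def eventually_at by auto
  have "u (- x) + p * (- y - x) + X / 2 * (- y - x)\<^sup>2 \<le> u y" if "y \<noteq> - x" "dist y (- x) < d" for y
  proof -
    have "- y \<noteq> x" "dist (- y) x < d" using that by (auto simp: dist_real_def)
    then show ?thesis using d(2)[of "- y"] by simp
  qed
  note * = this
  have "u (- x) + - p * (y - - x) + X / 2 * (y - - x)\<^sup>2 \<le> u y" if "y \<noteq> - x" "dist y (- x) < d" for y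
    using *[OF that] by (simp add: power2_eq_square algebra_simps)
  then show ?thesis
    unfolding subjet_def eventually_at using d(1) by blast
qed

lemma subjet_deriv_eq:
  assumes "subjet u x p X" "(u has_real_derivative D) (at x)"
  shows "p = D"
proof -
  obtain d where d: "d > 0" "\<And>y. y \<noteq> x \<Longrightarrow> dist y x < d \<Longrightarrow>
      u x + p * (y - x) + X / 2 * (y - x)\<^sup>2 \<le> u y"
    using assms(1) unfolding subjet_def eventually_at by auto
  have "((\<lambda>y. u y - (u x + p * (y - x) + X / 2 * (y - x)\<^sup>2)) has_real_derivative D - p) (at x)"
    by (rule derivative_eq_intros assms refl)+ auto
  from DERIV_local_min[OF this d(1)] have "D - p = 0"
    using d(2) by (force simp: dist_real_def)
  then show ?thesis by simp
qed

lemma superjet_deriv_eq: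
  assumes "superjet u x p X" "(u has_real_derivative D) (at x)"
  shows "p = D"
  using subjet_deriv_eq[of "\<lambda>y. - u y" x "- p" "- X" "- D"] assms
  by (auto simp: superjet_def intro: derivative_eq_intros)

lemma subjet_of_min:
  assumes U: "open U" "x \<in> U"
    and min: "\<And>y. y \<in> U \<Longrightarrow> u x - f x \<le> u y - f y"
    and d: "\<And>y. y \<in> U \<Longrightarrow> (f has_real_derivative f' y) (at y)"
    and d2: "(f' has_real_derivative D) (at x)" and X: "X < D"
  shows "subjet u x (f' x) X"
proof -
  have "\<forall>\<^sub>F y in nhds x. (f has_real_derivative f' y) (at y)"
    using U d by (auto intro: eventually_nhds[THEN iffD2])
  from taylor_lower[OF this d2 X]
  have "\<forall>\<^sub>F y in at x. f x + f' x * (y - x) + X / 2 * (y - x)\<^sup>2 \<le> f y" .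
  moreover have "\<forall>\<^sub>F y in at x. y \<in> U" using U by (simp add: eventually_at_in_open')
  ultimately show ?thesis unfolding subjet_def
    by eventually_elim (use min in force)
qed

text \<open>The inf-convolution of \<open>u\<close> inherits the slope bound at its minimising points, where \<open>u\<close> is
  touched from below by a parabola.\<close>

lemma subjet_slope_le:
  fixes u :: "real \<Rightarrow> real"
  assumes cont: "continuous_on {al<..<be} u"
    and jet: "\<And>x p X. al < x \<Longrightarrow> x < be \<Longrightarrow> subjet u x p X \<Longrightarrow> p \<le> K"
    and xy: "al < x" "x \<le> y" "y < be"
  shows "u y - u x \<le> K * (y - x)"
proof -
  obtain al' where al': "al < al'" "al' < x" using xy dense by blast
  obtain be' where be': "y < be'" "be' < be" using xy dense by blast
  have c': "continuous_on {al'..be'} u"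
    by (rule continuous_on_subset[OF cont]) (use al' be' in auto)
  have "bounded (u ` {al'..be'})"
    by (intro compact_imp_bounded compact_continuous_image c') auto
  then obtain B where B: "\<And>t. al' \<le> t \<Longrightarrow> t \<le> be' \<Longrightarrow> \<bar>u t\<bar> \<le> B"
    unfolding bounded_iff by (metis atLeastAtMost_iff imageI real_norm_def)
  have B0: "B \<ge> 0" using B[of x] al' be' xy by auto
  define r where "r = min (x - al') (be' - y)"
  have r: "r > 0" using al' be' by (simp add: r_def)
  have step: "\<exists>t. \<bar>t - y\<bar> < \<epsilon> \<and> u t \<le> u x + K * (y - x)" if eps: "\<epsilon> > 0" "\<epsilon> \<le> r" for \<epsilon>
  proof -
    \<comment> \<open>At distance \<open>\<epsilon>\<close> the penalty
      \<open>M * \<epsilon>^2 = 2 * B + 1\<close> exceeds the largest possible oscillation of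
      \<open>u\<close>, so minimisers stay within \<open>\<epsilon>\<close> of
      \<open>c\<close>.\<close>
    define M where "M = (2 * B + 1) / \<epsilon>\<^sup>2"
    have M: "M > 0" "M * \<epsilon>\<^sup>2 = 2 * B + 1" using eps B0 by (auto simp: M_def)
    have "\<exists>t\<in>{al'..be'}. \<forall>s\<in>{al'..be'}. u t + M * (t - c)\<^sup>2 \<le> u s + M * (s - c)\<^sup>2" for c
      by (rule continuous_attains_inf) (use xy al' be' in \<open>auto intro!: continuous_intros c'\<close>)
    then obtain T where T: "\<And>c. T c \<in> {al'..be'}"
      "\<And>c s. s \<in> {al'..be'} \<Longrightarrow> u (T c) + M * (T c - c)\<^sup>2 \<le> u s + M * (s - c)\<^sup>2"
      by metis
    define W where "W c = u (T c) + M * (T c - c)\<^sup>2" for c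
    have near: "\<bar>T c - c\<bar> < \<epsilon>" if c: "x \<le> c" "c \<le> y" for c
    proof -
      have "u (T c) + M * (T c - c)\<^sup>2 \<le> u c" using T(2)[of c c] c al' be' by auto
      moreover have "u c \<le> B" "- B \<le> u (T c)"
        using B[of c] B[of "T c"] T(1)[of c] c al' be' by auto
      ultimately have "M * (T c - c)\<^sup>2 < M * \<epsilon>\<^sup>2" using M by linarith
      then have "(T c - c)\<^sup>2 < \<epsilon>\<^sup>2" by (simp only: mult_less_cancel_left_pos[OF M(1)])
      then show ?thesis using power2_less_imp_less[of "\<bar>T c - c\<bar>" \<epsilon>] eps by simp
    qed
    \<comment> \<open>The minimum inequality at \<open>T c\<close>, read as a statement on
      \<open>u\<close>, is a touching parabola with slope \<open>2 * M * (c - T c)\<close> and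
      second coefficient \<open>- 2 * M\<close>; hence \<open>jet\<close> applies.\<close>
    have slope: "2 * M * (c - T c) \<le> K" if c: "x \<le> c" "c \<le> y" for c
    proof -
      have t: "al' < T c" "T c < be'" using near[OF c] c eps unfolding r_def by auto
      have "subjet u (T c) (2 * M * (c - T c)) (- 2 * M)"
        unfolding subjet_def eventually_at_topological
      proof (intro exI conjI ballI impI)
        show "open {al'<..<be'}" "T c \<in> {al'<..<be'}" using t by auto
        fix s assume "s \<in> {al'<..<be'}"
        then have "u (T c) + M * (T c - c)\<^sup>2 \<le> u s + M * (s - c)\<^sup>2" using T(2)[of s c] by auto
        then show "u (T c) + 2 * M * (c - T c) * (s - T c) + - 2 * M / 2 * (s - T c)\<^sup>2 \<le> u s"
          by (simp add: power2_eq_square algebra_simps)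
      qed
      then show ?thesis using jet t al' be' by (meson less_trans)
    qed
    \<comment> \<open>The minimiser for \<open>c\<close> serves as a competitor for
      \<open>c'\<close>; the error is quadratic in \<open>c' - c\<close>, so it vanishes when the
      increment is summed over ever finer subdivisions.\<close>
    have Wst: "W c' - W c \<le> K * (c' - c) + M * (c' - c)\<^sup>2"
      if c: "x \<le> c" "c \<le> c'" "c' \<le> y" for c c'
    proof -
      have "W c' \<le> u (T c) + M * (T c - c')\<^sup>2" unfolding W_def using T by blast
      then have "W c' - W c \<le> M * (T c - c')\<^sup>2 - M * (T c - c)\<^sup>2" by (simp add: W_def)
      also have "\<dots> = (2 * M * (c - T c)) * (c' - c) + M * (c' - c)\<^sup>2"
        by (simp add: power2_eq_square algebra_simps)
      also have "\<dots> \<le> K * (c' - c) + M * (c' - c)\<^sup>2"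
        using slope[of c] c by (intro add_right_mono mult_right_mono) auto
      finally show ?thesis .
    qed
    have sub: "W y - W x \<le> K * (y - x) + M * (y - x)\<^sup>2 / real (Suc n)" for n
    proof -
      define N where "N = Suc n"
      define h where "h = (y - x) / real N"
      have h0: "h \<ge> 0" and Nh: "real N * h = y - x" using xy by (auto simp: h_def N_def)
      have "W (x + real i * h) - W x \<le> real i * (K * h + M * h\<^sup>2)" if "i \<le> N" for i
        using that
      proof (induction i)
        case (Suc i)
        have a: "real i * h \<ge> 0" using h0 by simp
        have "real (Suc i) * h \<le> real N * h" using Suc.prems h0 by (intro mult_right_mono) auto
        then have "W (x + real (Suc i) * h) - W (x + real i * h) \<le> K * h + M * h\<^sup>2"
          using Wst[of "x + real i * h" "x + real (Suc i) * h"] h0 a Nh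
          by (auto simp: algebra_simps)
        then show ?case using Suc by (auto simp: algebra_simps)
      qed simp
      from this[of N] have "W (x + (y - x)) - W x \<le> real N * (K * h + M * h\<^sup>2)" using Nh by simp
      also have "\<dots> = K * (real N * h) + M * (real N * h)\<^sup>2 / real N"
        by (simp add: N_def power2_eq_square field_simps)
      finally show ?thesis using Nh N_def by simp
    qed
    have "W y - W x \<le> K * (y - x)"
    proof (rule LIMSEQ_le_const)
      show "(\<lambda>n. K * (y - x) + M * (y - x)\<^sup>2 / real (Suc n)) \<longlonglongrightarrow> K * (y - x)"
        using tendsto_add[OF tendsto_const LIMSEQ_Suc[OF lim_const_over_n]] by fastforce
    qed (use sub in auto)
    \<comment> \<open>The convolution lies below \<open>u\<close> at \<open>x\<close>, while at
      \<open>y\<close> it is only known to dominate \<open>u (T y)\<close>. So the estimate is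
      obtained at a point near \<open>y\<close>, and continuity of \<open>u\<close>
      finishes.\<close>
    moreover have "W x \<le> u x" using T(2)[of x x] xy al' be' by (auto simp: W_def)
    moreover have "u (T y) \<le> W y" using M by (simp add: W_def)
    ultimately show ?thesis using near[of y] xy by (intro exI[of _ "T y"]) auto
  qed
  show ?thesis
  proof (rule ccontr)
    assume "\<not> ?thesis"
    then have pos: "u x + K * (y - x) < u y" by simp
    have "isCont u y" using cont xy by (simp add: continuous_on_eq_continuous_at)
    then have "\<forall>\<^sub>F t in nhds y. u x + K * (y - x) < u t"
      using pos by (simp add: isCont_def tendsto_at_iff_tendsto_nhds order_tendstoD)
    then obtain d where d: "d > 0" "\<And>t. dist t y < d \<Longrightarrow> u x + K * (y - x) < u t"
      unfolding eventually_nhds_metric by auto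
    show False using step[of "min d r"] d r by (fastforce simp: dist_real_def)
  qed
qed

lemma superjet_slope_ge:
  fixes u :: "real \<Rightarrow> real"
  assumes cont: "continuous_on {al<..<be} u"
    and jet: "\<And>x p X. al < x \<Longrightarrow> x < be \<Longrightarrow> superjet u x p X \<Longrightarrow> K \<le> p"
    and xy: "al < x" "x \<le> y" "y < be"
  shows "K * (y - x) \<le> u y - u x"
proof -
  have "p \<le> - K" if "al < t" "t < be" "subjet (\<lambda>t. - u t) t p X" for t p X
    using jet[of t "- p" "- X"] that by (auto simp: superjet_def)
  then show ?thesis
    using subjet_slope_le[of al be "\<lambda>t. - u t" "- K" x y] cont xy
    by (auto intro: continuous_intros simp: algebra_simps)
qed

text \<open>Suppose \<open>u - G\<close> dips below a chord. The chord, sagged by a small convex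
  parabola vanishing at both ends, still lies above the dip, so its sum with \<open>G\<close>
  touches \<open>u\<close> from below, after a vertical shift, at an interior point. There its
  second derivative exceeds \<open>m\<close> by \<open>\<epsilon>\<close>, against the bound on
  subjets.\<close>

lemma subjet_imp_convex:
  fixes u G G' m :: "real \<Rightarrow> real"
  assumes cont: "continuous_on {al<..<be} u"
    and G: "\<And>x. al < x \<Longrightarrow> x < be \<Longrightarrow> (G has_real_derivative G' x) (at x)"
    and G': "\<And>x. al < x \<Longrightarrow> x < be \<Longrightarrow> (G' has_real_derivative m x) (at x)"
    and jet: "\<And>x p X. al < x \<Longrightarrow> x < be \<Longrightarrow> subjet u x p X \<Longrightarrow> X \<le> m x"
  shows "convex_on {al<..<be} (\<lambda>x. G x - u x)"
proof (rule convex_on_linorderI)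
  fix t x y :: real
  assume t: "0 < t" "t < 1" and xy: "x \<in> {al<..<be}" "y \<in> {al<..<be}" "x < y"
  define z where "z s = u s - G s" for s
  define s0 where "s0 = (1 - t) * x + t * y"
  define ch where "ch s = z x + (s - x) * ((z y - z x) / (y - x))" for s
  have s0: "x < s0" "s0 < y"
  proof -
    have "s0 - x = t * (y - x)" "y - s0 = (1 - t) * (y - x)" by (simp_all add: s0_def algebra_simps)
    then show "x < s0" "s0 < y" using t xy by (smt (verit) mult_pos_pos)+
  qed
  have chs0: "ch s0 = (1 - t) * z x + t * z y"
  proof -
    have "(s0 - x) * ((z y - z x) / (y - x)) = t * (z y - z x)"
    proof -
      have "s0 - x = t * (y - x)" by (simp add: s0_def algebra_simps)
      then show ?thesis using xy by simp
    qed
    then show ?thesis by (simp add: ch_def algebra_simps)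
  qed
  have "ch s0 \<le> z s0"
  proof (rule ccontr)
    assume "\<not> ?thesis"
    then have neg: "z s0 - ch s0 < 0" by simp
    define q where "q = (s0 - x) * (y - s0)"
    have q: "q > 0" using s0 by (simp add: q_def)
    \<comment> \<open>With this value the sag uses up exactly half of the gap at \<open>s0\<close>,
      so \<open>u - f\<close> stays negative there.\<close>
    define \<epsilon> where "\<epsilon> = (ch s0 - z s0) / q"
    have eps: "\<epsilon> > 0" using neg q by (simp add: \<epsilon>_def)
    define f where "f s = G s + ch s - \<epsilon> / 2 * ((s - x) * (y - s))" for s
    define f' where "f' s = G' s + (z y - z x) / (y - x) - \<epsilon> / 2 * (x + y - 2 * s)" for s
    have cf: "continuous_on {x..y} f"
    proof -
      have "continuous_on {x..y} G"
        by (rule DERIV_continuous_on[where D=G'], rule has_field_derivative_at_within, rule G) (use xy in auto)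
      then show ?thesis unfolding f_def ch_def by (intro continuous_intros) (use xy in auto)
    qed
    have cu: "continuous_on {x..y} u" by (rule continuous_on_subset[OF cont]) (use xy in auto)
    have "\<exists>c\<in>{x..y}. \<forall>s\<in>{x..y}. u c - f c \<le> u s - f s"
      by (rule continuous_attains_inf) (use xy in \<open>auto intro!: continuous_intros cf cu\<close>)
    then obtain c where c: "c \<in> {x..y}" "\<And>s. s \<in> {x..y} \<Longrightarrow> u c - f c \<le> u s - f s" by auto
    have "u s0 - f s0 = z s0 - ch s0 + \<epsilon> / 2 * q" by (simp add: f_def z_def q_def)
    also have "\<dots> = (z s0 - ch s0) / 2" using q by (simp add: \<epsilon>_def field_simps)
    finally have "u c - f c < 0" using c(2)[of s0] s0 neg by auto
    moreover have "u x - f x = 0" "u y - f y = 0" using xy by (auto simp: f_def ch_def z_def)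
    ultimately have "c \<noteq> x" "c \<noteq> y" by auto
    with c have cxy: "x < c" "c < y" by auto
    have "subjet u c (f' c) (m c + \<epsilon> / 2)"
    proof (rule subjet_of_min[where U="{x<..<y}"])
      show "u c - f c \<le> u s - f s" if "s \<in> {x<..<y}" for s using c(2) that by auto
      show "(f has_real_derivative f' s) (at s)" if s: "s \<in> {x<..<y}" for s
        unfolding f_def f'_def ch_def
        by (rule derivative_eq_intros G refl | use s xy in force)+
      show "(f' has_real_derivative m c + \<epsilon>) (at c)"
        unfolding f'_def by (rule derivative_eq_intros G' refl | use cxy xy in force)+
    qed (use cxy eps in auto)
    then have "m c + \<epsilon> / 2 \<le> m c" using jet[of c "f' c" "m c + \<epsilon> / 2"] cxy xy by auto
    then show False using eps by simp
  qed
  then show "G ((1 - t) *\<^sub>R x + t *\<^sub>R y) - u ((1 - t) *\<^sub>R x + t *\<^sub>R y) \<le>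
      (1 - t) * (G x - u x) + t * (G y - u y)"
    unfolding chs0 by (simp add: s0_def z_def algebra_simps)
qed auto

lemma convex_on_supporting_line:
  fixes f :: "real \<Rightarrow> real"
  assumes "convex_on {al<..<be} f" "al < x" "x < be"
  obtains p where "\<And>y. al < y \<Longrightarrow> y < be \<Longrightarrow> f x + p * (y - x) \<le> f y"
  using convex_le_Inf_differential[OF assms(1), of x] assms by (force simp: interior_open)

section \<open>Real analysis\<close>

text \<open>Supporting lines of the two convex functions give an upper and a lower parabola through
  \<open>(x, u x)\<close>. Being ordered on both sides of \<open>x\<close> they must have the same
  slope, which is then the derivative with a quadratic error. With \<open>C = 0\<close> the
  conclusion says that \<open>u\<close> is affine.\<close>

lemma semiconcave_semiconvex_expansion:
  fixes u :: "real \<Rightarrow> real"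
  assumes c1: "convex_on {al<..<be} (\<lambda>x. C / 2 * x\<^sup>2 - u x)"
    and c2: "convex_on {al<..<be} (\<lambda>x. C / 2 * x\<^sup>2 + u x)"
  obtains p where "\<And>x y. al < x \<Longrightarrow> x < be \<Longrightarrow> al < y \<Longrightarrow> y < be \<Longrightarrow>
      \<bar>u y - u x - p x * (y - x)\<bar> \<le> C / 2 * (y - x)\<^sup>2"
proof -
  have "\<exists>p. \<forall>y. al < y \<longrightarrow> y < be \<longrightarrow> \<bar>u y - u x - p * (y - x)\<bar> \<le> C / 2 * (y - x)\<^sup>2"
    if x: "al < x" "x < be" for x
  proof -
    obtain s where s: "\<And>y. al < y \<Longrightarrow> y < be \<Longrightarrow>
        C / 2 * x\<^sup>2 - u x + s * (y - x) \<le> C / 2 * y\<^sup>2 - u y"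
      using convex_on_supporting_line[OF c1 x] by blast
    obtain r where r: "\<And>y. al < y \<Longrightarrow> y < be \<Longrightarrow>
        C / 2 * x\<^sup>2 + u x + r * (y - x) \<le> C / 2 * y\<^sup>2 + u y"
      using convex_on_supporting_line[OF c2 x] by blast
    define A where "A = C * x - s"
    define B where "B = r - C * x"
    have sq: "C / 2 * y\<^sup>2 = C / 2 * x\<^sup>2 + C * x * (y - x) + C / 2 * (y - x)\<^sup>2" for y
      by (simp add: power2_eq_square field_simps)
    have up: "u y \<le> u x + A * (y - x) + C / 2 * (y - x)\<^sup>2" if "al < y" "y < be" for y
      using s[OF that] sq[of y] by (simp add: A_def algebra_simps)
    have lo: "u x + B * (y - x) - C / 2 * (y - x)\<^sup>2 \<le> u y" if "al < y" "y < be" for y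
      using r[OF that] sq[of y] by (simp add: B_def algebra_simps)
    \<comment> \<open>The linear part of the upper parabola is touched from below by the lower one
      once both curvatures are put on one side; Fermat's rule then identifies the slopes.\<close>
    have "subjet (\<lambda>y. A * (y - x)) x B (- 2 * C)"
      unfolding subjet_def eventually_at_topological
      by (rule exI[of _ "{al<..<be}"]) (use x up lo in \<open>force\<close>)
    then have BA: "B = A"
      by (rule subjet_deriv_eq) (auto intro!: derivative_eq_intros)
    have "\<bar>u y - u x - A * (y - x)\<bar> \<le> C / 2 * (y - x)\<^sup>2" if "al < y" "y < be" for y
      using up[OF that] lo[OF that] unfolding abs_le_iff BA by linarith
    then show ?thesis by blast
  qed
  then show ?thesis using that by metis
qed

text \<open>A bounded function cannot decrease at rate \<open>c / a\<close> all the way to a zero of \<open>a\<close>, because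
  \<open>1 / a\<close> is not integrable there.\<close>

lemma no_bounded_descent_at_zero:
  fixes g g' a :: "real \<Rightarrow> real"
  assumes zx: "z < x" and c: "c > 0" and k: "k > 0"
    and a: "\<And>y. z < y \<Longrightarrow> y \<le> x \<Longrightarrow> 0 < a y \<and> a y \<le> k * (y - z)\<^sup>2"
    and g: "\<And>y. z < y \<Longrightarrow> y \<le> x \<Longrightarrow> (g has_real_derivative g' y) (at y)"
    and g': "\<And>y. z < y \<Longrightarrow> y \<le> x \<Longrightarrow> g' y \<le> - c / a y"
    and B: "\<And>y. \<bar>g y\<bar> \<le> B"
  shows False
proof -
  \<comment> \<open>\<open>- (c / k) / (y - z)\<close> is the explicit primitive of
    \<open>(c / k) / (y - z)^2\<close>, a lower bound for \<open>c / a\<close>; adding it leaves a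
    nonincreasing function.\<close>
  define f where "f y = g y - (c / k) * inverse (y - z)" for y
  have mono: "f x \<le> f y" if y: "z < y" "y \<le> x" for y
  proof (rule DERIV_nonpos_imp_nonincreasing[OF y(2)])
    fix t assume t: "y \<le> t" "t \<le> x"
    then have tz: "z < t" using y by simp
    have "(f has_real_derivative g' t + (c / k) * inverse ((t - z)\<^sup>2)) (at t)"
      unfolding f_def using tz
      by (auto intro!: derivative_eq_intros g t simp: power2_eq_square k[THEN less_imp_neq, symmetric])
    moreover have "(c / k) * inverse ((t - z)\<^sup>2) \<le> c / a t"
    proof -
      have "c / (k * (t - z)\<^sup>2) \<le> c / a t"
        using a[OF tz t(2)] c k tz by (intro divide_left_mono mult_pos_pos) auto
      then show ?thesis by (simp add: field_simps)
    qed
    ultimately show "\<exists>d. (f has_real_derivative d) (at t) \<and> d \<le> 0"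
      using g'[OF tz t(2)] by force
  qed
  define Q where "Q = 2 * B + (c / k) * inverse (x - z)"
  have B0: "B \<ge> 0" using B[of x] by linarith
  have Q: "Q \<ge> 0" using B0 c k zx by (simp add: Q_def)
  \<comment> \<open>Monotonicity gives \<open>(c / k) / h \<le> Q\<close> at the point
    \<open>z + h\<close>; this \<open>h\<close> makes \<open>Q * h < c / k\<close>.\<close>
  define h where "h = min (x - z) ((c / k) / (Q + 1))"
  have h: "h > 0" using zx c k Q by (simp add: h_def)
  have "f x \<le> f (z + h)" using mono[of "z + h"] h by (simp add: h_def)
  then have "(c / k) * inverse h \<le> Q"
    using B[of x] B[of "z + h"] by (simp add: f_def Q_def)
  then have "(c / k) / h \<le> Q" by (simp add: divide_inverse)
  then have "c / k \<le> Q * h" using h by (simp only: pos_divide_le_eq)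
  also have "\<dots> \<le> Q * ((c / k) / (Q + 1))" using Q by (intro mult_left_mono) (auto simp: h_def)
  also have "\<dots> = (c / k) * (Q / (Q + 1))" by simp
  also have "\<dots> < (c / k) * 1" using Q c k by (intro mult_strict_left_mono) auto
  finally show False by simp
qed

section \<open>One-dimensional comparison principles\<close>

lemma last_nonpos_point:
  fixes D :: "real \<Rightarrow> real"
  assumes "continuous_on {c..d} D" "c \<le> d" "D c \<le> 0" "D d > 0"
  obtains y where "c \<le> y" "y < d" "D y = 0" "\<And>x. y < x \<Longrightarrow> x \<le> d \<Longrightarrow> D x > 0"
proof -
  define S where "S = {x \<in> {c..d}. D x \<le> 0}"
  have "closed S" unfolding S_def
    by (intro continuous_closed_preimage_constant continuous_on_closed_Collect_le assms) auto
  then have "compact S" unfolding S_def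
    by (metis (no_types, lifting) S_def bounded_closed_interval bounded_subset compact_eq_bounded_closed mem_Collect_eq subsetI)
  moreover have "S \<noteq> {}" using assms by (auto simp: S_def)
  ultimately obtain y where y: "y \<in> S" "\<And>x. x \<in> S \<Longrightarrow> x \<le> y"
    using compact_attains_sup by metis
  have pos: "D x > 0" if "y < x" "x \<le> d" for x
  proof (rule ccontr)
    assume "\<not> ?thesis"
    then have "x \<in> S" using y(1) that by (auto simp: S_def)
    then show False using y(2) that by force
  qed
  have yd: "c \<le> y" "D y \<le> 0" "y \<le> d" "y \<noteq> d" using y(1) assms(4) by (auto simp: S_def)
  then have "y < d" by simp
  have "D y = 0"
  proof (rule ccontr)
    assume "D y \<noteq> 0"
    then have neg: "D y < 0" using yd by simp
    have "\<exists>x. y \<le> x \<and> x \<le> d \<and> D x = 0"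
      by (rule IVT') (use yd neg assms in \<open>auto intro: continuous_on_subset\<close>)
    then obtain x where x: "y \<le> x" "x \<le> d" "D x = 0" by blast
    then have "y < x" using neg by (cases "x = y") auto
    then show False using pos[of x] x by simp
  qed
  then show ?thesis using that yd \<open>y < d\<close> pos by blast
qed

text \<open>The differential inequality is demanded only where \<open>D\<close> is positive, that
  is, where the two slopes being compared are in the wrong order. After the last zero of
  \<open>D\<close> the function \<open>exp (- M * x) * D x\<close> cannot increase from its value
  0.\<close>

lemma gronwall_nonpos:
  fixes D :: "real \<Rightarrow> real"
  assumes cont: "continuous_on {c..d} D" and cd: "c \<le> d" and D0: "D c \<le> 0"
    and der: "\<And>x. c < x \<Longrightarrow> x < d \<Longrightarrow> D x > 0 \<Longrightarrow>
        \<exists>D'. (D has_real_derivative D') (at x) \<and> D' \<le> M * D x"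
  shows "D d \<le> 0"
proof (rule ccontr)
  assume "\<not> ?thesis"
  then have "D d > 0" by simp
  from last_nonpos_point[OF cont cd D0 this]
  obtain y where y: "c \<le> y" "y < d" "D y = 0" "\<And>x. y < x \<Longrightarrow> x \<le> d \<Longrightarrow> D x > 0" by metis
  define E where "E x = exp (- M * x) * D x" for x
  have dE: "\<exists>E'. (E has_real_derivative E') (at x) \<and> E' \<le> 0" if x: "y < x" "x < d" for x
  proof -
    obtain D' where D': "(D has_real_derivative D') (at x)" "D' \<le> M * D x"
      using der[of x] x y by auto
    have "(E has_real_derivative exp (- M * x) * (D' - M * D x)) (at x)"
      unfolding E_def by (rule derivative_eq_intros D' refl)+ (simp add: algebra_simps)
    then show ?thesis using D'(2) by (force simp: mult_le_0_iff)
  qed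
  have "\<exists>l z. y < z \<and> z < d \<and> DERIV E z :> l \<and> E d - E y = (d - y) * l"
  proof (rule MVT[OF y(2)])
    show "continuous_on {y..d} E" unfolding E_def
      by (intro continuous_intros continuous_on_subset[OF cont]) (use y in auto)
    show "E differentiable at x" if "y < x" "x < d" for x
      using dE[OF that] by (auto simp: real_differentiable_def)
  qed
  then obtain l z where z: "y < z" "z < d" "DERIV E z :> l" "E d - E y = (d - y) * l" by auto
  have "l \<le> 0" using dE[OF z(1,2)] z(3) DERIV_unique by blast
  then have "(d - y) * l \<le> 0" using y by (simp add: mult_nonneg_nonpos)
  then have "E d \<le> E y" using z by simp
  then show False using y(2-4) by (simp add: E_def mult_le_0_iff not_less[symmetric])
qed

text \<open>A descent from \<open>f x\<close> to \<open>f y\<close> survives a small upward tilt,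
  after which the derivative is at least \<open>e > 0\<close> off a null set \<open>N\<close>. A
  locally Lipschitz image of a null set is null, so some level \<open>c\<close> in the gap is
  attained only off \<open>N\<close>. After the last crossing of that level the tilted function
  stays below it, yet its derivative at the crossing is positive.\<close>

lemma locally_Lipschitz_AE_deriv_nonneg_imp_mono:
  fixes f :: "real \<Rightarrow> real"
  assumes lip: "\<And>x. \<exists>d>0. \<exists>B. \<forall>y. \<bar>y - x\<bar> < d \<longrightarrow> \<bar>f y - f x\<bar> \<le> B * \<bar>y - x\<bar>"
    and ae: "AE x in lborel. \<exists>D\<ge>0. (f has_real_derivative D) (at x)"
    and xy: "x \<le> y"
  shows "f x \<le> f y"
proof (rule ccontr)
  assume "\<not> ?thesis"
  then have less: "f y < f x" and xy: "x < y" using xy by (auto simp: order_le_less)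
  obtain N where N: "N \<in> null_sets lborel"
    "\<And>t. t \<notin> N \<Longrightarrow> \<exists>D\<ge>0. (f has_real_derivative D) (at t)"
  proof -
    obtain N where "N \<in> null_sets lborel" "{t. \<not> (\<exists>D\<ge>0. (f has_real_derivative D) (at t))} \<subseteq> N"
      using ae unfolding eventually_ae_filter by auto
    then show thesis using that by blast
  qed
  have negN: "negligible N" using N(1) negligible_iff_null_sets null_sets_completionI by blast
  \<comment> \<open>Half the mean descent: the tilt consumes half of
    \<open>f x - f y\<close>.\<close>
  define e where "e = (f x - f y) / (2 * (y - x))"
  have e: "e > 0" using less xy by (simp add: e_def)
  define F where "F t = f t + e * t" for t
  have "F x - F y = (f x - f y) - e * (y - x)" by (simp add: F_def algebra_simps)
  also have "\<dots> = (f x - f y) / 2" using xy by (simp add: e_def field_simps)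
  finally have Fxy: "F y < F x" using less by simp
  have lipF: "\<exists>d>0. \<exists>B. \<forall>y. \<bar>y - x\<bar> < d \<longrightarrow> \<bar>F y - F x\<bar> \<le> B * \<bar>y - x\<bar>" for x
  proof -
    obtain d B where d: "d > 0" "\<And>y. \<bar>y - x\<bar> < d \<Longrightarrow> \<bar>f y - f x\<bar> \<le> B * \<bar>y - x\<bar>"
      using lip by blast
    have "\<bar>F y - F x\<bar> \<le> (B + e) * \<bar>y - x\<bar>" if "\<bar>y - x\<bar> < d" for y
    proof -
      have "\<bar>F y - F x\<bar> \<le> \<bar>f y - f x\<bar> + \<bar>e * (y - x)\<bar>" by (simp add: F_def algebra_simps abs_if)
      also have "\<bar>e * (y - x)\<bar> = e * \<bar>y - x\<bar>" using e by (simp add: abs_mult)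
      finally show ?thesis using d(2)[OF that] by (simp add: distrib_right)
    qed
    then show ?thesis using d(1) by blast
  qed
  have "negligible (F ` N)"
  proof (rule negligible_locally_Lipschitz_image[OF _ negN])
    fix x
    obtain d B where d: "d > 0" "\<And>y. \<bar>y - x\<bar> < d \<Longrightarrow> \<bar>F y - F x\<bar> \<le> B * \<bar>y - x\<bar>"
      using lipF by blast
    then show "\<exists>T B. open T \<and> x \<in> T \<and> (\<forall>y\<in>N \<inter> T. norm (F y - F x) \<le> B * norm (y - x))"
      by (intro exI[of _ "ball x d"] exI[of _ B]) (auto simp: dist_real_def abs_minus_commute)
  qed simp
  moreover have "\<not> negligible {F y<..<F x}" using Fxy by (intro open_not_negligible) auto
  ultimately obtain c where c: "F y < c" "c < F x" "c \<notin> F ` N"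
    using negligible_subset by (metis greaterThanLessThan_iff subsetI)
  have contF: "continuous_on UNIV F"
    unfolding continuous_on_iff
  proof (intro ballI allI impI)
    fix t \<epsilon> :: real assume eps: "\<epsilon> > 0"
    obtain d B where d: "d > 0" "\<And>y. \<bar>y - t\<bar> < d \<Longrightarrow> \<bar>F y - F t\<bar> \<le> B * \<bar>y - t\<bar>"
      using lipF by blast
    define r where "r = min d (\<epsilon> / (\<bar>B\<bar> + 1))"
    have "\<bar>F s - F t\<bar> < \<epsilon>" if s: "\<bar>s - t\<bar> < r" for s
    proof -
      have "\<bar>F s - F t\<bar> \<le> B * \<bar>s - t\<bar>" using d(2) s by (simp add: r_def)
      also have "\<dots> \<le> (\<bar>B\<bar> + 1) * \<bar>s - t\<bar>" by (intro mult_right_mono) auto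
      also have "\<dots> < (\<bar>B\<bar> + 1) * (\<epsilon> / (\<bar>B\<bar> + 1))"
        using s by (intro mult_strict_left_mono) (auto simp: r_def)
      also have "\<dots> = \<epsilon>" by simp
      finally show ?thesis .
    qed
    moreover have "r > 0" using d eps by (simp add: r_def)
    ultimately show "\<exists>d>0. \<forall>s\<in>UNIV. dist s t < d \<longrightarrow> dist (F s) (F t) < \<epsilon>"
      by (auto simp: dist_real_def)
  qed
  have "continuous_on {x..y} (\<lambda>t. c - F t)"
    by (intro continuous_intros continuous_on_subset[OF contF]) auto
  from last_nonpos_point[OF this] c xy
  obtain t where t: "x \<le> t" "t < y" "c - F t = 0" "\<And>s. t < s \<Longrightarrow> s \<le> y \<Longrightarrow> c - F s > 0"
    by (smt (verit))
  have "t \<notin> N" using c t by force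
  then obtain D where D: "D \<ge> 0" "(f has_real_derivative D) (at t)" using N by blast
  have "(F has_real_derivative D + e) (at t)"
    unfolding F_def by (rule derivative_eq_intros D refl)+ simp
  from DERIV_pos_inc_right[OF this] D e obtain d where
    d: "d > 0" "\<And>h. 0 < h \<Longrightarrow> h < d \<Longrightarrow> F t < F (t + h)" by auto
  define h where "h = min (d / 2) (y - t)"
  have "0 < h" "h < d" "t + h \<le> y" using d t by (auto simp: h_def)
  then show False using d(2)[of h] t(3) t(4)[of "t + h"] by auto
qed

text \<open>If both alternatives fail, \<open>f\<close> rises somewhere to the left of
  \<open>z\<close> and falls somewhere to the right, so its maximum over the span of these two
  places is interior, hence local.\<close>

lemma no_local_max_dichotomy:
  fixes f :: "real \<Rightarrow> real"
  assumes cont: "continuous_on {al<..<be} f"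
    and nomax: "\<And>x. al < x \<Longrightarrow> x < be \<Longrightarrow> \<not> (\<forall>\<^sub>F y in at x. f y \<le> f x)"
  shows "(\<forall>x y. z \<le> x \<longrightarrow> x \<le> y \<longrightarrow> al < x \<longrightarrow> y < be \<longrightarrow> f x \<le> f y) \<or>
         (\<forall>x y. al < x \<longrightarrow> x \<le> y \<longrightarrow> y \<le> z \<longrightarrow> y < be \<longrightarrow> f y \<le> f x)"
proof (rule ccontr)
  assume "\<not> ?thesis"
  then obtain x x' y y' where x: "z \<le> x" "x \<le> x'" "al < x" "x' < be" "f x' < f x"
    and y: "al < y" "y \<le> y'" "y' \<le> z" "y' < be" "f y < f y'"
    by (auto simp: not_le)
  have "\<exists>c\<in>{y..x'}. \<forall>t\<in>{y..x'}. f t \<le> f c"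
    by (rule continuous_attains_sup) (use x y in \<open>auto intro: continuous_on_subset[OF cont]\<close>)
  then obtain c where c: "c \<in> {y..x'}" "\<And>t. t \<in> {y..x'} \<Longrightarrow> f t \<le> f c" by auto
  have "f x \<le> f c" "f y' \<le> f c" using c(2) x y by auto
  then have "c \<noteq> y" "c \<noteq> x'" using x y by auto
  then have cc: "y < c" "c < x'" using c by auto
  have "\<forall>\<^sub>F t in at c. t \<in> {y<..<x'}" using cc by (intro eventually_at_in_open') auto
  then have "\<forall>\<^sub>F t in at c. f t \<le> f c" by eventually_elim (use c in auto)
  then show False using nomax cc x y by force
qed

lemma countable_if_isolated:
  fixes D :: "real set"
  assumes "\<And>y. y \<in> D \<Longrightarrow> \<exists>d>0. \<forall>z\<in>D. \<bar>z - y\<bar> < d \<longrightarrow> z = y"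
  shows "countable D"
proof -
  have "\<exists>n r. \<bar>y - of_rat r\<bar> < 1 / (2 * real (Suc n)) \<and> (\<forall>z\<in>D. \<bar>z - y\<bar> < 1 / real (Suc n) \<longrightarrow> z = y)"
    if y: "y \<in> D" for y
  proof -
    obtain d where d: "d > 0" "\<forall>z\<in>D. \<bar>z - y\<bar> < d \<longrightarrow> z = y" using assms[OF y] by blast
    obtain n where n: "inverse (real (Suc n)) < d" using reals_Archimedean[OF d(1)] by blast
    obtain r where "y - 1 / (2 * real (Suc n)) < of_rat r" "of_rat r < y + 1 / (2 * real (Suc n))"
      using of_rat_dense[of "y - 1 / (2 * real (Suc n))" "y + 1 / (2 * real (Suc n))"] by auto
    then have "\<bar>y - of_rat r\<bar> < 1 / (2 * real (Suc n))" by linarith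
    moreover have "1 / real (Suc n) < d" using n by (simp add: inverse_eq_divide)
    ultimately show ?thesis using d(2) by (intro exI[of _ n] exI[of _ r]) force
  qed
  then obtain n r where nr: "\<And>y. y \<in> D \<Longrightarrow> \<bar>y - of_rat (r y)\<bar> < 1 / (2 * real (Suc (n y)))"
    "\<And>y z. y \<in> D \<Longrightarrow> z \<in> D \<Longrightarrow> \<bar>z - y\<bar> < 1 / real (Suc (n y)) \<Longrightarrow> z = y"
    by metis
  have "inj_on (\<lambda>y. (n y, r y :: rat)) D"
  proof (rule inj_onI)
    fix y z assume yz: "y \<in> D" "z \<in> D" "(n y, r y) = (n z, r z)"
    have "\<bar>z - y\<bar> < 1 / (2 * real (Suc (n y))) + 1 / (2 * real (Suc (n y)))"
      using nr(1)[OF yz(1)] nr(1)[OF yz(2)] yz(3) by auto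
    also have "\<dots> = 1 / real (Suc (n y))" by (simp add: field_simps)
    finally show "y = z" using nr(2)[OF yz(1,2)] by simp
  qed
  then show ?thesis by (rule countableI')
qed

text \<open>The right-hand side is globally Lipschitz in \<open>p\<close>, so the solution exists on
  all of \<open>{c..d}\<close>. Measuring increments of the iterates against
  \<open>exp (2 * L * (x - c))\<close> makes each Picard step gain a factor 1/2 whatever the length
  of the interval.\<close>

lemma picard_lindelof_real:
  fixes G :: "real \<Rightarrow> real \<Rightarrow> real"
  assumes cd: "c \<le> d" and L: "L > 0"
    and contG: "continuous_on ({c..d} \<times> UNIV) (\<lambda>(x, p). G x p)"
    and lip: "\<And>x p q. c \<le> x \<Longrightarrow> x \<le> d \<Longrightarrow> \<bar>G x p - G x q\<bar> \<le> L * \<bar>p - q\<bar>"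
  obtains p where "continuous_on {c..d} p" "p c = p0"
    "\<And>x. c < x \<Longrightarrow> x < d \<Longrightarrow> (p has_real_derivative G x (p x)) (at x)"
proof -
  define \<Phi> where "\<Phi> f x = p0 + integral {c..x} (\<lambda>s. G s (f s))" for f x
  define P where "P n = (\<Phi> ^^ n) (\<lambda>_. p0)" for n
  have PS: "P (Suc n) x = p0 + integral {c..x} (\<lambda>s. G s (P n s))" for n x
    by (simp add: P_def \<Phi>_def)
  have compc: "continuous_on {c..d} (\<lambda>s. G s (f s))" if "continuous_on {c..d} f" for f
    using continuous_on_compose2[OF contG continuous_on_Pair[OF continuous_on_id that]] by auto
  have Pc: "continuous_on {c..d} (P n)" for n
  proof (induction n)
    case 0 show ?case by (simp add: P_def)
  next
    case (Suc n)
    have "continuous_on {c..d} (\<lambda>x. p0 + integral {c..x} (\<lambda>s. G s (P n s)))"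
      by (intro continuous_intros indefinite_integral_continuous_1 integrable_continuous_real compc Suc)
    then show ?case by (simp add: PS[abs_def])
  qed
  have Gint: "(\<lambda>s. G s (P n s)) integrable_on {c..x}" if "x \<le> d" for n x
    by (rule integrable_continuous_real, rule continuous_on_subset[OF compc[OF Pc]]) (use that in auto)
  have "bounded ((\<lambda>x. P 1 x - P 0 x) ` {c..d})"
    by (intro compact_imp_bounded compact_continuous_image continuous_intros Pc) auto
  then obtain B where B: "\<And>x. x \<in> {c..d} \<Longrightarrow> \<bar>P 1 x - P 0 x\<bar> \<le> B"
    unfolding bounded_iff by (metis imageI real_norm_def)
  have B0: "B \<ge> 0" using B[of c] cd by auto
  have est: "\<bar>P (Suc n) x - P n x\<bar> \<le> B / 2 ^ n * exp (2 * L * (x - c))" if x: "c \<le> x" "x \<le> d" for n x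
    using x
  proof (induction n arbitrary: x)
    case 0
    have "B * 1 \<le> B * exp (2 * L * (x - c))" using B0 L 0 by (intro mult_left_mono) auto
    then show ?case using B[of x] 0 by auto
  next
    case (Suc n)
    define F where "F s = B / 2 ^ Suc n * exp (2 * L * (s - c))" for s
    have FI: "((\<lambda>s. L * (B / 2 ^ n * exp (2 * L * (s - c)))) has_integral (F x - F c)) {c..x}"
    proof (rule fundamental_theorem_of_calculus[OF Suc.prems(1)])
      fix s
      have "(F has_real_derivative L * (B / 2 ^ n * exp (2 * L * (s - c)))) (at s)"
        unfolding F_def by (auto intro!: derivative_eq_intros)
      then show "(F has_vector_derivative L * (B / 2 ^ n * exp (2 * L * (s - c)))) (at s within {c..x})"
        by (simp add: has_real_derivative_iff_has_vector_derivative has_vector_derivative_at_within)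
    qed
    have "P (Suc (Suc n)) x - P (Suc n) x = integral {c..x} (\<lambda>s. G s (P (Suc n) s) - G s (P n s))"
      unfolding PS[of "Suc n" x] PS[of n x] using integral_diff[OF Gint Gint] Suc.prems by simp
    also have "norm \<dots> \<le> integral {c..x} (\<lambda>s. L * (B / 2 ^ n * exp (2 * L * (s - c))))"
    proof (rule integral_norm_bound_integral)
      fix s assume s: "s \<in> {c..x}"
      have "\<bar>G s (P (Suc n) s) - G s (P n s)\<bar> \<le> L * \<bar>P (Suc n) s - P n s\<bar>"
        using lip s Suc.prems by auto
      also have "\<dots> \<le> L * (B / 2 ^ n * exp (2 * L * (s - c)))"
        using L s Suc.prems by (intro mult_left_mono Suc.IH) auto
      finally show "norm (G s (P (Suc n) s) - G s (P n s)) \<le> L * (B / 2 ^ n * exp (2 * L * (s - c)))"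
        by simp
    qed (use Suc.prems FI Gint in \<open>auto intro!: integrable_diff\<close>)
    also have "\<dots> = F x - F c" using FI by (rule integral_unique)
    also have "\<dots> \<le> F x" using B0 by (simp add: F_def)
    finally show ?case by (simp add: F_def)
  qed
  define E where "E = exp (2 * L * (d - c))"
  define Q where "Q x = p0 + (\<Sum>i. P (Suc i) x - P i x)" for x
  have ul0: "uniform_limit {c..d} (\<lambda>n x. \<Sum>i<n. P (Suc i) x - P i x) (\<lambda>x. \<Sum>i. P (Suc i) x - P i x) sequentially"
  proof (rule Weierstrass_m_test)
    show "summable (\<lambda>n. B * E * (1 / 2) ^ n)" by (intro summable_mult summable_geometric) auto
    fix n x assume x: "x \<in> {c..d}"
    have "B / 2 ^ n * exp (2 * L * (x - c)) \<le> B / 2 ^ n * E"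
      using x B0 L by (intro mult_left_mono) (auto simp: E_def)
    then show "norm (P (Suc n) x - P n x) \<le> B * E * (1 / 2) ^ n"
      using est[of x n] x by (simp add: power_divide)
  qed
  have "P n x = p0 + (\<Sum>i<n. P (Suc i) x - P i x)" for n x
    using sum_lessThan_telescope[of "\<lambda>i. P i x" n] by (simp add: P_def del: funpow.simps(2))
  then have "P = (\<lambda>n x. p0 + (\<Sum>i<n. P (Suc i) x - P i x))" by blast
  moreover have "uniform_limit {c..d} (\<lambda>n x. p0 + (\<Sum>i<n. P (Suc i) x - P i x)) Q sequentially"
    unfolding Q_def[abs_def] by (intro uniform_limit_add ul0 uniform_limit_const)
  ultimately have ul: "uniform_limit {c..d} P Q sequentially" by simp
  have Qc: "continuous_on {c..d} Q"
    by (rule uniform_limit_theorem[OF _ ul]) (auto simp: Pc)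
  have ulG: "uniform_limit {c..d} (\<lambda>n s. G s (P n s)) (\<lambda>s. G s (Q s)) sequentially"
  proof (rule uniform_limitI)
    fix e :: real assume e: "e > 0"
    have "\<forall>\<^sub>F n in sequentially. \<forall>x\<in>{c..d}. dist (P n x) (Q x) < e / L"
      using uniform_limitD[OF ul, of "e / L"] e L by simp
    then show "\<forall>\<^sub>F n in sequentially. \<forall>x\<in>{c..d}. dist (G x (P n x)) (G x (Q x)) < e"
    proof eventually_elim
      case (elim n)
      show ?case
      proof
        fix x assume x: "x \<in> {c..d}"
        have "\<bar>G x (P n x) - G x (Q x)\<bar> \<le> L * \<bar>P n x - Q x\<bar>" using lip x by auto
        also have "\<dots> < L * (e / L)"
          using elim x L by (intro mult_strict_left_mono) (auto simp: dist_real_def)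
        finally show "dist (G x (P n x)) (G x (Q x)) < e" using L by (simp add: dist_real_def)
      qed
    qed
  qed
  have Qeq: "Q x = p0 + integral {c..x} (\<lambda>s. G s (Q s))" if x: "x \<in> {c..d}" for x
  proof -
    have u: "uniform_limit {c..x} (\<lambda>n s. G s (P n s)) (\<lambda>s. G s (Q s)) sequentially"
      by (rule uniform_limit_on_subset[OF ulG]) (use x in auto)
    have cc: "continuous_on {c..x} (\<lambda>s. G s (P n s))" for n
      by (rule continuous_on_subset[OF compc[OF Pc]]) (use x in auto)
    obtain I J where IJ: "\<And>n. ((\<lambda>s. G s (P n s)) has_integral I n) {c..x}"
      "((\<lambda>s. G s (Q s)) has_integral J) {c..x}" "I \<longlonglongrightarrow> J"
      using uniform_limit_integral[OF u cc] by auto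
    have "P (Suc n) x = p0 + I n" for n using IJ(1)[of n] by (simp add: PS integral_unique)
    then have "(\<lambda>n. P (Suc n) x) \<longlonglongrightarrow> p0 + J" using IJ(3) by (auto intro: tendsto_intros)
    moreover have "(\<lambda>n. P (Suc n) x) \<longlonglongrightarrow> Q x"
      using tendsto_uniform_limitI[OF ul x] by (rule LIMSEQ_Suc)
    ultimately show ?thesis using LIMSEQ_unique IJ(2) by (metis integral_unique)
  qed
  show ?thesis
  proof
    show "continuous_on {c..d} Q" by fact
    show "Q c = p0" using Qeq[of c] cd by simp
    fix x assume x: "c < x" "x < d"
    have "((\<lambda>x. p0 + integral {c..x} (\<lambda>s. G s (Q s))) has_real_derivative 0 + G x (Q x)) (at x within {c..d})"
      by (intro DERIV_add integral_has_real_derivative compc Qc) (use x in auto)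
    then have "((\<lambda>x. p0 + integral {c..x} (\<lambda>s. G s (Q s))) has_real_derivative G x (Q x)) (at x)"
      using x by (simp add: at_within_Icc_at)
    then show "(Q has_real_derivative G x (Q x)) (at x)"
      by (rule has_field_derivative_transform_within_open[where S="{c<..<d}"]) (use x Qeq in auto)
  qed
qed

section \<open>Viscosity solutions and touching parabolas\<close>

lemma superjet_slope_lower_bound:
  assumes "superjet u x p X" "\<forall>\<^sub>F y in at_right x. m * (y - x) \<le> u y - u x"
  shows "m \<le> p"
proof -
  have "\<forall>\<^sub>F y in at_right x. u y \<le> u x + p * (y - x) + X / 2 * (y - x)\<^sup>2"
    using assms(1) unfolding superjet_altdef by (rule filter_leD[OF at_le, rotated]) simp
  moreover have "\<forall>\<^sub>F y in at_right x. x < y" by (simp add: eventually_at_right_less)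
  ultimately have "\<forall>\<^sub>F y in at_right x. m \<le> p + X / 2 * (y - x)"
    using assms(2)
  proof eventually_elim
    case (elim y)
    have "(p + X / 2 * (y - x)) * (y - x) = p * (y - x) + X / 2 * (y - x)\<^sup>2"
      by (simp add: power2_eq_square distrib_right)
    then have "m * (y - x) \<le> (p + X / 2 * (y - x)) * (y - x)" using elim by linarith
    then show ?case using elim by simp
  qed
  moreover have "((\<lambda>y. p + X / 2 * (y - x)) \<longlongrightarrow> p + X / 2 * (x - x)) (at_right x)"
    by (intro tendsto_intros)
  ultimately show ?thesis
    using tendsto_lowerbound[of _ _ "at_right x" m] by force
qed

lemma superjet_slope_upper_bound:
  assumes "superjet u x p X" "\<forall>\<^sub>F y in at_left x. u x - u y \<le> m * (x - y)"
  shows "p \<le> m"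
proof -
  have "\<forall>\<^sub>F y in at_left x. u y \<le> u x + p * (y - x) + X / 2 * (y - x)\<^sup>2"
    using assms(1) unfolding superjet_altdef by (rule filter_leD[OF at_le, rotated]) simp
  moreover have "\<forall>\<^sub>F y in at_left x. y < x" by (simp add: eventually_at_left_real eventually_at_filter)
  ultimately have "\<forall>\<^sub>F y in at_left x. p + X / 2 * (y - x) \<le> m"
    using assms(2)
  proof eventually_elim
    case (elim y)
    have "(p + X / 2 * (y - x)) * (x - y) = - ((p + X / 2 * (y - x)) * (y - x))"
      by (metis minus_diff_eq mult_minus_right)
    also have "\<dots> = - (p * (y - x) + X / 2 * (y - x)\<^sup>2)"
      by (simp add: power2_eq_square distrib_right)
    finally have "(p + X / 2 * (y - x)) * (x - y) = - (p * (y - x) + X / 2 * (y - x)\<^sup>2)" .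
    then have "(p + X / 2 * (y - x)) * (x - y) \<le> m * (x - y)" using elim by linarith
    then show ?case using elim by simp
  qed
  moreover have "((\<lambda>y. p + X / 2 * (y - x)) \<longlongrightarrow> p + X / 2 * (x - x)) (at_left x)"
    by (intro tendsto_intros)
  ultimately show ?thesis
    using tendsto_upperbound[of _ _ "at_left x" m] by force
qed

lemma subjet_superjet_order:
  assumes "subjet u x p X" "superjet u x p Y"
  shows "X \<le> Y"
proof (rule ccontr)
  assume "\<not> X \<le> Y"
  have "\<forall>\<^sub>F y in at x. y \<noteq> x" by (simp add: eventually_neq_at_within)
  with assms(1) assms(2)[unfolded superjet_altdef] have "\<forall>\<^sub>F y in at x. False"
    unfolding subjet_def
  proof eventually_elim
    case (elim y)
    then have "X / 2 * (y - x)\<^sup>2 \<le> Y / 2 * (y - x)\<^sup>2" by linarith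
    then show ?case using elim \<open>\<not> X \<le> Y\<close> by simp
  qed
  then show False by simp
qed

lemma jets_of_C2:
  assumes d: "\<forall>\<^sub>F y in nhds x. (f has_real_derivative f' y) (at y)"
    and d2: "(f' has_real_derivative D) (at x)"
  shows "X < D \<Longrightarrow> subjet f x (f' x) X" and "D < X \<Longrightarrow> superjet f x (f' x) X"
proof -
  show "X < D \<Longrightarrow> subjet f x (f' x) X" unfolding subjet_def by (rule taylor_lower[OF d d2])
  have "\<forall>\<^sub>F y in nhds x. ((\<lambda>y. - f y) has_real_derivative - f' y) (at y)"
    using d by eventually_elim (auto intro: derivative_intros)
  moreover have "((\<lambda>y. - f' y) has_real_derivative - D) (at x)" using d2 by (auto intro: derivative_intros)
  ultimately show "D < X \<Longrightarrow> superjet f x (f' x) X"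
    unfolding superjet_def subjet_def by (rule taylor_lower) simp
qed

lemma C2_on_parabola: "C2_on UNIV (\<lambda>y. c + p * (y - x) + X / 2 * (y - x)\<^sup>2)"
  and deriv_parabola: "deriv (\<lambda>y. c + p * (y - x) + X / 2 * (y - x)\<^sup>2) = (\<lambda>y. p + X * (y - x))"
  and deriv2_parabola: "deriv (deriv (\<lambda>y. c + p * (y - x) + X / 2 * (y - x)\<^sup>2)) = (\<lambda>_. X)"
proof -
  let ?f = "\<lambda>y. c + p * (y - x) + X / 2 * (y - x)\<^sup>2"
  have 1: "(?f has_real_derivative p + X * (y - x)) (at y)" for y
    by (auto intro!: derivative_eq_intros)
  have 2: "((\<lambda>y. p + X * (y - x)) has_real_derivative X) (at y)" for y
    by (auto intro!: derivative_eq_intros)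
  show "C2_on UNIV ?f" unfolding C2_on_def
    by (intro exI[of _ "\<lambda>y. p + X * (y - x)"] exI[of _ "\<lambda>_. X"] conjI ballI 1 2 continuous_on_const)
  show e: "deriv ?f = (\<lambda>y. p + X * (y - x))" using 1 by (auto intro: DERIV_imp_deriv)
  show "deriv (deriv ?f) = (\<lambda>_. X)" unfolding e using 2 by (auto intro: DERIV_imp_deriv)
qed

lemma C2_on_UNIV_derivs:
  assumes "C2_on UNIV f"
  shows "(f has_real_derivative deriv f x) (at x)"
    and "(deriv f has_real_derivative deriv (deriv f) x) (at x)"
proof -
  obtain f' f'' where 1: "\<And>x. (f has_real_derivative f' x) (at x)"
    and 2: "\<And>x. (f' has_real_derivative f'' x) (at x)"
    using assms unfolding C2_on_def by auto
  have "deriv f = f'" using 1 by (auto intro: DERIV_imp_deriv)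
  moreover have "deriv f' = f''" using 2 by (auto intro: DERIV_imp_deriv)
  ultimately show "(f has_real_derivative deriv f x) (at x)"
    and "(deriv f has_real_derivative deriv (deriv f) x) (at x)"
    using 1 2 by auto
qed

text \<open>Touching parabolas are themselves C2 test functions. Conversely a test function yields
  jets for every \<open>X\<close> below its second derivative, and the inequality is continuous in
  \<open>X\<close>.\<close>

lemma visc_super_iff_subjet:
  assumes a: "\<And>x. 0 \<le> a x"
  shows "visc_super a H lam u \<longleftrightarrow> continuous_on UNIV u \<and>
     (\<forall>x p X. subjet u x p X \<longrightarrow> a x * X + H x p \<le> lam)"
proof (intro iffI conjI allI impI)
  assume vs: "visc_super a H lam u"
  then show "continuous_on UNIV u" by (simp add: visc_super_def)
  fix x p X assume j: "subjet u x p X"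
  let ?f = "\<lambda>y. u x + p * (y - x) + X / 2 * (y - x)\<^sup>2"
  have "a x * deriv (deriv ?f) x + H x (deriv ?f x) \<le> lam"
    by (rule vs[unfolded visc_super_def, THEN conjunct2, rule_format])
       (use j[unfolded subjet_def] C2_on_parabola in simp)
  then show "a x * X + H x p \<le> lam" by (simp only: deriv2_parabola) (simp only: deriv_parabola, simp)
next
  assume A: "continuous_on UNIV u \<and> (\<forall>x p X. subjet u x p X \<longrightarrow> a x * X + H x p \<le> lam)"
  show "visc_super a H lam u" unfolding visc_super_def
  proof (intro conjI allI impI)
    show "continuous_on UNIV u" using A by simp
    fix \<phi> x0 assume B: "C2_on UNIV \<phi> \<and> \<phi> x0 = u x0 \<and> (\<forall>\<^sub>F x in at x0. \<phi> x \<le> u x)"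
    let ?D = "deriv (deriv \<phi>) x0"
    have j: "a x0 * X + H x0 (deriv \<phi> x0) \<le> lam" if X: "X < ?D" for X
    proof -
      have "subjet \<phi> x0 (deriv \<phi> x0) X"
        by (rule jets_of_C2(1)[OF _ _ X]) (use C2_on_UNIV_derivs B in auto)
      moreover have "\<forall>\<^sub>F x in at x0. \<phi> x \<le> u x" using B by simp
      ultimately have "subjet u x0 (deriv \<phi> x0) X"
        unfolding subjet_def by eventually_elim (use B in auto)
      then show ?thesis using A by blast
    qed
    have "((\<lambda>X. a x0 * X + H x0 (deriv \<phi> x0)) \<longlongrightarrow> a x0 * ?D + H x0 (deriv \<phi> x0)) (at_left ?D)"
      by (intro tendsto_intros)
    moreover have "\<forall>\<^sub>F X in at_left ?D. a x0 * X + H x0 (deriv \<phi> x0) \<le> lam"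
      using j by (simp add: eventually_at_filter)
    ultimately show "a x0 * ?D + H x0 (deriv \<phi> x0) \<le> lam"
      by (rule tendsto_upperbound) simp
  qed
qed

lemma visc_sub_iff_superjet:
  assumes a: "\<And>x. 0 \<le> a x"
  shows "visc_sub a H lam u \<longleftrightarrow> continuous_on UNIV u \<and>
     (\<forall>x p X. superjet u x p X \<longrightarrow> lam \<le> a x * X + H x p)"
proof (intro iffI conjI allI impI)
  assume vs: "visc_sub a H lam u"
  then show "continuous_on UNIV u" by (simp add: visc_sub_def)
  fix x p X assume j: "superjet u x p X"
  let ?f = "\<lambda>y. u x + p * (y - x) + X / 2 * (y - x)\<^sup>2"
  have "a x * deriv (deriv ?f) x + H x (deriv ?f x) \<ge> lam"
    by (rule vs[unfolded visc_sub_def, THEN conjunct2, rule_format])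
       (use j[unfolded superjet_altdef] C2_on_parabola in simp)
  then show "lam \<le> a x * X + H x p" by (simp only: deriv2_parabola) (simp only: deriv_parabola, simp)
next
  assume A: "continuous_on UNIV u \<and> (\<forall>x p X. superjet u x p X \<longrightarrow> lam \<le> a x * X + H x p)"
  show "visc_sub a H lam u" unfolding visc_sub_def
  proof (intro conjI allI impI)
    show "continuous_on UNIV u" using A by simp
    fix \<phi> x0 assume B: "C2_on UNIV \<phi> \<and> \<phi> x0 = u x0 \<and> (\<forall>\<^sub>F x in at x0. u x \<le> \<phi> x)"
    let ?D = "deriv (deriv \<phi>) x0"
    have j: "lam \<le> a x0 * X + H x0 (deriv \<phi> x0)" if X: "?D < X" for X
    proof -
      have "superjet \<phi> x0 (deriv \<phi> x0) X"
        by (rule jets_of_C2(2)[OF _ _ X]) (use C2_on_UNIV_derivs B in auto)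
      moreover have "\<forall>\<^sub>F x in at x0. u x \<le> \<phi> x" using B by simp
      ultimately have "superjet u x0 (deriv \<phi> x0) X"
        unfolding superjet_altdef by eventually_elim (use B in auto)
      then show ?thesis using A by blast
    qed
    have "((\<lambda>X. a x0 * X + H x0 (deriv \<phi> x0)) \<longlongrightarrow> a x0 * ?D + H x0 (deriv \<phi> x0)) (at_right ?D)"
      by (intro tendsto_intros)
    moreover have "\<forall>\<^sub>F X in at_right ?D. lam \<le> a x0 * X + H x0 (deriv \<phi> x0)"
      using j by (simp add: eventually_at_filter)
    ultimately show "lam \<le> a x0 * ?D + H x0 (deriv \<phi> x0)"
      by (rule tendsto_lowerbound) simp
  qed
qed

lemma positive_near_compact_slab:
  fixes F :: "real \<Rightarrow> real \<Rightarrow> real"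
  assumes cont: "continuous_on UNIV (\<lambda>(x, p). F x p)" and S: "compact S"
    and pos: "\<And>p. p \<in> S \<Longrightarrow> 0 < F x0 p"
  obtains c d where "c > 0" "d > 0" "\<And>x p. \<bar>x - x0\<bar> < d \<Longrightarrow> p \<in> S \<Longrightarrow> c \<le> F x p"
proof (cases "S = {}")
  case True then show ?thesis using that[of 1 1] by auto
next
  case False
  have "continuous_on S (\<lambda>p. F x0 p)"
    using continuous_on_compose2[OF cont, of S "\<lambda>p. (x0, p)"]
      continuous_on_Pair[OF continuous_on_const continuous_on_id] by auto
  then obtain p0 where p0: "p0 \<in> S" "\<And>p. p \<in> S \<Longrightarrow> F x0 p0 \<le> F x0 p"
    using continuous_attains_inf[OF S False] by metis
  define c where "c = F x0 p0 / 2"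
  have c: "c > 0" using pos[OF p0(1)] by (simp add: c_def)
  have "uniformly_continuous_on (cball x0 1 \<times> S) (\<lambda>(x, p). F x p)"
    by (intro compact_uniformly_continuous compact_Times S continuous_on_subset[OF cont]) auto
  then obtain d where d: "d > 0"
    "\<And>z z'. z \<in> cball x0 1 \<times> S \<Longrightarrow> z' \<in> cball x0 1 \<times> S \<Longrightarrow> dist z' z < d \<Longrightarrow>
      dist (case z' of (x, p) \<Rightarrow> F x p) (case z of (x, p) \<Rightarrow> F x p) < c"
    using c unfolding uniformly_continuous_on_def by metis
  have "c \<le> F x p" if "\<bar>x - x0\<bar> < min d 1" "p \<in> S" for x p
  proof -
    have "dist (F x p) (F x0 p) < c"
      using d(2)[of "(x0, p)" "(x, p)"] that by (auto simp: dist_Pair_Pair dist_real_def abs_minus_commute)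
    then have "\<bar>F x p - F x0 p\<bar> < c" by (simp add: dist_real_def)
    then show ?thesis using p0(2)[OF that(2)] unfolding c_def by linarith
  qed
  then show ?thesis using that[of c "min d 1"] c d by auto
qed

section \<open>Degenerate Hamilton-Jacobi equations\<close>

text \<open>The assumptions are invariant under \<open>x \<mapsto> - x\<close>, \<open>p \<mapsto> - p\<close>, so that every one-sided statement has
  a mirror image.\<close>

locale degenerate_hj =
  fixes a :: "real \<Rightarrow> real" and H :: "real \<Rightarrow> real \<Rightarrow> real" and k :: real
  assumes a_nonneg: "\<And>x. 0 \<le> a x" and a_cont: "continuous_on UNIV a" and k_pos: "k > 0"
    and a_quad: "\<And>x z. a z = 0 \<Longrightarrow> a x \<le> k * (x - z)\<^sup>2"
    and zero_below: "\<And>x. \<exists>z\<le>x. a z = 0" and zero_above: "\<And>x. \<exists>z\<ge>x. a z = 0"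
    and H_coercive: "\<And>lam. \<exists>K. \<forall>x p. K \<le> \<bar>p\<bar> \<longrightarrow> 1 + p\<^sup>2 \<le> H x p - lam"
    and H_lip_x: "\<And>K. \<exists>M. \<forall>x y p. \<bar>p\<bar> \<le> K \<longrightarrow> \<bar>H x p - H y p\<bar> \<le> M * \<bar>x - y\<bar>"
    and H_lip_p: "\<And>K. \<exists>M. \<forall>x p q. \<bar>p\<bar> \<le> K \<longrightarrow> \<bar>q\<bar> \<le> K \<longrightarrow> \<bar>H x p - H x q\<bar> \<le> M * \<bar>p - q\<bar>"
    and H_sqc: "\<And>x p q r. p < r \<Longrightarrow> r < q \<Longrightarrow> H x r < max (H x p) (H x q)"
begin

lemma reflect: "degenerate_hj (\<lambda>x. a (- x)) (\<lambda>x p. H (- x) (- p)) k"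
proof unfold_locales
  show "continuous_on UNIV (\<lambda>x. a (- x))"
    by (rule continuous_on_compose2[OF a_cont]) (auto intro: continuous_intros)
  show "a (- x) \<le> k * (x - z)\<^sup>2" if "a (- z) = 0" for x z
    using a_quad[OF that, of "- x"] by (simp add: power2_commute)
  show "\<exists>z\<le>x. a (- z) = 0" for x using zero_above[of "- x"] by (metis minus_le_iff minus_minus)
  show "\<exists>z\<ge>x. a (- z) = 0" for x using zero_below[of "- x"] by (metis le_minus_iff minus_minus)
  show "\<exists>K. \<forall>x p. K \<le> \<bar>p\<bar> \<longrightarrow> 1 + p\<^sup>2 \<le> H (- x) (- p) - lam" for lam
    using H_coercive[of lam] by (metis abs_minus_cancel power2_minus)
  show "\<exists>M. \<forall>x y p. \<bar>p\<bar> \<le> K \<longrightarrow> \<bar>H (- x) (- p) - H (- y) (- p)\<bar> \<le> M * \<bar>x - y\<bar>" for K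
  proof -
    obtain M where M: "\<And>x y p. \<bar>p\<bar> \<le> K \<Longrightarrow> \<bar>H x p - H y p\<bar> \<le> M * \<bar>x - y\<bar>"
      using H_lip_x[of K] by blast
    have "\<bar>H (- x) (- p) - H (- y) (- p)\<bar> \<le> M * \<bar>x - y\<bar>" if "\<bar>p\<bar> \<le> K" for x y p
      using M[of "- p" "- x" "- y"] that by (simp add: abs_minus_commute)
    then show ?thesis by blast
  qed
  show "\<exists>M. \<forall>x p q. \<bar>p\<bar> \<le> K \<longrightarrow> \<bar>q\<bar> \<le> K \<longrightarrow> \<bar>H (- x) (- p) - H (- x) (- q)\<bar> \<le> M * \<bar>p - q\<bar>" for K
  proof -
    obtain M where M: "\<And>x p q. \<bar>p\<bar> \<le> K \<Longrightarrow> \<bar>q\<bar> \<le> K \<Longrightarrow> \<bar>H x p - H x q\<bar> \<le> M * \<bar>p - q\<bar>"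
      using H_lip_p[of K] by blast
    have "\<bar>H (- x) (- p) - H (- x) (- q)\<bar> \<le> M * \<bar>p - q\<bar>" if "\<bar>p\<bar> \<le> K" "\<bar>q\<bar> \<le> K" for x p q
      using M[of "- p" "- q" "- x"] that by (simp add: abs_minus_commute)
    then show ?thesis by blast
  qed
  show "H (- x) (- r) < max (H (- x) (- p)) (H (- x) (- q))" if "p < r" "r < q" for x p q r
    using H_sqc[of "- q" "- r" "- p" "- x"] that by (simp add: max.commute)
qed (use a_nonneg k_pos in auto)

lemma H_cont: "continuous_on UNIV (\<lambda>(x, p). H x p)"
proof -
  have "isCont (\<lambda>(x, p). H x p) (x0, p0)" for x0 p0
  proof -
    define K where "K = \<bar>p0\<bar> + 1"
    obtain M1 where M1: "\<And>x y p. \<bar>p\<bar> \<le> K \<Longrightarrow> \<bar>H x p - H y p\<bar> \<le> M1 * \<bar>x - y\<bar>"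
      using H_lip_x[of K] by blast
    obtain M2 where M2: "\<And>x p q. \<bar>p\<bar> \<le> K \<Longrightarrow> \<bar>q\<bar> \<le> K \<Longrightarrow> \<bar>H x p - H x q\<bar> \<le> M2 * \<bar>p - q\<bar>"
      using H_lip_p[of K] by blast
    have "((\<lambda>z. M1 * \<bar>fst z - x0\<bar> + M2 * \<bar>snd z - p0\<bar>) \<longlongrightarrow>
        M1 * \<bar>fst (x0, p0) - x0\<bar> + M2 * \<bar>snd (x0, p0) - p0\<bar>) (at (x0, p0))"
      by (intro tendsto_intros)
    then have lim: "((\<lambda>z. M1 * \<bar>fst z - x0\<bar> + M2 * \<bar>snd z - p0\<bar>) \<longlongrightarrow> 0) (at (x0, p0))" by simp
    have snd: "(snd \<longlongrightarrow> p0) (at (x0, p0))" using tendsto_snd[OF tendsto_ident_at] by fastforce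
    have "\<forall>\<^sub>F z in at (x0, p0). dist (snd z) p0 < 1"
      using tendstoD[OF snd, of 1] by simp
    then have ev: "\<forall>\<^sub>F z in at (x0, p0). norm ((case z of (x, p) \<Rightarrow> H x p) - H x0 p0) \<le>
        M1 * \<bar>fst z - x0\<bar> + M2 * \<bar>snd z - p0\<bar>"
    proof eventually_elim
      case (elim z)
      obtain x p where z: "z = (x, p)" by force
      have p: "\<bar>p\<bar> \<le> K" "\<bar>p0\<bar> \<le> K" using elim by (auto simp: z K_def dist_real_def)
      show ?case using M1[OF p(1), of x x0] M2[OF p, of x0] by (simp add: z)
    qed
    have "((\<lambda>z. (case z of (x, p) \<Rightarrow> H x p) - H x0 p0) \<longlongrightarrow> 0) (at (x0, p0))"
      by (rule Lim_null_comparison[OF ev lim])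
    then show ?thesis unfolding isCont_def by (simp add: Lim_null[symmetric] LIM_zero_iff)
  qed
  then show ?thesis by (auto intro!: continuous_at_imp_continuous_on)
qed

lemma H_cont_comp [continuous_intros]:
  assumes "continuous_on S f" "continuous_on S g"
  shows "continuous_on S (\<lambda>s. H (f s) (g s))"
  using continuous_on_compose2[OF H_cont continuous_on_Pair[OF assms]] by auto

lemma solD:
  assumes "visc_sol a H lam u"
  shows sol_cont: "continuous_on S u"
    and sol_subjet: "subjet u x p X \<Longrightarrow> a x * X + H x p \<le> lam"
    and sol_superjet: "superjet u x p X \<Longrightarrow> lam \<le> a x * X + H x p"
proof -
  have "visc_sub a H lam u" "visc_super a H lam u" using assms by (auto simp: visc_sol_def)
  then show "subjet u x p X \<Longrightarrow> a x * X + H x p \<le> lam"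
    and "superjet u x p X \<Longrightarrow> lam \<le> a x * X + H x p"
    and "continuous_on S u"
    using visc_super_iff_subjet[of a H lam u] visc_sub_iff_superjet[of a H lam u] a_nonneg
    by (auto intro: continuous_on_subset)
qed

lemma solI:
  assumes "continuous_on UNIV u"
    and "\<And>x p X. subjet u x p X \<Longrightarrow> a x * X + H x p \<le> lam"
    and "\<And>x p X. superjet u x p X \<Longrightarrow> lam \<le> a x * X + H x p"
  shows "visc_sol a H lam u"
  using visc_super_iff_subjet[of a H lam u] visc_sub_iff_superjet[of a H lam u] a_nonneg assms
  by (simp add: visc_sol_def)

lemma sol_reflect:
  assumes "visc_sol a H lam u"
  shows "visc_sol (\<lambda>x. a (- x)) (\<lambda>x p. H (- x) (- p)) lam (\<lambda>x. u (- x))"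
proof (rule degenerate_hj.solI[OF reflect])
  show "continuous_on UNIV (\<lambda>x. u (- x))"
    by (rule continuous_on_compose2[OF sol_cont[OF assms]]) (auto intro: continuous_intros)
  show "a (- x) * X + H (- x) (- p) \<le> lam" if "subjet (\<lambda>x. u (- x)) x p X" for x p X
    using sol_subjet[OF assms subjet_reflect[OF that]] .
  show "lam \<le> a (- x) * X + H (- x) (- p)" if "superjet (\<lambda>x. u (- x)) x p X" for x p X
    using sol_superjet[OF assms, of "- x" "- p" X] subjet_reflect[of "\<lambda>x. - u x" x "- p" "- X"] that
    by (simp add: superjet_def)
qed

text \<open>Differentiability fixes the slope of every jet. Where \<open>a\<close> is positive the
  second derivative bounds \<open>X\<close> through the ordering of jets; where \<open>a\<close>
  vanishes the term with \<open>X\<close> drops out and \<open>H x (q x) = lam\<close>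
  decides.\<close>

lemma classical_imp_sol:
  assumes u: "\<And>x. (u has_real_derivative q x) (at x)"
    and q: "\<And>x. a x > 0 \<Longrightarrow> (q has_real_derivative (lam - H x (q x)) / a x) (at x)"
    and z: "\<And>x. a x = 0 \<Longrightarrow> H x (q x) = lam"
  shows "visc_sol a H lam u"
proof (rule solI)
  show "continuous_on UNIV u" using u by (auto intro: DERIV_continuous_on has_field_derivative_at_within)
next
  fix x p X assume j: "subjet u x p X"
  have p: "p = q x" using subjet_deriv_eq[OF j u] .
  show "a x * X + H x p \<le> lam"
  proof (cases "a x = 0")
    case True then show ?thesis using z p by simp
  next
    case False
    then have pos: "a x > 0" using a_nonneg[of x] by simp
    have "X \<le> (lam - H x (q x)) / a x"
    proof (rule field_le_epsilon)
      fix e :: real assume "e > 0"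
      then have "superjet u x (q x) ((lam - H x (q x)) / a x + e)"
        using u by (intro jets_of_C2(2)[OF _ q[OF pos]]) auto
      then show "X \<le> (lam - H x (q x)) / a x + e" using subjet_superjet_order j p by blast
    qed
    then show ?thesis using pos by (simp add: p field_simps)
  qed
next
  fix x p X assume j: "superjet u x p X"
  have p: "p = q x" using superjet_deriv_eq[OF j u] .
  show "lam \<le> a x * X + H x p"
  proof (cases "a x = 0")
    case True then show ?thesis using z p by simp
  next
    case False
    then have pos: "a x > 0" using a_nonneg[of x] by simp
    have "(lam - H x (q x)) / a x \<le> X"
    proof (rule field_le_epsilon)
      fix e :: real assume "e > 0"
      then have "subjet u x (q x) ((lam - H x (q x)) / a x - e)"
        using u by (intro jets_of_C2(1)[OF _ q[OF pos]]) auto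
      then have "(lam - H x (q x)) / a x - e \<le> X" using subjet_superjet_order j p by blast
      then show "(lam - H x (q x)) / a x \<le> X + e" by simp
    qed
    then show ?thesis using pos by (simp add: p field_simps)
  qed
qed

lemma H_bounded_below:
  obtains C where "C \<ge> 0" "\<And>x p. \<bar>x - x0\<bar> \<le> 1 \<Longrightarrow> - C \<le> H x p"
proof -
  obtain K where K: "\<And>x p. K \<le> \<bar>p\<bar> \<Longrightarrow> 1 + p\<^sup>2 \<le> H x p - 0" using H_coercive[of 0] by blast
  have "bounded ((\<lambda>(x, p). H x p) ` (cball x0 1 \<times> {-K..K}))"
    by (intro compact_imp_bounded compact_continuous_image compact_Times
        continuous_on_subset[OF H_cont]) auto
  then obtain C where C: "\<And>z. z \<in> cball x0 1 \<times> {-K..K} \<Longrightarrow> \<bar>case z of (x, p) \<Rightarrow> H x p\<bar> \<le> C"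
    unfolding bounded_iff by (metis imageI real_norm_def)
  have "- \<bar>C\<bar> \<le> H x p" if x: "\<bar>x - x0\<bar> \<le> 1" for x p
  proof (cases "K \<le> \<bar>p\<bar>")
    case True
    have "0 \<le> p\<^sup>2" by simp
    then show ?thesis using K[OF True, of x] by linarith
  next
    case False
    then have "p \<in> {-K..K}" by auto
    then have "\<bar>H x p\<bar> \<le> C" using C[of "(x, p)"] x by (auto simp: dist_real_def abs_minus_commute)
    then show ?thesis by linarith
  qed
  then show ?thesis using that[of "\<bar>C\<bar>"] by auto
qed

subsection \<open>Regularity where the diffusion is positive\<close>

lemma sol_C11_near:
  assumes sol: "visc_sol a H lam u" and pos: "a x0 > 0"
  obtains d C p where "d > 0" "\<And>x. \<bar>x - x0\<bar> < d \<Longrightarrow> a x > 0"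
    "\<And>x y. \<bar>x - x0\<bar> < d \<Longrightarrow> \<bar>y - x0\<bar> < d \<Longrightarrow> \<bar>u y - u x - p x * (y - x)\<bar> \<le> C / 2 * (y - x)\<^sup>2"
proof -
  define a0 where "a0 = a x0 / 2"
  have a0: "a0 > 0" using pos by (simp add: a0_def)
  have "isCont a x0" using a_cont continuous_on_eq_continuous_at by blast
  then have "(a \<longlongrightarrow> a x0) (nhds x0)" by (simp add: isCont_def tendsto_at_iff_tendsto_nhds)
  moreover have "a0 < a x0" using pos by (simp add: a0_def)
  ultimately have "\<forall>\<^sub>F x in nhds x0. a0 < a x" by (rule order_tendstoD)
  then obtain d0 where d0: "d0 > 0" "\<And>x. dist x x0 < d0 \<Longrightarrow> a0 < a x"
    unfolding eventually_nhds_metric by blast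
  define r where "r = min 1 d0"
  have r: "r > 0" "r \<le> 1" using d0 by (auto simp: r_def)
  have ar: "a0 < a x" if "\<bar>x - x0\<bar> < r" for x using d0(2)[of x] that by (simp add: r_def dist_real_def)
  obtain C0 where C0: "C0 \<ge> 0" "\<And>x p. \<bar>x - x0\<bar> \<le> 1 \<Longrightarrow> - C0 \<le> H x p"
    using H_bounded_below[of x0] by blast
  \<comment> \<open>A subjet satisfies
    \<open>a x * X \<le> lam - H x p \<le> \<bar>lam\<bar> + C0\<close> with no bound on
    \<open>p\<close>, and \<open>a0 < a x\<close> turns this into a bound on
    \<open>X\<close>.\<close>
  define C1 where "C1 = (\<bar>lam\<bar> + C0) / a0"
  have C1: "C1 \<ge> 0" "a0 * C1 = \<bar>lam\<bar> + C0" using a0 C0 by (auto simp: C1_def)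
  have sub1: "X \<le> C1" if x: "\<bar>x - x0\<bar> < r" and j: "subjet u x p X" for x p X
  proof (rule ccontr)
    assume "\<not> ?thesis"
    then have X: "C1 < X" by simp
    have "a0 * C1 < a x * X" using X ar[OF x] a0 C1 by (intro mult_strict_mono) auto
    then show False using sol_subjet[OF sol j] C0(2)[of x p] x r C1 by linarith
  qed
  have cv1: "convex_on {x0 - r<..<x0 + r} (\<lambda>x. C1 / 2 * x\<^sup>2 - u x)"
  proof (rule subjet_imp_convex[where G'="\<lambda>x. C1 * x" and m="\<lambda>_. C1"])
    show "X \<le> C1" if "x0 - r < x" "x < x0 + r" "subjet u x p X" for x p X
      using sub1[OF _ that(3)] that by auto
  qed (auto intro!: derivative_eq_intros sol_cont[OF sol])
  have "\<exists>A. \<forall>y. \<bar>y - x0\<bar> < r \<longrightarrow> u y \<le> u x + A * (y - x) + C1 / 2 * (y - x)\<^sup>2" if x: "\<bar>x - x0\<bar> < r" for x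
  proof -
    obtain s where s: "\<And>y. x0 - r < y \<Longrightarrow> y < x0 + r \<Longrightarrow>
        C1 / 2 * x\<^sup>2 - u x + s * (y - x) \<le> C1 / 2 * y\<^sup>2 - u y"
      using convex_on_supporting_line[OF cv1, of x] x by (auto simp: abs_less_iff)
    have sq: "C1 / 2 * y\<^sup>2 = C1 / 2 * x\<^sup>2 + C1 * x * (y - x) + C1 / 2 * (y - x)\<^sup>2" for y
      by (simp add: power2_eq_square field_simps)
    have "u y \<le> u x + (C1 * x - s) * (y - x) + C1 / 2 * (y - x)\<^sup>2" if "\<bar>y - x0\<bar> < r" for y
    proof -
      have "C1 / 2 * x\<^sup>2 - u x + s * (y - x) \<le> C1 / 2 * y\<^sup>2 - u y"
        using s[of y] that by (simp add: abs_less_iff)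
      moreover have "(C1 * x - s) * (y - x) = C1 * x * (y - x) - s * (y - x)"
        by (rule left_diff_distrib)
      ultimately show ?thesis using sq[of y] by linarith
    qed
    then show ?thesis by blast
  qed
  then obtain A where A: "\<And>x y. \<bar>x - x0\<bar> < r \<Longrightarrow> \<bar>y - x0\<bar> < r \<Longrightarrow>
      u y \<le> u x + A x * (y - x) + C1 / 2 * (y - x)\<^sup>2" by metis
  \<comment> \<open>With a third of the radius, \<open>x + d\<close> and \<open>x - d\<close> remain
    inside; the one-sided parabolas evaluated there bound the slope \<open>A x\<close> on both
    sides.\<close>
  define d where "d = r / 3"
  have d: "d > 0" "d < r" "d \<le> 1" using r by (auto simp: d_def)
  have "bounded (u ` {x0 - 2 * d..x0 + 2 * d})"
    by (intro compact_imp_bounded compact_continuous_image sol_cont[OF sol]) auto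
  then obtain B where B: "\<And>t. t \<in> {x0 - 2 * d..x0 + 2 * d} \<Longrightarrow> \<bar>u t\<bar> \<le> B"
    unfolding bounded_iff by (metis imageI real_norm_def)
  define B2 where "B2 = (2 * B + C1 / 2 * d\<^sup>2) / d"
  have Ab: "\<bar>A x\<bar> \<le> B2" if x: "\<bar>x - x0\<bar> < d" for x
  proof -
    have "\<bar>u x\<bar> \<le> B" "\<bar>u (x + d)\<bar> \<le> B" "\<bar>u (x - d)\<bar> \<le> B" by (rule B; use x in auto)+
    moreover have rs: "\<bar>x - x0\<bar> < r" "\<bar>x + d - x0\<bar> < r" "\<bar>x - d - x0\<bar> < r"
      using x r(1) unfolding d_def by linarith+
    moreover have "u (x + d) \<le> u x + A x * d + C1 / 2 * d\<^sup>2"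
      using A[OF rs(1,2)] by simp
    moreover have "u (x - d) \<le> u x - A x * d + C1 / 2 * d\<^sup>2"
      using A[OF rs(1,3)] by simp
    ultimately have "\<bar>A x * d\<bar> \<le> 2 * B + C1 / 2 * d\<^sup>2" by linarith
    then show ?thesis using d by (simp add: B2_def pos_le_divide_eq abs_mult)
  qed
  define B3 where "B3 = B2 + C1"
  have Lip: "u y - u x \<le> B3 * \<bar>y - x\<bar>" if x: "\<bar>x - x0\<bar> < d" "\<bar>y - x0\<bar> < d" for x y
  proof -
    have h: "\<bar>y - x\<bar> \<le> 2" using x d by linarith
    have "A x * (y - x) \<le> \<bar>A x\<bar> * \<bar>y - x\<bar>" by (metis abs_ge_self abs_mult)
    also have "\<dots> \<le> B2 * \<bar>y - x\<bar>" using Ab[OF x(1)] by (intro mult_right_mono) auto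
    finally have 1: "A x * (y - x) \<le> B2 * \<bar>y - x\<bar>" .
    have "C1 / 2 * (y - x)\<^sup>2 = C1 / 2 * \<bar>y - x\<bar> * \<bar>y - x\<bar>" by (simp add: power2_eq_square)
    also have "\<dots> \<le> C1 / 2 * 2 * \<bar>y - x\<bar>" using h C1 by (intro mult_right_mono mult_left_mono) auto
    finally have 2: "C1 / 2 * (y - x)\<^sup>2 \<le> C1 * \<bar>y - x\<bar>" by simp
    show ?thesis using A[of x y] x d 1 2 by (simp add: B3_def distrib_right)
  qed
  \<comment> \<open>Superjet slopes inherit the Lipschitz bound. That is what bounds
    \<open>H x p\<close> from above, so that the subsolution inequality controls \<open>X\<close>
    from below.\<close>
  have jb: "\<bar>p\<bar> \<le> B3" if x: "\<bar>x - x0\<bar> < d" and j: "superjet u x p X" for x p X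
  proof -
    have U: "open {x0 - d<..<x0 + d}" "x \<in> {x0 - d<..<x0 + d}" using x by auto
    have ev: "\<forall>\<^sub>F y in at x within S. y \<in> {x0 - d<..<x0 + d}" for S
      using U eventually_at_topological by blast
    have "\<forall>\<^sub>F y in at_right x. x < y" by (simp add: eventually_at_right_less)
    with ev[of "{x<..}"] have "\<forall>\<^sub>F y in at_right x. - B3 * (y - x) \<le> u y - u x"
    proof eventually_elim
      case (elim y)
      have "u x - u y \<le> B3 * \<bar>x - y\<bar>" using Lip[of y x] x elim by auto
      then show ?case using elim by (simp add: abs_if)
    qed
    then have 1: "- B3 \<le> p" by (rule superjet_slope_lower_bound[OF j])
    have "\<forall>\<^sub>F y in at_left x. y < x" by (simp add: eventually_at_filter)
    with ev[of "{..<x}"] have "\<forall>\<^sub>F y in at_left x. u x - u y \<le> B3 * (x - y)"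
    proof eventually_elim
      case (elim y)
      have "u x - u y \<le> B3 * \<bar>x - y\<bar>" using Lip[of y x] x elim by auto
      then show ?case using elim by (simp add: abs_if)
    qed
    then have "p \<le> B3" by (rule superjet_slope_upper_bound[OF j])
    then show ?thesis using 1 by simp
  qed
  have "bounded ((\<lambda>(x, p). H x p) ` (cball x0 1 \<times> {-B3..B3}))"
    by (intro compact_imp_bounded compact_continuous_image compact_Times
        continuous_on_subset[OF H_cont]) auto
  then obtain C2 where C2: "\<And>z. z \<in> cball x0 1 \<times> {-B3..B3} \<Longrightarrow> \<bar>case z of (x, p) \<Rightarrow> H x p\<bar> \<le> C2"
    unfolding bounded_iff by (metis imageI real_norm_def)
  define C3 where "C3 = max C1 ((\<bar>lam\<bar> + \<bar>C2\<bar>) / a0)"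
  have C3: "C1 \<le> C3" "C3 \<ge> 0" "\<bar>lam\<bar> + \<bar>C2\<bar> \<le> a0 * C3" using C1 a0
    by (auto simp: C3_def field_simps max_def)
  have sup1: "- C3 \<le> X" if x: "\<bar>x - x0\<bar> < d" and j: "superjet u x p X" for x p X
  proof (rule ccontr)
    assume "\<not> ?thesis"
    then have X: "C3 < - X" by simp
    have "a0 * C3 < a x * (- X)" using X ar[of x] x d a0 C3 by (intro mult_strict_mono) auto
    moreover have "H x p \<le> \<bar>C2\<bar>"
    proof -
      have "(x, p) \<in> cball x0 1 \<times> {-B3..B3}" using jb[OF x j] x d by (auto simp: dist_real_def)
      then show ?thesis using C2 by force
    qed
    ultimately show False using sol_superjet[OF sol j] C3 by simp
  qed
  have cu: "continuous_on S u" for S by (rule sol_cont[OF sol])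
  have "convex_on {x0 - d<..<x0 + d} (\<lambda>x. C3 / 2 * x\<^sup>2 - u x)"
  proof (rule subjet_imp_convex[where G'="\<lambda>x. C3 * x" and m="\<lambda>_. C3"])
    show "X \<le> C3" if "x0 - d < x" "x < x0 + d" "subjet u x p X" for x p X
      using sub1[OF _ that(3)] that C3 d by (force simp: abs_less_iff)
  qed (auto intro!: derivative_eq_intros cu)
  moreover have "convex_on {x0 - d<..<x0 + d} (\<lambda>x. C3 / 2 * x\<^sup>2 - (- u x))"
  proof (rule subjet_imp_convex[where G'="\<lambda>x. C3 * x" and m="\<lambda>_. C3"])
    show "X \<le> C3" if "x0 - d < x" "x < x0 + d" "subjet (\<lambda>x. - u x) x p X" for x p X
      using sup1[of x "- p" "- X"] that by (force simp: abs_less_iff superjet_def)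
  qed (auto intro!: derivative_eq_intros continuous_intros cu)
  ultimately obtain p where p: "\<And>x y. x0 - d < x \<Longrightarrow> x < x0 + d \<Longrightarrow> x0 - d < y \<Longrightarrow> y < x0 + d \<Longrightarrow>
      \<bar>u y - u x - p x * (y - x)\<bar> \<le> C3 / 2 * (y - x)\<^sup>2"
    using semiconcave_semiconvex_expansion[of "x0 - d" "x0 + d" C3 u] by force
  show ?thesis
  proof (rule that[OF d(1)])
    show "a x > 0" if "\<bar>x - x0\<bar> < d" for x using ar[of x] that d a0 by simp
    show "\<bar>u y - u x - p x * (y - x)\<bar> \<le> C3 / 2 * (y - x)\<^sup>2"
      if "\<bar>x - x0\<bar> < d" "\<bar>y - x0\<bar> < d" for x y
      using p[of x y] that by (simp add: abs_less_iff)
  qed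
qed

text \<open>With a Lipschitz derivative \<open>p\<close> available, the equation prescribes a
  continuous second derivative \<open>g\<close>. A double primitive \<open>G\<close> of
  \<open>g\<close> makes \<open>u - G\<close> both convex and concave, because each jet of
  \<open>u\<close> has slope \<open>p x\<close>; hence \<open>u - G\<close> is affine and
  \<open>u\<close> is as smooth as \<open>G\<close>.\<close>

lemma sol_C2_at:
  assumes sol: "visc_sol a H lam u" and pos: "a x0 > 0"
  shows "(u has_real_derivative deriv u x0) (at x0)"
    and "(deriv u has_real_derivative (lam - H x0 (deriv u x0)) / a x0) (at x0)"
proof -
  obtain d C p where d: "d > 0" and apos: "\<And>x. \<bar>x - x0\<bar> < d \<Longrightarrow> a x > 0"
    and p: "\<And>x y. \<bar>x - x0\<bar> < d \<Longrightarrow> \<bar>y - x0\<bar> < d \<Longrightarrow> \<bar>u y - u x - p x * (y - x)\<bar> \<le> C / 2 * (y - x)\<^sup>2"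
    using sol_C11_near[OF sol pos] by metis
  define al where "al = x0 - d"
  define be where "be = x0 + d"
  have I: "\<bar>x - x0\<bar> < d \<longleftrightarrow> al < x \<and> x < be" for x by (auto simp: al_def be_def)
  have du: "(u has_real_derivative p x) (at x)" if x: "al < x" "x < be" for x
  proof -
    have "((\<lambda>y. (u y - u x) / (y - x)) \<longlongrightarrow> p x) (at x)"
    proof (rule LIM_zero_cancel, rule Lim_null_comparison)
      have "\<forall>\<^sub>F y in at x. y \<in> {al<..<be}" by (rule eventually_at_in_open') (use x in auto)
      moreover have "\<forall>\<^sub>F y in at x. y \<noteq> x" by (rule eventually_neq_at_within)
      ultimately show "\<forall>\<^sub>F y in at x. norm ((u y - u x) / (y - x) - p x) \<le> C / 2 * \<bar>y - x\<bar>"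
      proof eventually_elim
        case (elim y)
        have "(u y - u x) / (y - x) - p x = (u y - u x - p x * (y - x)) / (y - x)"
          using elim by (simp add: field_simps)
        then have "norm ((u y - u x) / (y - x) - p x) = \<bar>u y - u x - p x * (y - x)\<bar> / \<bar>y - x\<bar>"
          by simp
        also have "\<dots> \<le> C / 2 * (y - x)\<^sup>2 / \<bar>y - x\<bar>"
          using p[of x y] x elim by (intro divide_right_mono) (auto simp: I)
        also have "\<dots> = C / 2 * \<bar>y - x\<bar>"
        proof -
          have "C / 2 * (y - x)\<^sup>2 = (C / 2 * \<bar>y - x\<bar>) * \<bar>y - x\<bar>" by (simp add: power2_eq_square)
          also have "\<dots> / \<bar>y - x\<bar> = C / 2 * \<bar>y - x\<bar>"
            by (rule nonzero_mult_div_cancel_right) (use elim in simp)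
          finally show ?thesis .
        qed
        finally show ?case .
      qed
      have "((\<lambda>y. C / 2 * \<bar>y - x\<bar>) \<longlongrightarrow> C / 2 * \<bar>x - x\<bar>) (at x)" by (intro tendsto_intros)
      then show "((\<lambda>y. C / 2 * \<bar>y - x\<bar>) \<longlongrightarrow> 0) (at x)" by simp
    qed
    then show ?thesis by (simp add: has_field_derivative_iff)
  qed
  have plip: "\<bar>p x - p y\<bar> \<le> C * \<bar>x - y\<bar>" if "al < x" "x < be" "al < y" "y < be" for x y
  proof (cases "x = y")
    case False
    have "\<bar>u y - u x - p x * (y - x)\<bar> \<le> C / 2 * (y - x)\<^sup>2" "\<bar>u x - u y - p y * (x - y)\<bar> \<le> C / 2 * (x - y)\<^sup>2"
      using p that by (auto simp: I)
    moreover have "(p x - p y) * (x - y) = (u y - u x - p x * (y - x)) + (u x - u y - p y * (x - y))"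
      by (simp add: algebra_simps)
    ultimately have "\<bar>(p x - p y) * (x - y)\<bar> \<le> C / 2 * (x - y)\<^sup>2 + C / 2 * (x - y)\<^sup>2"
      unfolding power2_commute[of y x] by linarith
    then have "\<bar>p x - p y\<bar> * \<bar>x - y\<bar> \<le> C * \<bar>x - y\<bar> * \<bar>x - y\<bar>"
      by (simp add: abs_mult power2_eq_square)
    then show ?thesis using False by simp
  qed simp
  have pc: "continuous_on {al<..<be} p"
    unfolding continuous_on_iff
  proof (intro ballI allI impI)
    fix x e :: real assume x: "x \<in> {al<..<be}" and e: "e > 0"
    show "\<exists>d>0. \<forall>y\<in>{al<..<be}. dist y x < d \<longrightarrow> dist (p y) (p x) < e"
    proof (intro exI[of _ "e / (\<bar>C\<bar> + 1)"] conjI ballI impI)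
      fix y assume y: "y \<in> {al<..<be}" "dist y x < e / (\<bar>C\<bar> + 1)"
      have "\<bar>p y - p x\<bar> \<le> C * \<bar>y - x\<bar>" using plip x y by auto
      also have "\<dots> \<le> (\<bar>C\<bar> + 1) * \<bar>y - x\<bar>" by (intro mult_right_mono) auto
      also have "\<dots> < e" using y(2) by (simp add: dist_real_def field_simps)
      finally show "dist (p y) (p x) < e" by (simp add: dist_real_def)
    qed (use e in auto)
  qed
  define g where "g x = (lam - H x (p x)) / a x" for x
  have gc: "continuous_on {al<..<be} g"
    unfolding g_def
    by (intro continuous_intros pc continuous_on_subset[OF a_cont]) (use apos I in force)+
  define l where "l = x0 - d / 2"
  define r where "r = x0 + d / 2"
  have lr: "al < l" "l < x0" "x0 < r" "r < be" using d by (auto simp: l_def r_def al_def be_def)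
  define G' where "G' x = integral {l..x} g" for x
  have G': "(G' has_real_derivative g x) (at x)" if "l < x" "x < r" for x
  proof -
    have "continuous_on {l..r} g" by (rule continuous_on_subset[OF gc]) (use lr in auto)
    from integral_has_real_derivative[OF this, of x] show ?thesis
      using that by (simp add: G'_def[abs_def] at_within_Icc_at)
  qed
  \<comment> \<open>The interval shrinks once per integration, since each primitive is
    differentiated only at interior points of its interval.\<close>
  define l' where "l' = x0 - d / 4"
  define r' where "r' = x0 + d / 4"
  have lr': "l < l'" "l' < x0" "x0 < r'" "r' < r" using d by (auto simp: l_def r_def l'_def r'_def)
  define G where "G x = integral {l'..x} G'" for x
  have G: "(G has_real_derivative G' x) (at x)" if "l' < x" "x < r'" for x
  proof -
    have "continuous_on {l'..r'} G'"
      by (rule DERIV_continuous_on[where D=g], rule has_field_derivative_at_within, rule G')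
         (use lr' in auto)
    from integral_has_real_derivative[OF this, of x] show ?thesis
      using that by (simp add: G_def[abs_def] at_within_Icc_at)
  qed
  have cu: "continuous_on S u" for S by (rule sol_cont[OF sol])
  have "convex_on {l'<..<r'} (\<lambda>x. G x - u x)"
  proof (rule subjet_imp_convex[where G'=G' and m=g])
    fix x q X assume x: "l' < x" "x < r'" and j: "subjet u x q X"
    have "q = p x" using subjet_deriv_eq[OF j du] x lr lr' by auto
    moreover have "a x > 0" using apos I x lr lr' by auto
    ultimately show "X \<le> g x" using sol_subjet[OF sol j] by (simp add: g_def field_simps)
  qed (use G G' lr' cu in auto)
  moreover have "convex_on {l'<..<r'} (\<lambda>x. - G x - (- u x))"
  proof (rule subjet_imp_convex[where G'="\<lambda>x. - G' x" and m="\<lambda>x. - g x"])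
    fix x q X assume x: "l' < x" "x < r'" and j: "subjet (\<lambda>x. - u x) x q X"
    have j: "superjet u x (- q) (- X)" using j by (simp add: superjet_def)
    have "- q = p x" using superjet_deriv_eq[OF j du] x lr lr' by auto
    moreover have "a x > 0" using apos I x lr lr' by auto
    ultimately show "X \<le> - g x" using sol_superjet[OF sol j] by (simp add: g_def field_simps)
  qed (use G G' lr' cu in \<open>auto intro!: derivative_intros continuous_intros\<close>)
  ultimately obtain s where s: "\<And>x y. l' < x \<Longrightarrow> x < r' \<Longrightarrow> l' < y \<Longrightarrow> y < r' \<Longrightarrow>
      \<bar>(u y - G y) - (u x - G x) - s x * (y - x)\<bar> \<le> 0 / 2 * (y - x)\<^sup>2"
    using semiconcave_semiconvex_expansion[of l' r' 0 "\<lambda>x. u x - G x"] by (force simp: algebra_simps)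
  have ueq: "u y = G y + (u x0 - G x0) + s x0 * (y - x0)" if "l' < y" "y < r'" for y
    using s[of x0 y] that lr' by simp
  have dd: "deriv u y = G' y + s x0" if y: "l' < y" "y < r'" for y
  proof (rule DERIV_imp_deriv)
    have "((\<lambda>y. G y + (u x0 - G x0) + s x0 * (y - x0)) has_real_derivative G' y + s x0) (at y)"
      using G[OF y] by (auto intro!: derivative_eq_intros)
    then show "(u has_real_derivative G' y + s x0) (at y)"
      by (rule has_field_derivative_transform_within_open[where S="{l'<..<r'}"]) (use y ueq in auto)
  qed
  have px: "deriv u x0 = p x0" using du[of x0] lr by (simp add: DERIV_imp_deriv)
  show "(u has_real_derivative deriv u x0) (at x0)" using du[of x0] lr px by simp
  have "((\<lambda>y. G' y + s x0) has_real_derivative g x0) (at x0)"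
    using G'[of x0] lr by (auto intro!: derivative_eq_intros)
  then have "(deriv u has_real_derivative g x0) (at x0)"
    by (rule has_field_derivative_transform_within_open[where S="{l'<..<r'}"]) (use lr' dd in auto)
  then show "(deriv u has_real_derivative (lam - H x0 (deriv u x0)) / a x0) (at x0)"
    by (simp add: g_def px)
qed

end

section \<open>Behaviour near the zeros of the diffusion\<close>

lemma deriv_ge_of_slopes:
  fixes u :: "real \<Rightarrow> real"
  assumes sl: "\<And>x y. al < x \<Longrightarrow> x \<le> y \<Longrightarrow> y < be \<Longrightarrow> m * (y - x) \<le> u y - u x"
    and x: "al < x" "x < be" and D: "(u has_real_derivative D) (at x)"
  shows "m \<le> D"
proof (rule tendsto_lowerbound)
  show "((\<lambda>y. (u y - u x) / (y - x)) \<longlongrightarrow> D) (at_right x)"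
    using D has_field_derivative_iff has_field_derivative_at_within by blast
  have "\<forall>\<^sub>F y in at_right x. y \<in> {x<..<be}" using x by (intro eventually_at_right_real)
  then show "\<forall>\<^sub>F y in at_right x. m \<le> (u y - u x) / (y - x)"
    by eventually_elim (use sl x in \<open>auto simp: pos_le_divide_eq\<close>)
qed simp

lemma deriv_le_of_slopes:
  fixes u :: "real \<Rightarrow> real"
  assumes sl: "\<And>x y. al < x \<Longrightarrow> x \<le> y \<Longrightarrow> y < be \<Longrightarrow> u y - u x \<le> m * (y - x)"
    and x: "al < x" "x < be" and D: "(u has_real_derivative D) (at x)"
  shows "D \<le> m"
proof -
  have "- m \<le> - D"
  proof (rule deriv_ge_of_slopes[where u="\<lambda>x. - u x"])
    show "- m * (y - x) \<le> - u y - - u x" if "al < x" "x \<le> y" "y < be" for x y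
      using sl[OF that] by simp
    show "((\<lambda>x. - u x) has_real_derivative - D) (at x)" using D by (rule derivative_intros)
  qed (use x in auto)
  then show ?thesis by simp
qed

text \<open>This is strict differentiability: all difference quotients near \<open>x0\<close> are
  close to \<open>P\<close>, also those not based at \<open>x0\<close>. It gives at once the
  derivative at \<open>x0\<close> and the convergence of nearby derivatives to it, which a plain
  derivative at \<open>x0\<close> would not.\<close>

definition slopes_tend_to :: "(real \<Rightarrow> real) \<Rightarrow> real \<Rightarrow> real \<Rightarrow> bool" where
  "slopes_tend_to u x0 P \<longleftrightarrow> (\<forall>e>0. \<exists>d>0. \<forall>x y. x0 - d < x \<longrightarrow> x \<le> y \<longrightarrow> y < x0 + d \<longrightarrow>
     (P - e) * (y - x) \<le> u y - u x \<and> u y - u x \<le> (P + e) * (y - x))"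

lemma slopes_tend_toD:
  assumes "slopes_tend_to u x0 P" "e > 0"
  obtains d where "d > 0"
    "\<And>x y. x0 - d < x \<Longrightarrow> x \<le> y \<Longrightarrow> y < x0 + d \<Longrightarrow> (P - e) * (y - x) \<le> u y - u x"
    "\<And>x y. x0 - d < x \<Longrightarrow> x \<le> y \<Longrightarrow> y < x0 + d \<Longrightarrow> u y - u x \<le> (P + e) * (y - x)"
  using assms unfolding slopes_tend_to_def by metis

lemma slopes_tend_to_imp_deriv:
  assumes "slopes_tend_to u x0 P"
  shows "(u has_real_derivative P) (at x0)"
  unfolding has_field_derivative_iff
proof (rule tendstoI)
  fix e :: real assume e: "e > 0"
  obtain d where d: "d > 0"
    "\<And>x y. x0 - d < x \<Longrightarrow> x \<le> y \<Longrightarrow> y < x0 + d \<Longrightarrow> (P - e / 2) * (y - x) \<le> u y - u x"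
    "\<And>x y. x0 - d < x \<Longrightarrow> x \<le> y \<Longrightarrow> y < x0 + d \<Longrightarrow> u y - u x \<le> (P + e / 2) * (y - x)"
    using slopes_tend_toD[OF assms, of "e / 2"] e by (metis half_gt_zero)
  show "\<forall>\<^sub>F y in at x0. dist ((u y - u x0) / (y - x0)) P < e"
    unfolding eventually_at
  proof (intro exI[of _ d] conjI ballI impI d(1))
    fix y assume y: "y \<noteq> x0 \<and> dist y x0 < d"
    have "P - e / 2 \<le> (u y - u x0) / (y - x0) \<and> (u y - u x0) / (y - x0) \<le> P + e / 2"
    proof (cases "x0 < y")
      case True
      then show ?thesis using d(2)[of x0 y] d(3)[of x0 y] d(1) y
        by (auto simp: pos_le_divide_eq pos_divide_le_eq dist_real_def)
    next
      case False
      have eq: "(u y - u x0) / (y - x0) = (u x0 - u y) / (x0 - y)"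
        by (metis minus_diff_eq minus_divide_divide)
      show ?thesis unfolding eq using d(2)[of y x0] d(3)[of y x0] d(1) y False
        by (auto simp: pos_le_divide_eq pos_divide_le_eq dist_real_def)
    qed
    then show "dist ((u y - u x0) / (y - x0)) P < e"
      using e unfolding dist_real_def abs_less_iff by linarith
  qed
qed

lemma slopes_tend_to_imp_deriv_near:
  assumes "slopes_tend_to u x0 P" "e > 0"
  obtains d where "d > 0"
    "\<And>x D. \<bar>x - x0\<bar> < d \<Longrightarrow> (u has_real_derivative D) (at x) \<Longrightarrow> \<bar>D - P\<bar> \<le> e"
proof -
  obtain d where d: "d > 0"
    "\<And>x y. x0 - d < x \<Longrightarrow> x \<le> y \<Longrightarrow> y < x0 + d \<Longrightarrow> (P - e) * (y - x) \<le> u y - u x"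
    "\<And>x y. x0 - d < x \<Longrightarrow> x \<le> y \<Longrightarrow> y < x0 + d \<Longrightarrow> u y - u x \<le> (P + e) * (y - x)"
    using slopes_tend_toD[OF assms] by metis
  have "\<bar>D - P\<bar> \<le> e" if x: "\<bar>x - x0\<bar> < d" and D: "(u has_real_derivative D) (at x)" for x D
  proof -
    have "P - e \<le> D" by (rule deriv_ge_of_slopes[OF d(2) _ _ D]) (use x in auto)
    moreover have "D \<le> P + e" by (rule deriv_le_of_slopes[OF d(3) _ _ D]) (use x in auto)
    ultimately show ?thesis by linarith
  qed
  then show ?thesis using that d(1) by blast
qed

context degenerate_hj
begin

lemma left_zero:
  assumes "a x > 0"
  obtains z where "z < x" "a z = 0" "\<And>y. z < y \<Longrightarrow> y \<le> x \<Longrightarrow> a y > 0"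
    "\<And>z'. z' \<le> x \<Longrightarrow> a z' = 0 \<Longrightarrow> z' \<le> z"
proof -
  obtain z0 where z0: "z0 \<le> x" "a z0 = 0" using zero_below by blast
  obtain y where "z0 \<le> y" "y < x" "a y = 0" "\<And>t. y < t \<Longrightarrow> t \<le> x \<Longrightarrow> a t > 0"
    using last_nonpos_point[of z0 x a] continuous_on_subset[OF a_cont] z0 assms
    by (metis order_refl subset_UNIV)
  then show ?thesis using that by (metis less_irrefl not_le)
qed

lemma nonincreasing_above_barrier:
  assumes zx: "z < x" and pos: "\<And>y. z < y \<Longrightarrow> y \<le> x \<Longrightarrow> a y > 0"
    and q: "\<And>y. z < y \<Longrightarrow> y \<le> x \<Longrightarrow> (q has_real_derivative q' y) (at y)"
    and c: "c > 0"
    and rate: "\<And>y. z < y \<Longrightarrow> y \<le> x \<Longrightarrow> T \<le> q y \<Longrightarrow> a y * q' y \<le> - c * (1 + (q y)\<^sup>2)"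
    and y: "z < y" "y \<le> x" "q y \<le> T"
  shows "q x \<le> T"
proof -
  have "q x - T \<le> 0"
  proof (rule gronwall_nonpos[where D="\<lambda>t. q t - T" and c=y and M=0])
    show "continuous_on {y..x} (\<lambda>t. q t - T)"
      by (intro continuous_intros DERIV_continuous_on[where D=q'], rule has_field_derivative_at_within, rule q)
         (use y in auto)
    fix t assume t: "y < t" "t < x" "q t - T > 0"
    have "a t * q' t \<le> - c * (1 + (q t)\<^sup>2)" using rate[of t] t y by simp
    also have "\<dots> < 0" using c by (simp add: add_pos_nonneg)
    finally have "q' t < 0" using pos[of t] t y by (simp add: mult_less_0_iff)
    moreover have "((\<lambda>t. q t - T) has_real_derivative q' t) (at t)"
      using q[of t] t y by (auto intro!: derivative_eq_intros)
    ultimately show "\<exists>D'. ((\<lambda>t. q t - T) has_real_derivative D') (at t) \<and> D' \<le> 0 * (q t - T)"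
      by force
  qed (use y in auto)
  then show ?thesis by simp
qed

lemma arctan_rate:
  assumes "a y > 0" "a y * q' \<le> - c * (1 + (q::real)\<^sup>2)"
  shows "inverse (1 + q\<^sup>2) * q' \<le> - c / a y"
proof -
  have q: "1 + q\<^sup>2 > 0" by (simp add: add_pos_nonneg)
  have "a y * (inverse (1 + q\<^sup>2) * q') = inverse (1 + q\<^sup>2) * (a y * q')" by simp
  also have "\<dots> \<le> inverse (1 + q\<^sup>2) * (- c * (1 + q\<^sup>2))"
    using q assms by (intro mult_left_mono) auto
  also have "\<dots> = - c" using q by simp
  finally show ?thesis using assms(1) by (simp add: field_simps)
qed

lemma arctan_bound: "\<bar>arctan x\<bar> \<le> pi"
  using arctan_bounded[of x] pi_gt_zero by linarith

text \<open>If \<open>q x > T\<close>, then \<open>q > T\<close> all the way back to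
  \<open>z\<close>, where \<open>arctan q\<close> would have to descend at rate
  \<open>c / a\<close>. The divergence of the integral of \<open>1 / a\<close> at \<open>z\<close>
  thus takes the place of an initial condition.\<close>

lemma barrier_left:
  assumes z: "a z = 0" and zx: "z < x" and pos: "\<And>y. z < y \<Longrightarrow> y \<le> x \<Longrightarrow> a y > 0"
    and q: "\<And>y. z < y \<Longrightarrow> y \<le> x \<Longrightarrow> (q has_real_derivative q' y) (at y)"
    and c: "c > 0"
    and rate: "\<And>y. z < y \<Longrightarrow> y \<le> x \<Longrightarrow> T \<le> q y \<Longrightarrow> a y * q' y \<le> - c * (1 + (q y)\<^sup>2)"
  shows "q x \<le> T"
proof (rule ccontr)
  assume "\<not> ?thesis"
  then have qx: "q x > T" by simp
  have qy: "q y > T" if "z < y" "y \<le> x" for y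
    using nonincreasing_above_barrier[OF zx pos q c rate that] qx by force
  show False
  proof (rule no_bounded_descent_at_zero[OF zx c k_pos, where a=a and g="\<lambda>y. arctan (q y)" and B=pi
        and g'="\<lambda>y. inverse (1 + (q y)\<^sup>2) * q' y"])
    show "0 < a y \<and> a y \<le> k * (y - z)\<^sup>2" if "z < y" "y \<le> x" for y using pos a_quad z that by auto
    show "((\<lambda>y. arctan (q y)) has_real_derivative inverse (1 + (q y)\<^sup>2) * q' y) (at y)"
      if "z < y" "y \<le> x" for y using q[OF that] by (auto intro!: derivative_eq_intros)
    show "inverse (1 + (q y)\<^sup>2) * q' y \<le> - c / a y" if "z < y" "y \<le> x" for y
      using arctan_rate[OF pos[OF that]] rate[OF that] qy[OF that] by simp
  qed (rule arctan_bound)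
qed

text \<open>The zeros may accumulate at \<open>x0\<close>. If some zero lies in the left part of the
  neighbourhood, \<open>barrier_left\<close>, started from the nearest zero on the left, serves
  every point beyond it. Otherwise a component of \<open>{a > 0}\<close> ends at \<open>x0\<close>;
  then \<open>q\<close> must drop to \<open>T\<close> before \<open>x0\<close>, again because
  \<open>1 / a\<close> is not integrable, and it stays there.\<close>

lemma barrier_near_zero:
  assumes z: "a x0 = 0" and d0: "d0 > 0" and c: "c > 0"
    and q: "\<And>x. \<bar>x - x0\<bar> < d0 \<Longrightarrow> a x > 0 \<Longrightarrow> (q has_real_derivative q' x) (at x)"
    and rate: "\<And>x. \<bar>x - x0\<bar> < d0 \<Longrightarrow> a x > 0 \<Longrightarrow> T \<le> q x \<Longrightarrow> a x * q' x \<le> - c * (1 + (q x)\<^sup>2)"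
  obtains d where "d > 0" "\<And>x. \<bar>x - x0\<bar> < d \<Longrightarrow> a x > 0 \<Longrightarrow> q x \<le> T"
proof -
  have main: "q x \<le> T" if z': "a z' = 0" "x0 - d0 < z'" "z' \<le> x" and x: "x < x0 + d0" "a x > 0" for x z'
  proof -
    obtain z1 where z1: "z1 < x" "a z1 = 0" "\<And>y. z1 < y \<Longrightarrow> y \<le> x \<Longrightarrow> a y > 0" "z' \<le> z1"
      using left_zero[OF x(2)] z' by metis
    show ?thesis
      by (rule barrier_left[OF z1(2,1,3) q c rate]) (use z1 z' x in auto)
  qed
  show ?thesis
  proof (cases "\<exists>z. x0 - d0 < z \<and> z < x0 \<and> a z = 0")
    case True
    then obtain z1 where z1: "x0 - d0 < z1" "z1 < x0" "a z1 = 0" by blast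
    show ?thesis
    proof (rule that[of "x0 - z1"])
      show "x0 - z1 > 0" using z1 by simp
      show "q x \<le> T" if "\<bar>x - x0\<bar> < x0 - z1" "a x > 0" for x
        by (rule main[OF z1(3,1)]) (use that z1 in auto)
    qed
  next
    case False
    then have pos: "a y > 0" if "x0 - d0 < y" "y < x0" for y
      using a_nonneg[of y] that by (metis order_le_less)
    have "\<exists>y. x0 - d0 < y \<and> y < x0 \<and> q y \<le> T"
    proof (rule ccontr)
      assume "\<not> ?thesis"
      then have qT: "q y > T" if "x0 - d0 < y" "y < x0" for y using that by force
      have q1: "(q has_real_derivative q' y) (at y)" if "x0 - d0 < y" "y < x0" for y
        using q[of y] pos[of y] that by auto
      \<comment> \<open>The descent lemma expects the zero at the left end. Reversing
        \<open>x\<close> and negating \<open>arctan q\<close> are two sign changes, so the rate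
        keeps its sign.\<close>
      have dh: "- x0 < - (x0 - d0 / 2)" using d0 by simp
      show False
      proof (rule no_bounded_descent_at_zero[OF dh c k_pos, where a="\<lambda>t. a (- t)" and B=pi
            and g="\<lambda>t. - arctan (q (- t))" and g'="\<lambda>t. inverse (1 + (q (- t))\<^sup>2) * q' (- t)"])
        fix y assume "- x0 < y" "y \<le> - (x0 - d0 / 2)"
        then have y: "x0 - d0 < - y" "- y < x0" using d0 by auto
        show "0 < a (- y) \<and> a (- y) \<le> k * (y - - x0)\<^sup>2"
          using pos[OF y] a_quad[OF z, of "- y"] by (simp add: power2_eq_square algebra_simps)
        have "((\<lambda>t. q (- t)) has_real_derivative - q' (- y)) (at y)"
          using DERIV_mirror[of q "q' (- y)" y] q1[OF y] by simp
        then show "((\<lambda>t. - arctan (q (- t))) has_real_derivative inverse (1 + (q (- y))\<^sup>2) * q' (- y)) (at y)"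
          by (auto intro!: derivative_eq_intros)
        show "inverse (1 + (q (- y))\<^sup>2) * q' (- y) \<le> - c / a (- y)"
          using arctan_rate[OF pos[OF y]] rate[of "- y"] qT[OF y] pos[OF y] y by auto
      qed (use arctan_bound in simp)
    qed
    then obtain y where y: "x0 - d0 < y" "y < x0" "q y \<le> T" by blast
    show ?thesis
    proof (rule that[of "x0 - y"])
      show "x0 - y > 0" using y by simp
      fix x assume x: "\<bar>x - x0\<bar> < x0 - y" "a x > 0"
      show "q x \<le> T"
      proof (cases "x < x0")
        case True
        have yx: "y \<le> x" "x0 - d0 < x" using x y True by auto
        have in_A: "\<bar>t - x0\<bar> < d0" "a t > 0" if "x0 - d0 < t" "t \<le> x" for t
          using pos[of t] that True by auto
        show ?thesis
          by (rule nonincreasing_above_barrier[OF yx(2) in_A(2) q[OF in_A] c rate[OF in_A] y(1) yx(1) y(3)])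
      next
        case False
        show ?thesis by (rule main[OF z]) (use False x y d0 in auto)
      qed
    qed
  qed
qed

text \<open>Large slopes are handled by coercivity and moderate ones by compactness; the factor
  \<open>1 + p^2\<close> is kept since it cancels in the derivative of
  \<open>arctan\<close>.\<close>

lemma H_rate_above:
  assumes "\<And>p. T \<le> p \<Longrightarrow> lam < H x0 p"
  obtains c d where "c > 0" "d > 0"
    "\<And>x p. \<bar>x - x0\<bar> < d \<Longrightarrow> T \<le> p \<Longrightarrow> c * (1 + p\<^sup>2) \<le> H x p - lam"
proof -
  obtain K0 where K0: "\<And>x p. K0 \<le> \<bar>p\<bar> \<Longrightarrow> 1 + p\<^sup>2 \<le> H x p - lam" using H_coercive[of lam] by blast
  define K where "K = max \<bar>K0\<bar> \<bar>T\<bar>"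
  have "continuous_on UNIV (\<lambda>(x, p). H x p - lam)"
    using continuous_on_diff[OF H_cont continuous_on_const[of _ lam]] by (simp add: case_prod_unfold)
  moreover have "compact {T..K}" by simp
  ultimately obtain c0 d where cd: "c0 > 0" "d > 0" "\<And>x p. \<bar>x - x0\<bar> < d \<Longrightarrow> p \<in> {T..K} \<Longrightarrow> c0 \<le> H x p - lam"
    by (rule positive_near_compact_slab[where ?x0.0=x0]) (use assms in auto)
  define c where "c = min 1 (c0 / (1 + K\<^sup>2))"
  have K1: "1 + K\<^sup>2 > 0" by (simp add: add_pos_nonneg)
  have c: "c > 0" using cd K1 by (simp add: c_def)
  have "c * (1 + p\<^sup>2) \<le> H x p - lam" if "\<bar>x - x0\<bar> < d" "T \<le> p" for x p
  proof (cases "p \<le> K")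
    case True
    have "\<bar>p\<bar> \<le> \<bar>K\<bar>" using True that by (auto simp: K_def)
    then have "p\<^sup>2 \<le> K\<^sup>2" by (rule abs_le_square_iff[THEN iffD1])
    then have "c * (1 + p\<^sup>2) \<le> c0 / (1 + K\<^sup>2) * (1 + K\<^sup>2)"
      using c by (intro mult_mono) (auto simp: c_def)
    also have "\<dots> = c0" using K1 by simp
    finally show ?thesis using cd(3)[OF that(1), of p] that True by simp
  next
    case False
    then have "K0 \<le> \<bar>p\<bar>" by (auto simp: K_def)
    have "c * (1 + p\<^sup>2) \<le> 1 * (1 + p\<^sup>2)" by (intro mult_right_mono) (auto simp: c_def)
    then show ?thesis using K0[OF \<open>K0 \<le> \<bar>p\<bar>\<close>, of x] by simp
  qed
  then show ?thesis using that c cd(2) by blast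
qed

text \<open>Every subjet slope is at most \<open>T\<close>: where \<open>a\<close> is positive by
  the barrier for \<open>deriv u\<close>, and at zeros because the equation reduces to
  \<open>H t p \<le> lam\<close>, which the rate estimate excludes for \<open>p \<ge> T\<close>. Jet
  bounds then integrate to slope bounds.\<close>

lemma sol_slope_le_near_zero:
  assumes sol: "visc_sol a H lam u" and z: "a x0 = 0" and T: "\<And>p. T \<le> p \<Longrightarrow> lam < H x0 p"
  obtains d where "d > 0"
    "\<And>x y. x0 - d < x \<Longrightarrow> x \<le> y \<Longrightarrow> y < x0 + d \<Longrightarrow> u y - u x \<le> T * (y - x)"
proof -
  obtain c d0 where cd: "c > 0" "d0 > 0"
    "\<And>x p. \<bar>x - x0\<bar> < d0 \<Longrightarrow> T \<le> p \<Longrightarrow> c * (1 + p\<^sup>2) \<le> H x p - lam"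
    using H_rate_above[OF T] by blast
  obtain d1 where d1: "d1 > 0" "\<And>x. \<bar>x - x0\<bar> < d1 \<Longrightarrow> a x > 0 \<Longrightarrow> deriv u x \<le> T"
  proof (rule barrier_near_zero[OF z cd(2,1), where q="deriv u" and q'="\<lambda>x. (lam - H x (deriv u x)) / a x" and T=T])
    fix x assume x: "\<bar>x - x0\<bar> < d0" "a x > 0"
    show "(deriv u has_real_derivative (lam - H x (deriv u x)) / a x) (at x)"
      by (rule sol_C2_at(2)[OF sol x(2)])
    show "a x * ((lam - H x (deriv u x)) / a x) \<le> - c * (1 + (deriv u x)\<^sup>2)" if "T \<le> deriv u x"
      using cd(3)[OF x(1) that] x by simp
  qed blast
  define d where "d = min d0 d1"
  have "u y - u x \<le> T * (y - x)" if "x0 - d < x" "x \<le> y" "y < x0 + d" for x y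
  proof (rule subjet_slope_le[OF sol_cont[OF sol] _ that])
    fix t p X assume t: "x0 - d < t" "t < x0 + d" and j: "subjet u t p X"
    then have t': "\<bar>t - x0\<bar> < d0" "\<bar>t - x0\<bar> < d1" by (auto simp: d_def)
    show "p \<le> T"
    proof (cases "a t = 0")
      case True
      have "H t p \<le> lam" using sol_subjet[OF sol j] True by simp
      moreover have "c * (1 + p\<^sup>2) > 0" using cd(1) by (simp add: add_pos_nonneg)
      ultimately show ?thesis using cd(3)[OF t'(1), of p] by linarith
    next
      case False
      then have "a t > 0" using a_nonneg[of t] by simp
      then show ?thesis using d1(2)[OF t'(2)] subjet_deriv_eq[OF j sol_C2_at(1)[OF sol]] by simp
    qed
  qed
  then show ?thesis using that[of d] cd d1 by (simp add: d_def)
qed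

lemma sol_slope_ge_near_zero:
  assumes sol: "visc_sol a H lam u" and z: "a x0 = 0" and T: "\<And>p. p \<le> T \<Longrightarrow> lam < H x0 p"
  obtains d where "d > 0"
    "\<And>x y. x0 - d < x \<Longrightarrow> x \<le> y \<Longrightarrow> y < x0 + d \<Longrightarrow> T * (y - x) \<le> u y - u x"
proof -
  obtain d where d: "d > 0" "\<And>x y. - x0 - d < x \<Longrightarrow> x \<le> y \<Longrightarrow> y < - x0 + d \<Longrightarrow>
      u (- y) - u (- x) \<le> - T * (y - x)"
    by (rule degenerate_hj.sol_slope_le_near_zero[OF reflect sol_reflect[OF sol], of "- x0" "- T"])
       (use z T in auto)
  have "T * (y - x) \<le> u y - u x" if "x0 - d < x" "x \<le> y" "y < x0 + d" for x y
    using d(2)[of "- y" "- x"] that by (simp add: algebra_simps)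
  then show ?thesis using that d(1) by blast
qed

text \<open>If \<open>H x0\<close> stayed above \<open>lam\<close>, the barrier would hold at every
  height, and the slopes near \<open>x0\<close> would be at most -1 and at least 1
  simultaneously.\<close>

lemma level_nonempty:
  assumes sol: "visc_sol a H lam u" and z: "a x0 = 0"
  shows "\<exists>p. H x0 p \<le> lam"
proof (rule ccontr)
  assume "\<not> ?thesis"
  then have all: "lam < H x0 p" for p by (meson not_le)
  obtain d1 where d1: "d1 > 0"
    "\<And>x y. x0 - d1 < x \<Longrightarrow> x \<le> y \<Longrightarrow> y < x0 + d1 \<Longrightarrow> u y - u x \<le> - 1 * (y - x)"
    using sol_slope_le_near_zero[OF sol z, of "- 1"] all by metis
  obtain d2 where d2: "d2 > 0"
    "\<And>x y. x0 - d2 < x \<Longrightarrow> x \<le> y \<Longrightarrow> y < x0 + d2 \<Longrightarrow> 1 * (y - x) \<le> u y - u x"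
    using sol_slope_ge_near_zero[OF sol z, of 1] all by metis
  define y where "y = x0 + min d1 d2 / 2"
  have "x0 < y" "y < x0 + d1" "y < x0 + d2" using d1(1) d2(1) by (auto simp: y_def min_def)
  then show False using d1(2)[of x0 y] d2(2)[of x0 y] d1(1) d2(1) by auto
qed

section \<open>Endpoints of the sublevel sets of \<open>H\<close>\<close>

lemma p_plus_props:
  assumes ne: "\<exists>p. H x p \<le> lam"
  shows "H x (p_plus H lam x) = lam"
    and "\<And>p. p_plus H lam x < p \<Longrightarrow> lam < H x p"
    and "\<And>p. H x p \<le> lam \<Longrightarrow> p \<le> p_plus H lam x"
proof -
  let ?S = "{p. H x p \<le> lam}"
  let ?P = "p_plus H lam x"
  obtain K where K: "\<And>x p. K \<le> \<bar>p\<bar> \<Longrightarrow> 1 + p\<^sup>2 \<le> H x p - lam" using H_coercive[of lam] by blast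
  have "\<bar>p\<bar> \<le> K" if "p \<in> ?S" for p
  proof (rule ccontr)
    assume "\<not> ?thesis"
    then have "1 + p\<^sup>2 \<le> H x p - lam" using K by simp
    moreover have "0 \<le> p\<^sup>2" by simp
    moreover have "H x p \<le> lam" using that by simp
    ultimately show False by linarith
  qed
  then have bdd: "bdd_above ?S" by (meson abs_le_D1 bdd_aboveI)
  have Hx: "continuous_on UNIV (\<lambda>p. H x p)" by (intro continuous_intros)
  have cl: "closed ?S" using continuous_on_closed_Collect_le[OF Hx continuous_on_const[of UNIV lam]] by simp
  have in_S: "?P \<in> ?S" unfolding p_plus_def by (rule closed_contains_Sup[OF _ bdd cl]) (use ne in auto)
  show up: "p \<le> ?P" if "H x p \<le> lam" for p unfolding p_plus_def using bdd that by (simp add: cSup_upper)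
  show gt: "lam < H x p" if "?P < p" for p using up[of p] that by force
  show "H x ?P = lam"
  proof (rule ccontr)
    assume "H x ?P \<noteq> lam"
    then have "H x ?P < lam" using in_S by simp
    moreover have "((\<lambda>p. H x p) \<longlongrightarrow> H x ?P) (at_right ?P)"
      using Hx by (simp add: continuous_on_eq_continuous_at isCont_def filterlim_at_split)
    ultimately have "\<forall>\<^sub>F p in at_right ?P. H x p < lam" by (metis order_tendstoD(2))
    moreover have "\<forall>\<^sub>F p in at_right ?P. ?P < p" by (simp add: eventually_at_right_less)
    ultimately have "\<forall>\<^sub>F p in at_right ?P. False" by eventually_elim (use gt in force)
    then show False by simp
  qed
qed

lemma p_minus_reflect: "p_minus H lam x = - p_plus (\<lambda>x p. H (- x) (- p)) lam (- x)"
proof -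
  have "uminus ` {p. H x p \<le> lam} = {p. H x (- p) \<le> lam}" by force
  then show ?thesis by (simp add: p_minus_def p_plus_def Inf_real_def)
qed

lemma p_minus_props:
  assumes ne: "\<exists>p. H x p \<le> lam"
  shows "H x (p_minus H lam x) = lam"
    and "\<And>p. p < p_minus H lam x \<Longrightarrow> lam < H x p"
    and "\<And>p. H x p \<le> lam \<Longrightarrow> p_minus H lam x \<le> p"
proof -
  have "\<exists>p. H (- (- x)) (- p) \<le> lam" using ne by (metis minus_minus)
  note * = degenerate_hj.p_plus_props[OF reflect this]
  show "H x (p_minus H lam x) = lam" using *(1) by (simp add: p_minus_reflect)
  show "lam < H x p" if "p < p_minus H lam x" for p
    using *(2)[of "- p"] that by (simp add: p_minus_reflect)
  show "p_minus H lam x \<le> p" if "H x p \<le> lam" for p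
    using *(3)[of "- p"] that by (simp add: p_minus_reflect)
qed

lemma H_less_below_p_plus:
  assumes "H x m < lam" "m \<le> p" "p < p_plus H lam x"
  shows "H x p < lam"
proof (cases "p = m")
  case False
  then have "H x p < max (H x m) (H x (p_plus H lam x))" using H_sqc assms by simp
  moreover have "H x (p_plus H lam x) = lam" using p_plus_props(1) assms(1) by (meson less_imp_le)
  ultimately show ?thesis using assms(1) by simp
qed (use assms in simp)

lemma middle_rate:
  assumes "\<And>p. m \<le> p \<Longrightarrow> p \<le> T \<Longrightarrow> H x0 p < lam"
  obtains c d where "c > 0" "d > 0"
    "\<And>x p. \<bar>x - x0\<bar> < d \<Longrightarrow> m \<le> p \<Longrightarrow> p \<le> T \<Longrightarrow> c * (1 + p\<^sup>2) \<le> lam - H x p"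
proof -
  have "continuous_on UNIV (\<lambda>(x, p). lam - H x p)"
    using continuous_on_diff[OF continuous_on_const[of _ lam] H_cont] by (simp add: case_prod_unfold)
  moreover have "compact {m..T}" by simp
  ultimately obtain c0 d where cd: "c0 > 0" "d > 0" "\<And>x p. \<bar>x - x0\<bar> < d \<Longrightarrow> p \<in> {m..T} \<Longrightarrow> c0 \<le> lam - H x p"
    by (rule positive_near_compact_slab[where ?x0.0=x0]) (use assms in auto)
  define K where "K = max \<bar>m\<bar> \<bar>T\<bar>"
  have K1: "1 + K\<^sup>2 > 0" by (simp add: add_pos_nonneg)
  have "c0 / (1 + K\<^sup>2) * (1 + p\<^sup>2) \<le> lam - H x p" if "\<bar>x - x0\<bar> < d" "m \<le> p" "p \<le> T" for x p
  proof -
    have "\<bar>p\<bar> \<le> \<bar>K\<bar>" using that by (auto simp: K_def)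
    then have "p\<^sup>2 \<le> K\<^sup>2" by (rule abs_le_square_iff[THEN iffD1])
    then have "c0 / (1 + K\<^sup>2) * (1 + p\<^sup>2) \<le> c0 / (1 + K\<^sup>2) * (1 + K\<^sup>2)"
      using cd K1 by (intro mult_left_mono) auto
    also have "\<dots> = c0" using K1 by simp
    finally show ?thesis using cd(3)[OF that(1), of p] that by simp
  qed
  then show ?thesis using that[of "c0 / (1 + K\<^sup>2)" d] cd K1 by auto
qed

text \<open>The upper half is the general slope estimate. From below, \<open>m\<close> lies strictly
  inside the sublevel interval, and between \<open>m\<close> and \<open>p_plus\<close> minus
  \<open>e\<close> strict quasiconvexity gives \<open>H < lam\<close>: there the slope equation
  pushes \<open>deriv u\<close> upward, and at zeros of \<open>a\<close> the subsolution inequality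
  forbids such slopes.\<close>

lemma sol_slopes_tend_to_p_plus:
  assumes sol: "visc_sol a H lam u" and z: "a x0 = 0" and m: "H x0 m < lam" and d0: "d0 > 0"
    and sl: "\<And>x y. x0 - d0 < x \<Longrightarrow> x \<le> y \<Longrightarrow> y < x0 + d0 \<Longrightarrow> m * (y - x) \<le> u y - u x"
  shows "slopes_tend_to u x0 (p_plus H lam x0)"
  unfolding slopes_tend_to_def
proof (intro allI impI)
  fix e :: real assume e: "e > 0"
  let ?P = "p_plus H lam x0"
  note P = p_plus_props[OF level_nonempty[OF sol z]]
  obtain d1 where d1: "d1 > 0"
    "\<And>x y. x0 - d1 < x \<Longrightarrow> x \<le> y \<Longrightarrow> y < x0 + d1 \<Longrightarrow> u y - u x \<le> (?P + e) * (y - x)"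
    by (rule sol_slope_le_near_zero[OF sol z, of "?P + e"]) (use P(2) e in auto)
  have "\<exists>d2>0. \<forall>x y. x0 - d2 < x \<longrightarrow> x \<le> y \<longrightarrow> y < x0 + d2 \<longrightarrow> (?P - e) * (y - x) \<le> u y - u x"
  proof (cases "?P - e \<le> m")
    case True
    have "(?P - e) * (y - x) \<le> u y - u x" if "x0 - d0 < x" "x \<le> y" "y < x0 + d0" for x y
      using sl[OF that] mult_right_mono[OF True, of "y - x"] that by simp
    then show ?thesis using d0 by blast
  next
    case False
    define T where "T = ?P - e"
    have T: "m < T" "T < ?P" using False e by (auto simp: T_def)
    obtain c d where cd: "c > 0" "d > 0"
      "\<And>x p. \<bar>x - x0\<bar> < d \<Longrightarrow> m \<le> p \<Longrightarrow> p \<le> T \<Longrightarrow> c * (1 + p\<^sup>2) \<le> lam - H x p"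
      by (rule middle_rate[of m T x0 lam]) (use H_less_below_p_plus[OF m] T in auto)
    define d3 where "d3 = min d d0"
    have d3: "d3 > 0" using cd d0 by (simp add: d3_def)
    have ge_m: "m \<le> deriv u x" if "\<bar>x - x0\<bar> < d3" "a x > 0" for x
      by (rule deriv_ge_of_slopes[OF sl _ _ sol_C2_at(1)[OF sol that(2)]]) (use that in \<open>auto simp: d3_def\<close>)
    \<comment> \<open>The barrier is applied to \<open>- deriv u\<close>: while
      \<open>deriv u\<close> lies in \<open>[m, T]\<close>, the positive quantity
      \<open>lam - H\<close> makes it decrease at rate at least
      \<open>c * (1 + p^2) / a\<close>.\<close>
    obtain d4 where d4: "d4 > 0" "\<And>x. \<bar>x - x0\<bar> < d4 \<Longrightarrow> a x > 0 \<Longrightarrow> - deriv u x \<le> - T"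
    proof (rule barrier_near_zero[OF z d3 cd(1), where q="\<lambda>x. - deriv u x" and T="- T"
          and q'="\<lambda>x. - ((lam - H x (deriv u x)) / a x)"])
      fix x assume x: "\<bar>x - x0\<bar> < d3" "a x > 0"
      show "((\<lambda>x. - deriv u x) has_real_derivative - ((lam - H x (deriv u x)) / a x)) (at x)"
        by (rule DERIV_minus[OF sol_C2_at(2)[OF sol x(2)]])
      show "a x * - ((lam - H x (deriv u x)) / a x) \<le> - c * (1 + (- deriv u x)\<^sup>2)" if "- T \<le> - deriv u x"
        using cd(3)[of x "deriv u x"] ge_m[OF x] x that by (simp add: d3_def)
    qed blast
    define d5 where "d5 = min d3 d4"
    have "T * (y - x) \<le> u y - u x" if "x0 - d5 < x" "x \<le> y" "y < x0 + d5" for x y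
    proof (rule superjet_slope_ge[OF sol_cont[OF sol] _ that])
      fix t p X assume t: "x0 - d5 < t" "t < x0 + d5" and j: "superjet u t p X"
      then have t': "\<bar>t - x0\<bar> < d3" "\<bar>t - x0\<bar> < d4" by (auto simp: d5_def)
      show "T \<le> p"
      proof (cases "a t = 0")
        case True
        have 1: "lam \<le> H t p" using sol_superjet[OF sol j] True by simp
        have 2: "m \<le> p"
        proof (rule superjet_slope_lower_bound[OF j])
          have "\<forall>\<^sub>F y in at_right t. y \<in> {t<..<x0 + d3}" using t by (intro eventually_at_right_real) (simp add: d5_def)
          then show "\<forall>\<^sub>F y in at_right t. m * (y - t) \<le> u y - u t"
            by eventually_elim (use t in \<open>auto intro!: sl simp: d3_def d5_def\<close>)
        qed
        have "c * (1 + p\<^sup>2) > 0" using cd(1) by (simp add: add_pos_nonneg)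
        then show ?thesis using cd(3)[of t p] 1 2 t' by (force simp: d3_def)
      next
        case False
        then have "a t > 0" using a_nonneg[of t] by simp
        then show ?thesis using d4(2)[OF t'(2)] superjet_deriv_eq[OF j sol_C2_at(1)[OF sol]] by simp
      qed
    qed
    then show ?thesis using d3 d4 by (intro exI[of _ d5]) (auto simp: d5_def T_def)
  qed
  then obtain d2 where "d2 > 0" "\<And>x y. x0 - d2 < x \<Longrightarrow> x \<le> y \<Longrightarrow> y < x0 + d2 \<Longrightarrow> (?P - e) * (y - x) \<le> u y - u x"
    by blast
  then show "\<exists>d>0. \<forall>x y. x0 - d < x \<longrightarrow> x \<le> y \<longrightarrow> y < x0 + d \<longrightarrow>
      (?P - e) * (y - x) \<le> u y - u x \<and> u y - u x \<le> (?P + e) * (y - x)"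
    using d1 by (intro exI[of _ "min d1 d2"]) auto
qed

end

section \<open>Differentiability and uniqueness\<close>

text \<open>Truncating the slope turns the local Lipschitz bound of \<open>H\<close> in
  \<open>p\<close> into a global one, as Picard iteration requires; a priori bounds by
  \<open>K\<close> later remove the truncation.\<close>

definition clamp_abs :: "real \<Rightarrow> real \<Rightarrow> real" where
  "clamp_abs K p = max (- K) (min K p)"

lemma clamp_abs_lipschitz: "\<bar>clamp_abs K p - clamp_abs K q\<bar> \<le> \<bar>p - q\<bar>"
  unfolding clamp_abs_def by (auto simp: max_def min_def abs_if)

lemma clamp_abs_eq: "\<bar>p\<bar> \<le> K \<Longrightarrow> clamp_abs K p = p"
  unfolding clamp_abs_def by (auto simp: max_def min_def)

lemma clamp_abs_bound: "0 \<le> K \<Longrightarrow> \<bar>clamp_abs K p\<bar> \<le> K"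
  unfolding clamp_abs_def by (auto simp: max_def min_def)

lemma continuous_on_clamp_abs [continuous_intros]:
  "continuous_on S f \<Longrightarrow> continuous_on S (\<lambda>x. clamp_abs K (f x))"
  unfolding clamp_abs_def by (intro continuous_intros)

context degenerate_hj
begin

text \<open>At a zero of \<open>a\<close> coercivity provides barriers at \<open>B\<close> and
  \<open>- B\<close>; elsewhere the quadratic expansion suffices. For merely continuous functions an
  almost everywhere inequality between derivatives could not be integrated.\<close>

lemma sol_locally_Lipschitz:
  assumes sol: "visc_sol a H lam u"
  shows "\<exists>d>0. \<exists>B. \<forall>y. \<bar>y - x\<bar> < d \<longrightarrow> \<bar>u y - u x\<bar> \<le> B * \<bar>y - x\<bar>"
proof (cases "a x = 0")
  case True
  obtain K where K: "\<And>x p. K \<le> \<bar>p\<bar> \<Longrightarrow> 1 + p\<^sup>2 \<le> H x p - lam" using H_coercive[of lam] by blast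
  have big: "lam < H x p" if "K \<le> \<bar>p\<bar>" for p
  proof -
    have "0 \<le> p\<^sup>2" by simp
    then show ?thesis using K[OF that, of x] by linarith
  qed
  define B where "B = \<bar>K\<bar>"
  obtain d1 where d1: "d1 > 0" "\<And>s t. x - d1 < s \<Longrightarrow> s \<le> t \<Longrightarrow> t < x + d1 \<Longrightarrow> u t - u s \<le> B * (t - s)"
    by (rule sol_slope_le_near_zero[OF sol True, of B]) (use big in \<open>auto simp: B_def\<close>)
  obtain d2 where d2: "d2 > 0" "\<And>s t. x - d2 < s \<Longrightarrow> s \<le> t \<Longrightarrow> t < x + d2 \<Longrightarrow> - B * (t - s) \<le> u t - u s"
    by (rule sol_slope_ge_near_zero[OF sol True, of "- B"]) (use big in \<open>auto simp: B_def\<close>)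
  have "\<bar>u y - u x\<bar> \<le> B * \<bar>y - x\<bar>" if "\<bar>y - x\<bar> < min d1 d2" for y
  proof (cases "x \<le> y")
    case True
    then show ?thesis using d1(2)[of x y] d2(2)[of x y] that d1(1) d2(1) by auto
  next
    case False
    then show ?thesis using d1(2)[of y x] d2(2)[of y x] that d1(1) d2(1) by (auto simp: abs_if)
  qed
  then show ?thesis using d1(1) d2(1) by (intro exI[of _ "min d1 d2"]) auto
next
  case False
  then have "a x > 0" using a_nonneg[of x] by simp
  obtain d C p where d: "d > 0"
    "\<And>t y. \<bar>t - x\<bar> < d \<Longrightarrow> \<bar>y - x\<bar> < d \<Longrightarrow> \<bar>u y - u t - p t * (y - t)\<bar> \<le> C / 2 * (y - t)\<^sup>2"
    using sol_C11_near[OF sol \<open>a x > 0\<close>] by metis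
  have "\<bar>u y - u x\<bar> \<le> (\<bar>C\<bar> / 2 * d + \<bar>p x\<bar>) * \<bar>y - x\<bar>" if y: "\<bar>y - x\<bar> < d" for y
  proof -
    have "\<bar>u y - u x - p x * (y - x)\<bar> \<le> C / 2 * (y - x)\<^sup>2" using d y by simp
    moreover have "C / 2 * (y - x)\<^sup>2 \<le> \<bar>C\<bar> / 2 * (y - x)\<^sup>2" by (intro mult_right_mono) auto
    moreover have "\<bar>C\<bar> / 2 * (y - x)\<^sup>2 \<le> \<bar>C\<bar> / 2 * d * \<bar>y - x\<bar>"
    proof -
      have "\<bar>C\<bar> / 2 * (y - x)\<^sup>2 = \<bar>C\<bar> / 2 * \<bar>y - x\<bar> * \<bar>y - x\<bar>" by (simp add: power2_eq_square)
      also have "\<dots> \<le> \<bar>C\<bar> / 2 * d * \<bar>y - x\<bar>" using y by (intro mult_right_mono mult_left_mono) auto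
      finally show ?thesis .
    qed
    moreover have "\<bar>p x * (y - x)\<bar> = \<bar>p x\<bar> * \<bar>y - x\<bar>" by (rule abs_mult)
    ultimately show ?thesis unfolding distrib_right by linarith
  qed
  then show ?thesis using d(1) by blast
qed

text \<open>The hypothesis \<open>w' > v'\<close> is used later in this integrated form, which
  speaks about slopes near zeros of \<open>a\<close>, where neither function is known to be
  smooth.\<close>

lemma sol_diff_mono:
  assumes w: "visc_sol a H lam w" and v: "visc_sol a H mu v"
    and ae: "AE x in lborel. w differentiable (at x) \<and> v differentiable (at x) \<and> deriv w x > deriv v x"
    and xy: "x \<le> y"
  shows "v y - v x \<le> w y - w x"
proof -
  have "w x - v x \<le> w y - v y"
  proof (rule locally_Lipschitz_AE_deriv_nonneg_imp_mono[where f="\<lambda>x. w x - v x", OF _ _ xy])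
    fix x
    obtain d1 B1 where 1: "d1 > 0" "\<And>y. \<bar>y - x\<bar> < d1 \<Longrightarrow> \<bar>w y - w x\<bar> \<le> B1 * \<bar>y - x\<bar>"
      using sol_locally_Lipschitz[OF w] by blast
    obtain d2 B2 where 2: "d2 > 0" "\<And>y. \<bar>y - x\<bar> < d2 \<Longrightarrow> \<bar>v y - v x\<bar> \<le> B2 * \<bar>y - x\<bar>"
      using sol_locally_Lipschitz[OF v] by blast
    have "\<bar>w y - v y - (w x - v x)\<bar> \<le> (B1 + B2) * \<bar>y - x\<bar>" if "\<bar>y - x\<bar> < min d1 d2" for y
      using 1(2)[of y] 2(2)[of y] that unfolding distrib_right by auto
    then show "\<exists>d>0. \<exists>B. \<forall>y. \<bar>y - x\<bar> < d \<longrightarrow> \<bar>w y - v y - (w x - v x)\<bar> \<le> B * \<bar>y - x\<bar>"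
      using 1(1) 2(1) by (intro exI[of _ "min d1 d2"]) auto
  next
    show "AE x in lborel. \<exists>D\<ge>0. ((\<lambda>x. w x - v x) has_real_derivative D) (at x)"
      using ae
    proof eventually_elim
      case (elim x)
      then have "((\<lambda>x. w x - v x) has_real_derivative deriv w x - deriv v x) (at x)"
        by (intro DERIV_diff) (auto simp: DERIV_deriv_iff_real_differentiable)
      then show ?case using elim by (intro exI[of _ "deriv w x - deriv v x"]) auto
    qed
  qed
  then show ?thesis by simp
qed

text \<open>A slope just below \<open>p_minus\<close> at level \<open>mu\<close> lies outside the
  sublevel set at \<open>mu\<close>, so it bounds the slopes of \<open>v\<close> from below, and by
  continuity of \<open>H\<close> it lies strictly inside the sublevel set at \<open>lam\<close>. The
  strict gap \<open>mu < lam\<close> is spent here.\<close>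

lemma sol_slope_ge_sublevel:
  assumes v: "visc_sol a H mu v" and less: "mu < lam" and z: "a x0 = 0"
  obtains m d where "H x0 m < lam" "d > 0"
    "\<And>x y. x0 - d < x \<Longrightarrow> x \<le> y \<Longrightarrow> y < x0 + d \<Longrightarrow> m * (y - x) \<le> v y - v x"
proof -
  note P = p_minus_props[OF level_nonempty[OF v z]]
  let ?P = "p_minus H mu x0"
  have "continuous_on UNIV (\<lambda>p. H x0 p)" by (intro continuous_intros)
  then have "((\<lambda>p. H x0 p) \<longlongrightarrow> H x0 ?P) (at_left ?P)"
    by (simp add: continuous_on_eq_continuous_at isCont_def filterlim_at_split)
  then have "\<forall>\<^sub>F p in at_left ?P. H x0 p < lam" by (rule order_tendstoD) (use P(1) less in simp)
  moreover have "\<forall>\<^sub>F p in at_left ?P. p < ?P" by (simp add: eventually_at_filter)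
  ultimately have "\<forall>\<^sub>F p in at_left ?P. H x0 p < lam \<and> p < ?P" by (rule eventually_conj)
  then obtain m where m: "H x0 m < lam" "m < ?P"
    using eventually_happens'[OF trivial_limit_at_left_real] by blast
  show ?thesis
    by (rule sol_slope_ge_near_zero[OF v z, of m]) (use P(2) m that in auto)
qed

lemma sol_above_slopes_tend_to_p_plus:
  assumes w: "visc_sol a H lam w" and v: "visc_sol a H mu v" and less: "mu < lam"
    and mono: "\<And>x y. x \<le> y \<Longrightarrow> v y - v x \<le> w y - w x" and z: "a x0 = 0"
  shows "slopes_tend_to w x0 (p_plus H lam x0)"
proof -
  obtain m d where m: "H x0 m < lam" "d > 0"
    "\<And>x y. x0 - d < x \<Longrightarrow> x \<le> y \<Longrightarrow> y < x0 + d \<Longrightarrow> m * (y - x) \<le> v y - v x"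
    using sol_slope_ge_sublevel[OF v less z] by metis
  show ?thesis
    by (rule sol_slopes_tend_to_p_plus[OF w z m(1,2)]) (use m(3) mono order_trans in blast)
qed

lemma sol_differentiable_if_slopes_le:
  assumes sol: "visc_sol a H lam u" and z: "a x0 = 0" and m: "H x0 m < lam" and d0: "d0 > 0"
    and sl: "\<And>x y. x0 - d0 < x \<Longrightarrow> x \<le> y \<Longrightarrow> y < x0 + d0 \<Longrightarrow> u y - u x \<le> m * (y - x)"
  shows "u differentiable (at x0)"
proof -
  have "slopes_tend_to (\<lambda>t. u (- t)) (- x0) (p_plus (\<lambda>x p. H (- x) (- p)) lam (- x0))"
  proof (rule degenerate_hj.sol_slopes_tend_to_p_plus[OF reflect sol_reflect[OF sol], where m="- m"])
    show "- m * (y - x) \<le> u (- y) - u (- x)" if "- x0 - d0 < x" "x \<le> y" "y < - x0 + d0" for x y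
      using sl[of "- y" "- x"] that by (simp add: algebra_simps)
  qed (use z m d0 in auto)
  from slopes_tend_to_imp_deriv[OF this]
  have "((\<lambda>t. u (- t)) has_real_derivative (p_plus (\<lambda>x p. H (- x) (- p)) lam (- x0))) (at (- x0))" .
  then have "((\<lambda>t. u (- (- t))) has_real_derivative - (p_plus (\<lambda>x p. H (- x) (- p)) lam (- x0))) (at x0)"
    using DERIV_mirror[of "\<lambda>t. u (- t)" "p_plus (\<lambda>x p. H (- x) (- p)) lam (- x0)" x0] by simp
  then show ?thesis by (auto simp: real_differentiable_def)
qed

text \<open>Near a zero of \<open>a\<close> where the sublevel set has interior, \<open>v - m x\<close> has no local maximum for
  \<open>m\<close> in that interior; so a kink at \<open>y\<close> forces low slopes to its left and high slopes to its right.\<close>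

lemma countable_sol_not_differentiable:
  assumes v: "visc_sol a H mu v"
  shows "countable {x. \<not> v differentiable (at x)}"
proof (rule countable_if_isolated)
  fix y assume "y \<in> {x. \<not> v differentiable (at x)}"
  then have nd: "\<not> v differentiable (at y)" by simp
  have dA: "v differentiable (at x)" if "a x > 0" for x
    using sol_C2_at(1)[OF v that] by (auto simp: real_differentiable_def)
  have z: "a y = 0" using dA[of y] nd a_nonneg[of y] by force
  note ne = level_nonempty[OF v z]
  note P = p_plus_props[OF ne]
  note Q = p_minus_props[OF ne]
  let ?P = "p_plus H mu y" let ?Q = "p_minus H mu y"
  \<comment> \<open>If the sublevel set is a single point, slopes are squeezed from both sides and
    \<open>v\<close> is differentiable at \<open>y\<close>.\<close>
  have QP: "?Q < ?P"
  proof (rule ccontr)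
    assume "\<not> ?Q < ?P"
    moreover have "?Q \<le> ?P" using Q(1) P(3) by simp
    ultimately have eq: "?Q = ?P" by simp
    have "slopes_tend_to v y ?P" unfolding slopes_tend_to_def
    proof (intro allI impI)
      fix e :: real assume e: "e > 0"
      obtain d1 where d1: "d1 > 0" "\<And>s t. y - d1 < s \<Longrightarrow> s \<le> t \<Longrightarrow> t < y + d1 \<Longrightarrow> v t - v s \<le> (?P + e) * (t - s)"
        by (rule sol_slope_le_near_zero[OF v z, of "?P + e"]) (use P(2) e in auto)
      obtain d2 where d2: "d2 > 0" "\<And>s t. y - d2 < s \<Longrightarrow> s \<le> t \<Longrightarrow> t < y + d2 \<Longrightarrow> (?P - e) * (t - s) \<le> v t - v s"
        by (rule sol_slope_ge_near_zero[OF v z, of "?P - e"]) (use Q(2) e eq in auto)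
      show "\<exists>d>0. \<forall>s t. y - d < s \<longrightarrow> s \<le> t \<longrightarrow> t < y + d \<longrightarrow>
          (?P - e) * (t - s) \<le> v t - v s \<and> v t - v s \<le> (?P + e) * (t - s)"
        using d1 d2 by (intro exI[of _ "min d1 d2"]) auto
    qed
    from slopes_tend_to_imp_deriv[OF this] show False using nd by (auto simp: real_differentiable_def)
  qed
  define m where "m = (?P + ?Q) / 2"
  have "H y m < max (H y ?Q) (H y ?P)" by (rule H_sqc) (use QP in \<open>auto simp: m_def\<close>)
  then have Hm: "H y m < mu" using P(1) Q(1) by simp
  have "continuous_on UNIV (\<lambda>x. H x m)" by (intro continuous_intros)
  then have "isCont (\<lambda>x. H x m) y" by (simp add: continuous_on_eq_continuous_at)
  then have "((\<lambda>x. H x m) \<longlongrightarrow> H y m) (nhds y)"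
    unfolding isCont_def by (rule tendsto_at_iff_tendsto_nhds[of "\<lambda>x. H x m" y, THEN iffD1])
  then have "\<forall>\<^sub>F x in nhds y. H x m < mu" by (rule order_tendstoD) (use Hm in simp)
  then obtain d where d: "d > 0" "\<And>x. dist x y < d \<Longrightarrow> H x m < mu"
    unfolding eventually_nhds_metric by blast
  define f where "f x = v x - m * x" for x
  have fc: "continuous_on {y - d<..<y + d} f"
    unfolding f_def by (intro continuous_intros sol_cont[OF v])
  \<comment> \<open>A line of slope \<open>m\<close> touching from above is a superjet with
    \<open>X = 0\<close>, so it would force \<open>H x m \<ge> mu\<close> whatever the value of
    \<open>a\<close>.\<close>
  have nomax: "\<not> (\<forall>\<^sub>F t in at x. f t \<le> f x)" if x: "y - d < x" "x < y + d" for x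
  proof
    assume "\<forall>\<^sub>F t in at x. f t \<le> f x"
    then have "superjet v x m 0" unfolding superjet_altdef f_def
      by eventually_elim (simp add: algebra_simps)
    from sol_superjet[OF v this] have "mu \<le> H x m" by simp
    moreover have "dist x y < d" using x by (simp add: dist_real_def abs_less_iff)
    ultimately show False using d(2)[of x] by simp
  qed
  note dich = no_local_max_dichotomy[OF fc nomax]
  have up: "v differentiable (at x)" if x: "\<bar>x - y\<bar> < d" and e: "e > 0"
    and sl: "\<And>s t. x - e < s \<Longrightarrow> s \<le> t \<Longrightarrow> t < x + e \<Longrightarrow> f s \<le> f t" for x e
  proof (cases "a x = 0")
    case True
    have "slopes_tend_to v x (p_plus H mu x)"
      by (rule sol_slopes_tend_to_p_plus[OF v True _ e, of m])
         (use sl d(2)[of x] x in \<open>auto simp: f_def dist_real_def algebra_simps\<close>)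
    from slopes_tend_to_imp_deriv[OF this] show ?thesis by (auto simp: real_differentiable_def)
  qed (use dA a_nonneg[of x] in auto)
  have dn: "v differentiable (at x)" if x: "\<bar>x - y\<bar> < d" and e: "e > 0"
    and sl: "\<And>s t. x - e < s \<Longrightarrow> s \<le> t \<Longrightarrow> t < x + e \<Longrightarrow> f t \<le> f s" for x e
  proof (cases "a x = 0")
    case True
    show ?thesis
      by (rule sol_differentiable_if_slopes_le[OF v True _ e, of m])
         (use sl d(2)[of x] x in \<open>auto simp: f_def dist_real_def algebra_simps\<close>)
  qed (use dA a_nonneg[of x] in auto)
  \<comment> \<open>The midpoint \<open>t\<close> separates \<open>y\<close> from \<open>z\<close>.
    The alternative of the dichotomy that covers a neighbourhood of \<open>y\<close> would make
    \<open>v\<close> differentiable there, so the other one holds and covers a neighbourhood of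
    \<open>z\<close>.\<close>
  have "v differentiable (at z)" if z: "\<bar>z - y\<bar> < d" "z \<noteq> y" for z
  proof (cases "y < z")
    case True
    define t where "t = (y + z) / 2"
    have t: "y < t" "t < z" "t < y + d" using True z by (auto simp: t_def)
    have "\<not> (\<forall>s s'. y - d < s \<longrightarrow> s \<le> s' \<longrightarrow> s' \<le> t \<longrightarrow> s' < y + d \<longrightarrow> f s' \<le> f s)"
    proof
      assume "\<forall>s s'. y - d < s \<longrightarrow> s \<le> s' \<longrightarrow> s' \<le> t \<longrightarrow> s' < y + d \<longrightarrow> f s' \<le> f s"
      then have "v differentiable (at y)"
        using dn[of y "min d (t - y)"] d t by auto
      then show False using nd by simp
    qed
    then have "\<forall>s s'. t \<le> s \<longrightarrow> s \<le> s' \<longrightarrow> y - d < s \<longrightarrow> s' < y + d \<longrightarrow> f s \<le> f s'" using dich[of t] by blast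
    then show ?thesis using up[of z "min (y + d - z) (z - t)"] z t True by auto
  next
    case False
    then have zy: "z < y" using z by simp
    define t where "t = (y + z) / 2"
    have t: "z < t" "t < y" "y - d < t" using zy z by (auto simp: t_def abs_if)
    have "\<not> (\<forall>s s'. t \<le> s \<longrightarrow> s \<le> s' \<longrightarrow> y - d < s \<longrightarrow> s' < y + d \<longrightarrow> f s \<le> f s')"
    proof
      assume "\<forall>s s'. t \<le> s \<longrightarrow> s \<le> s' \<longrightarrow> y - d < s \<longrightarrow> s' < y + d \<longrightarrow> f s \<le> f s'"
      then have "v differentiable (at y)"
        using up[of y "min d (y - t)"] d t by auto
      then show False using nd by simp
    qed
    then have "\<forall>s s'. y - d < s \<longrightarrow> s \<le> s' \<longrightarrow> s' \<le> t \<longrightarrow> s' < y + d \<longrightarrow> f s' \<le> f s" using dich[of t] by blast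
    then show ?thesis using dn[of z "min (z - (y - d)) (t - z)"] z t zy by auto
  qed
  then show "\<exists>d>0. \<forall>z\<in>{x. \<not> v differentiable (at x)}. \<bar>z - y\<bar> < d \<longrightarrow> z = y"
    using d(1) by blast
qed

section \<open>Strict gaps at the zeros and comparison for the slope equation\<close>

lemma sol_deriv_le_p_plus:
  assumes v: "visc_sol a H mu v" and z: "a x = 0" and D: "(v has_real_derivative D) (at x)"
  shows "D \<le> p_plus H mu x"
proof (rule field_le_epsilon)
  fix e :: real assume e: "e > 0"
  note P = p_plus_props[OF level_nonempty[OF v z]]
  obtain d where d: "d > 0" "\<And>s t. x - d < s \<Longrightarrow> s \<le> t \<Longrightarrow> t < x + d \<Longrightarrow> v t - v s \<le> (p_plus H mu x + e) * (t - s)"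
    by (rule sol_slope_le_near_zero[OF v z, of "p_plus H mu x + e"]) (use P(2) e in auto)
  show "D \<le> p_plus H mu x + e" by (rule deriv_le_of_slopes[OF d(2) _ _ D]) (use d(1) in auto)
qed

lemma p_plus_strict_mono:
  assumes "\<exists>p. H x p \<le> mu" "mu < lam"
  shows "p_plus H mu x < p_plus H lam x"
proof -
  note P = p_plus_props[OF assms(1)]
  have ne: "\<exists>p. H x p \<le> lam" using assms by (meson less_le_trans less_imp_le order_trans)
  note Q = p_plus_props[OF ne]
  have "p_plus H mu x \<le> p_plus H lam x" using P(1) assms(2) by (intro Q(3)) simp
  moreover have "p_plus H mu x \<noteq> p_plus H lam x" using P(1) Q(1) assms(2) by auto
  ultimately show ?thesis by simp
qed

text \<open>On a compact interval inside \<open>{a > 0}\<close> the minimum \<open>a x0\<close> is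
  positive, so \<open>f - g\<close> satisfies a Gronwall inequality with constant
  \<open>\<bar>M\<bar> / a x0\<close>. Differential inequalities in place of equations allow
  constants, and slopes of solutions at a lower level, as barriers.\<close>

lemma ode_compare:
  assumes pos: "\<And>x. c \<le> x \<Longrightarrow> x \<le> d \<Longrightarrow> a x > 0" and K: "K \<ge> 0" and cd: "c \<le> d"
    and f: "continuous_on {c..d} f" and g: "continuous_on {c..d} g"
    and f': "\<And>x. c < x \<Longrightarrow> x < d \<Longrightarrow> \<exists>f'. (f has_real_derivative f') (at x) \<and> f' \<le> (lam - H x (clamp_abs K (f x))) / a x"
    and g': "\<And>x. c < x \<Longrightarrow> x < d \<Longrightarrow> \<exists>g'. (g has_real_derivative g') (at x) \<and> (lam - H x (clamp_abs K (g x))) / a x \<le> g'"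
    and init: "f c \<le> g c"
  shows "f d \<le> g d"
proof -
  obtain M where M: "\<And>x p q. \<bar>p\<bar> \<le> K \<Longrightarrow> \<bar>q\<bar> \<le> K \<Longrightarrow> \<bar>H x p - H x q\<bar> \<le> M * \<bar>p - q\<bar>"
    using H_lip_p[of K] by blast
  have "\<exists>x0\<in>{c..d}. \<forall>x\<in>{c..d}. a x0 \<le> a x"
    by (rule continuous_attains_inf) (use cd continuous_on_subset[OF a_cont] in auto)
  then obtain x0 where x0: "x0 \<in> {c..d}" "\<And>x. x \<in> {c..d} \<Longrightarrow> a x0 \<le> a x" by blast
  have a0: "a x0 > 0" using pos x0 by simp
  have "f d - g d \<le> 0"
  proof (rule gronwall_nonpos[where D="\<lambda>x. f x - g x" and c=c and M="\<bar>M\<bar> / a x0"])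
    fix x assume x: "c < x" "x < d" and D: "0 < f x - g x"
    obtain f1 where f1: "(f has_real_derivative f1) (at x)" "f1 \<le> (lam - H x (clamp_abs K (f x))) / a x"
      using f' x by blast
    obtain g1 where g1: "(g has_real_derivative g1) (at x)" "(lam - H x (clamp_abs K (g x))) / a x \<le> g1"
      using g' x by blast
    have ax: "a x0 \<le> a x" "a x > 0" using x0(2)[of x] pos[of x] x by auto
    have "f1 - g1 \<le> (lam - H x (clamp_abs K (f x))) / a x - (lam - H x (clamp_abs K (g x))) / a x"
      using f1 g1 by simp
    also have "\<dots> = (H x (clamp_abs K (g x)) - H x (clamp_abs K (f x))) / a x"
      by (simp add: diff_divide_distrib)
    also have "\<dots> \<le> (\<bar>M\<bar> * (f x - g x)) / a x"
    proof (rule divide_right_mono)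
      have "H x (clamp_abs K (g x)) - H x (clamp_abs K (f x)) \<le> M * \<bar>clamp_abs K (g x) - clamp_abs K (f x)\<bar>"
        using M[OF clamp_abs_bound[OF K] clamp_abs_bound[OF K], of x "g x" "f x"] by linarith
      also have "\<dots> \<le> \<bar>M\<bar> * \<bar>g x - f x\<bar>"
        by (intro mult_mono clamp_abs_lipschitz) auto
      also have "\<dots> = \<bar>M\<bar> * (f x - g x)" using D by simp
      finally show "H x (clamp_abs K (g x)) - H x (clamp_abs K (f x)) \<le> \<bar>M\<bar> * (f x - g x)" .
    qed (use ax in simp)
    also have "\<dots> \<le> (\<bar>M\<bar> * (f x - g x)) / a x0"
      using ax a0 D by (intro divide_left_mono mult_nonneg_nonneg mult_pos_pos) auto
    finally have "f1 - g1 \<le> \<bar>M\<bar> / a x0 * (f x - g x)" by simp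
    then show "\<exists>D'. ((\<lambda>x. f x - g x) has_real_derivative D') (at x) \<and> D' \<le> \<bar>M\<bar> / a x0 * (f x - g x)"
      using DERIV_diff[OF f1(1) g1(1)] by blast
  qed (use cd init in \<open>auto intro!: continuous_intros f g\<close>)
  then show ?thesis by simp
qed

lemma sol_deriv_continuous_on:
  assumes "visc_sol a H lam u" "\<And>x. x \<in> S \<Longrightarrow> a x > 0"
  shows "continuous_on S (deriv u)"
  by (rule DERIV_continuous_on, rule has_field_derivative_at_within, rule sol_C2_at(2)) (use assms in auto)

lemma sol_deriv_le_coercive:
  assumes sol: "visc_sol a H lam u" and K: "\<And>x p. K \<le> \<bar>p\<bar> \<Longrightarrow> 1 + p\<^sup>2 \<le> H x p - lam" and x: "a x > 0"
  shows "deriv u x \<le> K"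
proof -
  obtain z where z: "z < x" "a z = 0" "\<And>y. z < y \<Longrightarrow> y \<le> x \<Longrightarrow> a y > 0" using left_zero[OF x] by metis
  show ?thesis
  proof (rule barrier_left[OF z(2,1,3), where c=1 and q="deriv u" and q'="\<lambda>x. (lam - H x (deriv u x)) / a x"])
    fix y assume y: "z < y" "y \<le> x"
    show "(deriv u has_real_derivative (lam - H y (deriv u y)) / a y) (at y)"
      by (rule sol_C2_at(2)[OF sol z(3)[OF y]])
    show "a y * ((lam - H y (deriv u y)) / a y) \<le> - 1 * (1 + (deriv u y)\<^sup>2)" if "K \<le> deriv u y"
    proof -
      have "1 + (deriv u y)\<^sup>2 \<le> H y (deriv u y) - lam" by (rule K) (use that in linarith)
      then show ?thesis using z(3)[OF y] by simp
    qed
  qed auto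
qed

lemma sol_deriv_abs_le_coercive:
  assumes sol: "visc_sol a H lam u" and K: "\<And>x p. K \<le> \<bar>p\<bar> \<Longrightarrow> 1 + p\<^sup>2 \<le> H x p - lam" and x: "a x > 0"
  shows "\<bar>deriv u x\<bar> \<le> K"
proof -
  have "deriv (\<lambda>t. u (- t)) (- x) \<le> K"
  proof (rule degenerate_hj.sol_deriv_le_coercive[OF reflect sol_reflect[OF sol]])
    show "1 + p\<^sup>2 \<le> H (- x) (- p) - lam" if "K \<le> \<bar>p\<bar>" for x p using K[of "- p" "- x"] that by simp
  qed (use x in simp)
  moreover have "deriv (\<lambda>t. u (- t)) (- x) = - deriv u x"
    using DERIV_mirror[of u "deriv u x" "- x"] sol_C2_at(1)[OF sol x] by (intro DERIV_imp_deriv) simp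
  moreover have "deriv u x \<le> K" by (rule sol_deriv_le_coercive[OF sol K x])
  ultimately show ?thesis by simp
qed

end

section \<open>Slope profiles and the solution on one component\<close>

context degenerate_hj
begin

text \<open>A profile is the derivative of the sought upper solution, described without any
  comparison solution: the slope equation where \<open>a > 0\<close>, the upper endpoint at zeros,
  and continuity to link the two.\<close>

definition profile :: "real \<Rightarrow> (real \<Rightarrow> real) \<Rightarrow> bool" where
  "profile lam q \<longleftrightarrow> continuous_on UNIV q \<and> (\<forall>x. a x = 0 \<longrightarrow> q x = p_plus H lam x) \<and>
     (\<forall>x. a x > 0 \<longrightarrow> (q has_real_derivative (lam - H x (q x)) / a x) (at x))"

lemma ode_compare_unclamped:
  assumes pos: "\<And>x. c \<le> x \<Longrightarrow> x \<le> d \<Longrightarrow> a x > 0" and cd: "c \<le> d" and mu: "mu \<le> lam"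
    and f: "\<And>x. c \<le> x \<Longrightarrow> x \<le> d \<Longrightarrow> (f has_real_derivative (mu - H x (f x)) / a x) (at x)"
    and g: "\<And>x. c \<le> x \<Longrightarrow> x \<le> d \<Longrightarrow> (g has_real_derivative (lam - H x (g x)) / a x) (at x)"
    and init: "f c \<le> g c"
  shows "f d \<le> g d"
proof -
  have fc: "continuous_on {c..d} f"
    by (rule DERIV_continuous_on, rule has_field_derivative_at_within, rule f) auto
  have gc: "continuous_on {c..d} g"
    by (rule DERIV_continuous_on, rule has_field_derivative_at_within, rule g) auto
  have "bounded (f ` {c..d} \<union> g ` {c..d})"
    unfolding bounded_Un by (intro conjI compact_imp_bounded compact_continuous_image fc gc) auto
  then obtain K where K: "\<And>t. t \<in> f ` {c..d} \<union> g ` {c..d} \<Longrightarrow> \<bar>t\<bar> \<le> K"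
    unfolding bounded_iff real_norm_def by blast
  have Kf: "\<bar>f x\<bar> \<le> K" "\<bar>g x\<bar> \<le> K" if "c \<le> x" "x \<le> d" for x using K that by auto
  have K0: "K \<ge> 0" using Kf(1)[of c] cd by linarith
  show ?thesis
  proof (rule ode_compare[OF pos K0 cd fc gc _ _ init, where lam=lam])
    fix x assume x: "c < x" "x < d"
    have "(mu - H x (f x)) / a x \<le> (lam - H x (f x)) / a x"
      using mu pos[of x] x by (intro divide_right_mono) auto
    then show "\<exists>f'. (f has_real_derivative f') (at x) \<and> f' \<le> (lam - H x (clamp_abs K (f x))) / a x"
      using f[of x] x clamp_abs_eq[OF Kf(1), of x] by auto
    show "\<exists>g'. (g has_real_derivative g') (at x) \<and> (lam - H x (clamp_abs K (g x))) / a x \<le> g'"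
      using g[of x] x clamp_abs_eq[OF Kf(2), of x] by auto
  qed auto
qed

lemma profile_le:
  assumes q1: "profile lam q1" and q2: "profile lam q2" and ne: "\<And>x. a x = 0 \<Longrightarrow> \<exists>p. H x p < lam"
  shows "q1 x \<le> q2 x"
proof (cases "a x = 0")
  case True
  then show ?thesis using q1 q2 by (simp add: profile_def)
next
  case False
  then have ax: "a x > 0" using a_nonneg[of x] by simp
  obtain z where z: "z < x" "a z = 0" "\<And>y. z < y \<Longrightarrow> y \<le> x \<Longrightarrow> a y > 0" using left_zero[OF ax] by metis
  have c1: "continuous_on S q1" and c2: "continuous_on S q2" for S
    using q1 q2 by (auto simp: profile_def intro: continuous_on_subset)
  have d1: "(q1 has_real_derivative (lam - H y (q1 y)) / a y) (at y)" if "a y > 0" for y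
    using q1 that by (simp add: profile_def)
  have d2: "(q2 has_real_derivative (lam - H y (q2 y)) / a y) (at y)" if "a y > 0" for y
    using q2 that by (simp add: profile_def)
  have qz: "q1 z = p_plus H lam z" "q2 z = p_plus H lam z" using q1 q2 z by (auto simp: profile_def)
  show ?thesis
  proof (rule ccontr)
    assume "\<not> ?thesis"
    then have Dx: "q1 x - q2 x > 0" by simp
    have Dz: "q1 z - q2 z \<le> 0" using qz by simp
    have Dc: "continuous_on {z..x} (\<lambda>t. q1 t - q2 t)" by (intro continuous_intros c1 c2)
    obtain y where y: "z \<le> y" "y < x" "q1 y - q2 y = 0" "\<And>t. y < t \<Longrightarrow> t \<le> x \<Longrightarrow> q1 t - q2 t > 0"
      by (rule last_nonpos_point[OF Dc less_imp_le[OF z(1)] Dz Dx]) blast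
    show False
    proof (cases "y = z")
      case False
      have "q1 x \<le> q2 x"
        by (rule ode_compare_unclamped[where c=y and mu=lam and lam=lam])
           (use y z False in \<open>auto intro!: d1 d2\<close>)
      then show False using y(4)[of x] y by simp
    next
      case True
      obtain m where m: "H z m < lam" using ne[OF z(2)] by blast
      note P = p_plus_props[OF exI, OF less_imp_le[OF m]]
      have mP: "m < p_plus H lam z" using P(1) P(3)[of m] m by (metis less_imp_le order_le_less less_irrefl)
      have "continuous_on UNIV (\<lambda>t. H t (q2 t) - H t m)" by (intro continuous_intros c2)
      then have "((\<lambda>t. H t (q2 t) - H t m) \<longlongrightarrow> H z (q2 z) - H z m) (at_right z)"
        by (simp add: continuous_on_eq_continuous_at isCont_def filterlim_at_split)
      then have e1: "\<forall>\<^sub>F t in at_right z. 0 < H t (q2 t) - H t m"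
        by (rule order_tendstoD) (use P(1) m qz in simp)
      have "(q2 \<longlongrightarrow> q2 z) (at_right z)"
        using c2[of UNIV] by (simp add: continuous_on_eq_continuous_at isCont_def filterlim_at_split)
      then have e2: "\<forall>\<^sub>F t in at_right z. m < q2 t" by (rule order_tendstoD) (use mP qz in simp)
      obtain b where b: "b > z" "\<And>t. z < t \<Longrightarrow> t < b \<Longrightarrow> 0 < H t (q2 t) - H t m \<and> m < q2 t"
        using eventually_conj[OF e1 e2] unfolding eventually_at_right_field by blast
      define t where "t = min x ((z + b) / 2)"
      have t: "z < t" "t \<le> x" "t < b" using b z by (auto simp: t_def min_def)
      have "\<exists>l s. z < s \<and> s < t \<and> DERIV (\<lambda>t. q1 t - q2 t) s :> l \<and> (q1 t - q2 t) - (q1 z - q2 z) = (t - z) * l"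
      proof (rule MVT[OF t(1)])
        show "continuous_on {z..t} (\<lambda>t. q1 t - q2 t)" by (intro continuous_intros c1 c2)
        show "(\<lambda>t. q1 t - q2 t) differentiable at s" if s: "z < s" "s < t" for s
          using DERIV_diff[OF d1[of s] d2[of s]] z(3)[of s] s t real_differentiable_def by fastforce
      qed
      then obtain l s where s: "z < s" "s < t" "DERIV (\<lambda>t. q1 t - q2 t) s :> l"
        "(q1 t - q2 t) - (q1 z - q2 z) = (t - z) * l" by blast
      have as: "a s > 0" using z(3)[of s] s t by simp
      have "l = (lam - H s (q1 s)) / a s - (lam - H s (q2 s)) / a s"
        using DERIV_unique[OF s(3) DERIV_diff[OF d1[OF as] d2[OF as]]] .
      also have "\<dots> = (H s (q2 s) - H s (q1 s)) / a s" by (simp add: diff_divide_distrib)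
      also have "\<dots> < 0"
      proof -
        have b': "H s m < H s (q2 s)" "m < q2 s" using b(2)[of s] s t by auto
        have "q2 s < q1 s" using y(4)[of s] s t True by simp
        \<comment> \<open>Strict quasiconvexity with \<open>m < q2 s < q1 s\<close>; as
          \<open>H s m < H s (q2 s)\<close>, the maximum must be \<open>H s (q1 s)\<close>.\<close>
        then have "H s (q2 s) < max (H s m) (H s (q1 s))" using H_sqc b' by blast
        then show ?thesis using b' as by (simp add: divide_neg_pos)
      qed
      finally have "(t - z) * l < 0" using t by (simp add: mult_pos_neg)
      then show False using s(4) y(4)[of t] t qz True by simp
    qed
  qed
qed

text \<open>\<open>K\<close> is chosen with \<open>H x K > lam\<close>, so the constant
  \<open>K\<close> is a supersolution of the slope equation: each approximation stays below it, and
  the next one, started earlier, arrives at \<open>c n\<close> no higher than \<open>K\<close>. This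
  gives monotonicity in \<open>n\<close>. Since \<open>mu < lam\<close>, \<open>deriv v\<close> is a
  subsolution and stops the decrease.\<close>

lemma component_solution:
  assumes v: "visc_sol a H mu v" and less: "mu < lam" and zz: "z1 < z2"
    and pos: "\<And>x. z1 < x \<Longrightarrow> x < z2 \<Longrightarrow> a x > 0"
  obtains p where "\<And>x. z1 < x \<Longrightarrow> x < z2 \<Longrightarrow> deriv v x \<le> p x"
    "\<And>x. z1 < x \<Longrightarrow> x < z2 \<Longrightarrow> (p has_real_derivative (lam - H x (p x)) / a x) (at x)"
proof -
  obtain K0 where K0: "\<And>x p. K0 \<le> \<bar>p\<bar> \<Longrightarrow> 1 + p\<^sup>2 \<le> H x p - lam" using H_coercive[of lam] by blast
  define K where "K = \<bar>K0\<bar>"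
  have K: "1 + p\<^sup>2 \<le> H x p - lam" if "K \<le> \<bar>p\<bar>" for x p using K0 that by (simp add: K_def)
  have Kpos: "K \<ge> 0" by (simp add: K_def)
  have HK: "lam < H x K" for x
  proof -
    have "0 \<le> K\<^sup>2" by simp
    moreover have "1 + K\<^sup>2 \<le> H x K - lam" by (rule K) (use Kpos in simp)
    ultimately show ?thesis by linarith
  qed
  have Kmu: "1 + p\<^sup>2 \<le> H x p - mu" if "K \<le> \<bar>p\<bar>" for x p using K[OF that, of x] less by simp
  have vK: "\<bar>deriv v x\<bar> \<le> K" if "a x > 0" for x using sol_deriv_abs_le_coercive[OF v Kmu that] .
  define G where "G x p = (lam - H x (clamp_abs K p)) / a x" for x p
  have Gc: "continuous_on (S \<times> UNIV) (\<lambda>(x, p). G x p)" if "\<And>x. x \<in> S \<Longrightarrow> a x > 0" for S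
    unfolding G_def case_prod_unfold
    by (intro continuous_intros continuous_on_compose2[OF a_cont])
       (use that in \<open>force intro: continuous_intros\<close>)+
  \<comment> \<open>The shift 3 keeps \<open>\<delta> n\<close> at most a third of the length, so
    that \<open>c n \<le> d n\<close> from \<open>n = 0\<close> on.\<close>
  define \<delta> where "\<delta> n = (z2 - z1) / (real n + 3)" for n
  have del: "0 < \<delta> n" "\<delta> (Suc n) \<le> \<delta> n" "\<delta> n \<le> (z2 - z1) / 3" for n
    unfolding \<delta>_def by (use zz in simp, (rule divide_left_mono; use zz in simp)+)
  define c where "c n = z1 + \<delta> n" for n
  define d where "d n = z2 - \<delta> n" for n
  have cd: "z1 < c n" "c n \<le> d n" "d n < z2" for n using del(1,3)[of n] zz by (auto simp: c_def d_def field_simps)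
  have cdS: "c (Suc n) \<le> c n" "d n \<le> d (Suc n)" for n using del(2)[of n] by (auto simp: c_def d_def)
  have posn: "a x > 0" if "c n \<le> x" "x \<le> d n" for x n using pos[of x] cd[of n] that by simp
  have "\<exists>p. continuous_on {c n..d n} p \<and> p (c n) = K \<and>
      (\<forall>x. c n < x \<longrightarrow> x < d n \<longrightarrow> (p has_real_derivative G x (p x)) (at x))" for n
  proof -
    obtain M where M: "\<And>x p q. \<bar>p\<bar> \<le> K \<Longrightarrow> \<bar>q\<bar> \<le> K \<Longrightarrow> \<bar>H x p - H x q\<bar> \<le> M * \<bar>p - q\<bar>"
      using H_lip_p[of K] by blast
    have "\<exists>x0\<in>{c n..d n}. \<forall>x\<in>{c n..d n}. a x0 \<le> a x"
      by (rule continuous_attains_inf) (use cd continuous_on_subset[OF a_cont] in auto)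
    then obtain x0 where x0: "x0 \<in> {c n..d n}" "\<And>x. x \<in> {c n..d n} \<Longrightarrow> a x0 \<le> a x" by blast
    have a0: "a x0 > 0" using posn[of n x0] x0(1) by simp
    define L where "L = (\<bar>M\<bar> + 1) / a x0"
    have L: "L > 0" using a0 by (simp add: L_def)
    have lip: "\<bar>G x p - G x q\<bar> \<le> L * \<bar>p - q\<bar>" if x: "c n \<le> x" "x \<le> d n" for x p q
    proof -
      have ax: "a x0 \<le> a x" "a x > 0" using x0(2)[of x] posn[of n x] x by auto
      have "\<bar>G x p - G x q\<bar> = \<bar>H x (clamp_abs K q) - H x (clamp_abs K p)\<bar> / a x"
        using ax unfolding G_def by (simp add: diff_divide_distrib[symmetric])
      also have "\<dots> \<le> (\<bar>M\<bar> + 1) * \<bar>p - q\<bar> / a x"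
      proof (rule divide_right_mono)
        have "\<bar>H x (clamp_abs K q) - H x (clamp_abs K p)\<bar> \<le> M * \<bar>clamp_abs K q - clamp_abs K p\<bar>"
          by (intro M clamp_abs_bound Kpos)
        also have "\<dots> \<le> (\<bar>M\<bar> + 1) * \<bar>q - p\<bar>" by (intro mult_mono clamp_abs_lipschitz) auto
        finally show "\<bar>H x (clamp_abs K q) - H x (clamp_abs K p)\<bar> \<le> (\<bar>M\<bar> + 1) * \<bar>p - q\<bar>"
          by (simp add: abs_minus_commute)
      qed (use ax in simp)
      also have "\<dots> \<le> (\<bar>M\<bar> + 1) * \<bar>p - q\<bar> / a x0" using ax a0 by (intro divide_left_mono mult_pos_pos) auto
      finally show ?thesis by (simp add: L_def)
    qed
    have "continuous_on ({c n..d n} \<times> UNIV) (\<lambda>(x, p). G x p)" by (rule Gc) (use posn[of n] in auto)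
    from picard_lindelof_real[OF cd(2) L this lip, of K] show ?thesis by metis
  qed
  then obtain P where Pc: "\<And>n. continuous_on {c n..d n} (P n)" and P0: "\<And>n. P n (c n) = K"
    and Pd: "\<And>n x. c n < x \<Longrightarrow> x < d n \<Longrightarrow> (P n has_real_derivative G x (P n x)) (at x)"
    by metis
  have upper: "P n x \<le> K" if x: "c n \<le> x" "x \<le> d n" for n x
  proof (rule ode_compare[where c="c n" and d=x and lam=lam and K=K and f="P n" and g="\<lambda>_. K"])
    show "continuous_on {c n..x} (P n)" by (rule continuous_on_subset[OF Pc]) (use x in auto)
    fix y assume y: "c n < y" "y < x"
    show "\<exists>f'. (P n has_real_derivative f') (at y) \<and> f' \<le> (lam - H y (clamp_abs K (P n y))) / a y"
      using Pd[of n y] x y by (auto simp: G_def)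
    have "(lam - H y K) / a y \<le> 0" using HK[of y] posn[of n y] x y by (auto simp: divide_nonpos_pos)
    then show "\<exists>g'. ((\<lambda>_. K) has_real_derivative g') (at y) \<and> (lam - H y (clamp_abs K K)) / a y \<le> g'"
      using Kpos by (auto simp: clamp_abs_eq intro!: exI[of _ 0])
  qed (use x P0 Kpos posn[of n] in auto)
  have lower: "deriv v x \<le> P n x" if x: "c n \<le> x" "x \<le> d n" for n x
  proof (rule ode_compare[where c="c n" and d=x and lam=lam and K=K and f="deriv v" and g="P n"])
    show "continuous_on {c n..x} (P n)" by (rule continuous_on_subset[OF Pc]) (use x in auto)
    show "continuous_on {c n..x} (deriv v)" by (rule sol_deriv_continuous_on[OF v]) (use x posn[of n] in auto)
    fix y assume y: "c n < y" "y < x"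
    show "\<exists>g'. (P n has_real_derivative g') (at y) \<and> (lam - H y (clamp_abs K (P n y))) / a y \<le> g'"
      using Pd[of n y] x y by (auto simp: G_def)
    have ay: "a y > 0" using posn[of n y] x y by simp
    have "(mu - H y (deriv v y)) / a y \<le> (lam - H y (clamp_abs K (deriv v y))) / a y"
      using ay less clamp_abs_eq[OF vK[OF ay]] by (intro divide_right_mono) auto
    then show "\<exists>f'. (deriv v has_real_derivative f') (at y) \<and> f' \<le> (lam - H y (clamp_abs K (deriv v y))) / a y"
      using sol_C2_at(2)[OF v ay] by blast
  next
    show "deriv v (c n) \<le> P n (c n)" using vK[of "c n"] posn[of n "c n"] cd(2)[of n] P0 by auto
  qed (use x Kpos posn[of n] in auto)
  have decr: "P (Suc n) x \<le> P n x" if x: "c n \<le> x" "x \<le> d n" for n x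
  proof (rule ode_compare[where c="c n" and d=x and lam=lam and K=K and f="P (Suc n)" and g="P n"])
    show "continuous_on {c n..x} (P n)" by (rule continuous_on_subset[OF Pc]) (use x in auto)
    show "continuous_on {c n..x} (P (Suc n))" by (rule continuous_on_subset[OF Pc]) (use x cdS[of n] in auto)
    fix y assume y: "c n < y" "y < x"
    show "\<exists>g'. (P n has_real_derivative g') (at y) \<and> (lam - H y (clamp_abs K (P n y))) / a y \<le> g'"
      using Pd[of n y] x y by (auto simp: G_def)
    show "\<exists>f'. (P (Suc n) has_real_derivative f') (at y) \<and> f' \<le> (lam - H y (clamp_abs K (P (Suc n) y))) / a y"
      using Pd[of "Suc n" y] x y cdS[of n] by (auto simp: G_def)
  next
    show "P (Suc n) (c n) \<le> P n (c n)" using upper[of "Suc n" "c n"] P0 cdS[of n] cd(2)[of n] by simp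
  qed (use x Kpos posn[of n] in auto)
  have cmono: "c n \<le> c N" "d N \<le> d n" if "N \<le> n" for N n
    using lift_Suc_antimono_le[of c, OF cdS(1) that] lift_Suc_mono_le[of d, OF cdS(2) that] by auto
  have inside: "\<exists>N. c N < s \<and> t < d N" if "z1 < s" "t < z2" for s t
  proof -
    define e where "e = min (s - z1) (z2 - t)"
    have e: "e > 0" using that by (simp add: e_def)
    obtain N where "(z2 - z1) / e < real N" using reals_Archimedean2 by blast
    then have "z2 - z1 < real N * e" using e by (simp add: pos_divide_less_eq)
    also have "\<dots> \<le> (real N + 3) * e" using e by (intro mult_right_mono) auto
    finally have "\<delta> N < e" unfolding \<delta>_def by (simp add: pos_divide_less_eq mult.commute)
    then have "\<delta> N < min (s - z1) (z2 - t)" by (simp only: e_def)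
    then show ?thesis by (intro exI[of _ N]) (auto simp: c_def d_def)
  qed
  have "\<exists>l. (\<lambda>n. P n x) \<longlonglongrightarrow> l \<and> deriv v x \<le> l \<and> l \<le> K" if x: "z1 < x" "x < z2" for x
  proof -
    obtain N where N: "c N < x" "x < d N" using inside[of x x] x by blast
    have inN: "c n \<le> x" "x \<le> d n" if "N \<le> n" for n using cmono[OF that] N by auto
    have "decseq (\<lambda>n. P (n + N) x)" by (rule decseq_SucI) (use decr inN in auto)
    moreover have "\<forall>n. deriv v x \<le> P (n + N) x" using lower inN by auto
    ultimately obtain l where l: "(\<lambda>n. P (n + N) x) \<longlonglongrightarrow> l" "\<forall>n. l \<le> P (n + N) x"
      by (rule decseq_convergent)
    have "deriv v x \<le> l" by (rule LIMSEQ_le_const[OF l(1)]) (use lower inN in auto)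
    moreover have "l \<le> K" using l(2) upper[of N x] inN[of N] by (metis add_0 order_refl order_trans)
    ultimately show ?thesis using LIMSEQ_offset[OF l(1)] by blast
  qed
  then obtain p where plim: "\<And>x. z1 < x \<Longrightarrow> x < z2 \<Longrightarrow> (\<lambda>n. P n x) \<longlonglongrightarrow> p x"
    and plow: "\<And>x. z1 < x \<Longrightarrow> x < z2 \<Longrightarrow> deriv v x \<le> p x"
    and pup: "\<And>x. z1 < x \<Longrightarrow> x < z2 \<Longrightarrow> p x \<le> K" by metis
  have Gp: "continuous_on UNIV (G x)" if "a x > 0" for x
    unfolding G_def by (intro continuous_intros) (use that in auto)
  \<comment> \<open>The limit is known only pointwise, so the integral form of the equation is
    passed to the limit by dominated convergence. The truncation bounds \<open>G x\<close> uniformly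
    in \<open>p\<close>, which supplies the dominating constant and a Lipschitz bound for the
    limit.\<close>
  have integ: "\<exists>B. \<forall>s' t'. s \<le> s' \<longrightarrow> s' \<le> t' \<longrightarrow> t' \<le> t \<longrightarrow>
      ((\<lambda>x. G x (p x)) has_integral (p t' - p s')) {s'..t'} \<and> \<bar>p t' - p s'\<bar> \<le> B * (t' - s')"
    if st: "z1 < s" "t < z2" for s t
  proof -
    obtain N where N: "c N < s" "t < d N" using inside[OF st] by blast
    have "continuous_on ({s..t} \<times> UNIV) (\<lambda>(x, p). G x p)" by (rule Gc) (use pos st in auto)
    then have "continuous_on ({s..t} \<times> {-K..K}) (\<lambda>(x, p). G x p)" by (rule continuous_on_subset) auto
    then have "bounded ((\<lambda>(x, p). G x p) ` ({s..t} \<times> {-K..K}))"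
      by (intro compact_imp_bounded compact_continuous_image compact_Times) auto
    then obtain B where B0: "\<And>z. z \<in> {s..t} \<times> {-K..K} \<Longrightarrow> \<bar>case z of (x, p) \<Rightarrow> G x p\<bar> \<le> B"
      unfolding bounded_iff by (metis imageI real_norm_def)
    have B: "\<bar>G x q\<bar> \<le> \<bar>B\<bar>" if "x \<in> {s..t}" for x q
    proof -
      have "G x q = G x (clamp_abs K q)" by (simp add: G_def clamp_abs_eq clamp_abs_bound Kpos)
      moreover have "clamp_abs K q \<in> {-K..K}" using clamp_abs_bound[OF Kpos, of q] by auto
      then have "\<bar>G x (clamp_abs K q)\<bar> \<le> B" using B0[of "(x, clamp_abs K q)"] that by simp
      ultimately show ?thesis by simp
    qed
    show ?thesis
    proof (intro exI[of _ "\<bar>B\<bar>"] allI impI)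
      fix s' t' assume st': "s \<le> s'" "s' \<le> t'" "t' \<le> t"
      have I: "((\<lambda>x. G x (p x)) has_integral (p t' - p s')) {s'..t'}"
      proof (rule has_integral_dominated_convergence)
        fix n
        show "((\<lambda>x. G x (P (n + N) x)) has_integral (P (n + N) t' - P (n + N) s')) {s'..t'}"
        proof (rule fundamental_theorem_of_calculus[OF st'(2)])
          fix x assume x: "x \<in> {s'..t'}"
          have "(P (n + N) has_real_derivative G x (P (n + N) x)) (at x)"
            using Pd[of "n + N" x] cmono[of N "n + N"] N x st' by auto
          then show "(P (n + N) has_vector_derivative G x (P (n + N) x)) (at x within {s'..t'})"
            by (simp add: has_real_derivative_iff_has_vector_derivative has_vector_derivative_at_within)
        qed
        show "\<forall>x\<in>{s'..t'}. norm (G x (P (n + N) x)) \<le> \<bar>B\<bar>" using B st' by auto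
      next
        show "\<forall>x\<in>{s'..t'}. (\<lambda>n. G x (P (n + N) x)) \<longlonglongrightarrow> G x (p x)"
        proof
          fix x assume "x \<in> {s'..t'}"
          then have x: "z1 < x" "x < z2" using st st' by auto
          have "isCont (G x) (p x)" using Gp[OF pos[OF x]] by (simp add: continuous_on_eq_continuous_at)
          then show "(\<lambda>n. G x (P (n + N) x)) \<longlonglongrightarrow> G x (p x)"
            using LIMSEQ_ignore_initial_segment[OF plim[OF x], of N] by (rule isCont_tendsto_compose)
        qed
        show "(\<lambda>n. P (n + N) t' - P (n + N) s') \<longlonglongrightarrow> p t' - p s'"
          by (intro tendsto_diff LIMSEQ_ignore_initial_segment plim) (use st st' in auto)
      qed auto
      have "norm (p t' - p s') \<le> \<bar>B\<bar> * measure lborel {s'..t'}"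
        by (rule has_integral_bound_real[OF _ _ I, where S="{}"]) (use B st' in auto)
      then show "((\<lambda>x. G x (p x)) has_integral (p t' - p s')) {s'..t'} \<and> \<bar>p t' - p s'\<bar> \<le> \<bar>B\<bar> * (t' - s')"
        using I st' by simp
    qed
  qed
  show ?thesis
  proof (rule that[of p])
    show "deriv v x \<le> p x" if "z1 < x" "x < z2" for x using plow that .
    fix x assume x: "z1 < x" "x < z2"
    define s where "s = (z1 + x) / 2"
    define t where "t = (x + z2) / 2"
    have st: "z1 < s" "s < x" "x < t" "t < z2" using x by (auto simp: s_def t_def)
    obtain B where B: "\<And>s' t'. s \<le> s' \<Longrightarrow> s' \<le> t' \<Longrightarrow> t' \<le> t \<Longrightarrow> ((\<lambda>x. G x (p x)) has_integral (p t' - p s')) {s'..t'}"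
      "\<And>s' t'. s \<le> s' \<Longrightarrow> s' \<le> t' \<Longrightarrow> t' \<le> t \<Longrightarrow> \<bar>p t' - p s'\<bar> \<le> B * (t' - s')"
      using integ[OF st(1,4)] by blast
    \<comment> \<open>The Lipschitz bound makes the integrand continuous, so that the integral
      equation can be differentiated.\<close>
    have "\<bar>B\<bar>-lipschitz_on {s..t} p"
    proof (rule lipschitz_onI)
      fix y y' assume y: "y \<in> {s..t}" "y' \<in> {s..t}"
      have "\<bar>p y - p y'\<bar> \<le> B * \<bar>y - y'\<bar>"
        using B(2)[of y y'] B(2)[of y' y] y by (cases "y \<le> y'") (auto simp: abs_minus_commute)
      also have "\<dots> \<le> \<bar>B\<bar> * \<bar>y - y'\<bar>" by (intro mult_right_mono) auto
      finally show "dist (p y) (p y') \<le> \<bar>B\<bar> * dist y y'" by (simp add: dist_real_def)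
    qed simp
    then have pc: "continuous_on {s..t} p" by (rule lipschitz_on_continuous_on)
    have "continuous_on ({s..t} \<times> UNIV) (\<lambda>(x, p). G x p)" by (rule Gc) (use pos st in auto)
    then have Gpc: "continuous_on {s..t} (\<lambda>x. G x (p x))"
      using continuous_on_compose2[OF _ continuous_on_Pair[OF continuous_on_id pc], of "{s..t} \<times> UNIV" "\<lambda>(x, p). G x p"] by auto
    have "((\<lambda>y. p s + integral {s..y} (\<lambda>x. G x (p x))) has_real_derivative 0 + G x (p x)) (at x within {s..t})"
      by (intro DERIV_add integral_has_real_derivative Gpc) (use st in auto)
    then have "((\<lambda>y. p s + integral {s..y} (\<lambda>x. G x (p x))) has_real_derivative G x (p x)) (at x)"
      using st by (simp add: at_within_Icc_at)
    then have "(p has_real_derivative G x (p x)) (at x)"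
    proof (rule has_field_derivative_transform_within_open[where S="{s<..<t}"])
      show "p s + integral {s..y} (\<lambda>x. G x (p x)) = p y" if "y \<in> {s<..<t}" for y
        using integral_unique[OF B(1)[of s y]] that by simp
    qed (use st in auto)
    \<comment> \<open>The limit lies between \<open>deriv v\<close> and \<open>K\<close>, both
      within \<open>[- K, K]\<close>, so the truncation is inactive.\<close>
    moreover have "\<bar>p x\<bar> \<le> K" using plow[OF x] pup[OF x] vK[OF pos[OF x]] by auto
    ultimately show "(p has_real_derivative (lam - H x (p x)) / a x) (at x)"
      by (simp add: G_def clamp_abs_eq)
  qed
qed

end

lemma antiderivative_UNIV:
  fixes q :: "real \<Rightarrow> real"
  assumes q: "continuous_on UNIV q"
  obtains u where "u 0 = 0" "\<And>x. (u has_real_derivative q x) (at x)"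
proof -
  \<comment> \<open>The lower limit lies below both 0 and \<open>x\<close>, so both integrals run
    over ordinary intervals; any lower common limit gives the same difference.\<close>
  define u where "u x = integral {- (\<bar>x\<bar> + 1)..x} q - integral {- (\<bar>x\<bar> + 1)..0} q" for x
  have qi: "q integrable_on {s..t}" for s t
    by (rule integrable_continuous_real, rule continuous_on_subset[OF q]) simp
  have ueq: "u x = integral {- N..x} q - integral {- N..0} q" if N: "\<bar>x\<bar> + 1 \<le> N" for x N
  proof -
    let ?M = "\<bar>x\<bar> + 1"
    have "integral {- N..- ?M} q + integral {- ?M..x} q = integral {- N..x} q"
      by (rule Henstock_Kurzweil_Integration.integral_combine) (use N qi in auto)
    moreover have "integral {- N..- ?M} q + integral {- ?M..0} q = integral {- N..0} q"
      by (rule Henstock_Kurzweil_Integration.integral_combine) (use N qi in auto)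
    ultimately show ?thesis by (simp add: u_def)
  qed
  have "(u has_real_derivative q x) (at x)" for x
  proof -
    define N where "N = \<bar>x\<bar> + 2"
    have "((\<lambda>y. integral {- N..y} q - integral {- N..0} q) has_real_derivative q x - 0) (at x within {- N..N})"
      by (intro DERIV_diff integral_has_real_derivative continuous_on_subset[OF q] DERIV_const)
         (auto simp: N_def)
    moreover have "at x within {- N..N} = at x" by (rule at_within_Icc_at) (auto simp: N_def)
    ultimately have "((\<lambda>y. integral {- N..y} q - integral {- N..0} q) has_real_derivative q x) (at x)" by simp
    then show ?thesis
    proof (rule has_field_derivative_transform_within_open[where S="ball x 1"])
      show "integral {- N..y} q - integral {- N..0} q = u y" if "y \<in> ball x 1" for y
        using ueq[of y N] that by (auto simp: N_def dist_real_def)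
    qed auto
  qed
  moreover have "u 0 = 0" by (simp add: u_def)
  ultimately show ?thesis using that by blast
qed

section \<open>Gluing the components and constructing the upper solution\<close>

context degenerate_hj
begin

lemma right_zero:
  assumes "a x > 0"
  obtains z where "x < z" "a z = 0" "\<And>y. x \<le> y \<Longrightarrow> y < z \<Longrightarrow> a y > 0"
proof -
  obtain z where z: "z < - x" "a (- z) = 0" "\<And>y. z < y \<Longrightarrow> y \<le> - x \<Longrightarrow> a (- y) > 0"
    by (rule degenerate_hj.left_zero[OF reflect, of "- x"]) (use assms in auto)
  show ?thesis
  proof (rule that[of "- z"])
    show "a y > 0" if "x \<le> y" "y < - z" for y using z(3)[of "- y"] that by simp
  qed (use z in auto)
qed

text \<open>The pieces on different components are chosen independently, so continuity at a zero
  \<open>x0\<close> is the point: it must hold uniformly over the possibly infinitely many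
  components near \<open>x0\<close> and over the zeros between them. The bound by
  \<open>deriv v\<close> gives the glued function the lower bound \<open>m\<close> that starts the
  barrier argument for \<open>p_plus\<close>.\<close>

lemma exists_profile:
  assumes v: "visc_sol a H mu v" and less: "mu < lam"
  obtains q where "profile lam q"
proof -
  have lv: "\<exists>p. H x p \<le> mu" if "a x = 0" for x using level_nonempty[OF v that] .
  have ne: "\<exists>p. H x p \<le> lam" if "a x = 0" for x using lv[OF that] less by (meson less_imp_le order_trans)
  define comp where "comp z1 z2 \<longleftrightarrow> z1 < z2 \<and> (\<forall>x. z1 < x \<longrightarrow> x < z2 \<longrightarrow> a x > 0)" for z1 z2
  have "\<exists>p. comp z1 z2 \<longrightarrow> (\<forall>x. z1 < x \<longrightarrow> x < z2 \<longrightarrow> deriv v x \<le> p x \<and>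
      (p has_real_derivative (lam - H x (p x)) / a x) (at x))" for z1 z2
  proof (cases "comp z1 z2")
    case True
    then show ?thesis using component_solution[OF v less, of z1 z2] unfolding comp_def by metis
  qed blast
  then obtain f where f: "\<And>z1 z2 x. comp z1 z2 \<Longrightarrow> z1 < x \<Longrightarrow> x < z2 \<Longrightarrow> deriv v x \<le> f z1 z2 x \<and>
      (f z1 z2 has_real_derivative (lam - H x (f z1 z2 x)) / a x) (at x)" by metis
  have "\<exists>l r. a x > 0 \<longrightarrow> l < x \<and> x < r \<and> a l = 0 \<and> a r = 0 \<and> comp l r" for x
  proof (cases "a x > 0")
    case True
    obtain l where l: "l < x" "a l = 0" "\<And>y. l < y \<Longrightarrow> y \<le> x \<Longrightarrow> a y > 0" using left_zero[OF True] by metis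
    obtain r where r: "x < r" "a r = 0" "\<And>y. x \<le> y \<Longrightarrow> y < r \<Longrightarrow> a y > 0" using right_zero[OF True] by metis
    have "comp l r" unfolding comp_def using l r by (meson le_cases less_trans)
    then show ?thesis using l r by blast
  qed blast
  then obtain l r where lr: "\<And>x. a x > 0 \<Longrightarrow> l x < x \<and> x < r x \<and> a (l x) = 0 \<and> a (r x) = 0 \<and> comp (l x) (r x)"
    by metis
  \<comment> \<open>Two components sharing a point coincide, since no zero lies inside either; so
    the chosen endpoints \<open>l\<close> and \<open>r\<close> are constant along a
    component.\<close>
  have comp_unique: "z = z' \<and> w = w'"
    if "comp z w" "comp z' w'" "a z = 0" "a w = 0" "a z' = 0" "a w' = 0" "z < y" "y < w" "z' < y" "y < w'" for z w z' w' y
    using that unfolding comp_def by (metis less_irrefl less_trans linorder_neqE_linordered_idom)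
  define q where "q x = (if a x = 0 then p_plus H lam x else f (l x) (r x) x)" for x
  have qA: "deriv v x \<le> q x" "(q has_real_derivative (lam - H x (q x)) / a x) (at x)" if ax: "a x > 0" for x
  proof -
    note L = lr[OF ax]
    have eq: "q y = f (l x) (r x) y" if y: "l x < y" "y < r x" for y
    proof -
      have ay: "a y > 0" using L y by (simp add: comp_def)
      have "l y = l x \<and> r y = r x" by (rule comp_unique[of _ _ _ _ y]) (use L lr[OF ay] y in auto)
      then show ?thesis using ay by (simp add: q_def)
    qed
    have F: "deriv v x \<le> f (l x) (r x) x"
      "(f (l x) (r x) has_real_derivative (lam - H x (f (l x) (r x) x)) / a x) (at x)" using f L by auto
    show "deriv v x \<le> q x" using F eq L by simp
    have "(f (l x) (r x) has_real_derivative (lam - H x (q x)) / a x) (at x)" using F eq[of x] L by simp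
    then show "(q has_real_derivative (lam - H x (q x)) / a x) (at x)"
      by (rule has_field_derivative_transform_within_open[where S="{l x<..<r x}"]) (use L eq in auto)
  qed
  have "isCont q x0" for x0
  proof (cases "a x0 = 0")
    case False
    then show ?thesis using qA(2)[of x0] a_nonneg[of x0] DERIV_isCont by force
  next
    case z: True
    let ?P = "p_plus H lam x0"
    note P = p_plus_props[OF ne[OF z]]
    have "\<exists>d>0. \<forall>x. \<bar>x - x0\<bar> < d \<longrightarrow> \<bar>q x - ?P\<bar> \<le> e" if e: "e > 0" for e
    proof -
      obtain c1 d1 where u1: "c1 > 0" "d1 > 0"
        "\<And>x p. \<bar>x - x0\<bar> < d1 \<Longrightarrow> ?P + e \<le> p \<Longrightarrow> c1 * (1 + p\<^sup>2) \<le> H x p - lam"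
        by (rule H_rate_above[of "?P + e" lam x0]) (use P(2) e in auto)
      obtain m d0 where m: "H x0 m < lam" "d0 > 0"
        "\<And>x y. x0 - d0 < x \<Longrightarrow> x \<le> y \<Longrightarrow> y < x0 + d0 \<Longrightarrow> m * (y - x) \<le> v y - v x"
        using sol_slope_ge_sublevel[OF v less z] by metis
      have mP: "m < ?P"
      proof (rule ccontr)
        assume "\<not> m < ?P"
        then have "m = ?P" using P(3)[of m] m(1) by simp
        then show False using P(1) m(1) by simp
      qed
      \<comment> \<open>The maximum with \<open>m\<close> keeps \<open>[m, T]\<close> nonempty while
        \<open>T\<close> stays below \<open>p_plus\<close>, so \<open>H < lam\<close> on it at
        \<open>x0\<close>.\<close>
      define T where "T = max m (?P - e)"
      have T: "m \<le> T" "?P - e \<le> T" "T < ?P" using mP e by (auto simp: T_def)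
      obtain c2 d2 where u2: "c2 > 0" "d2 > 0"
        "\<And>x p. \<bar>x - x0\<bar> < d2 \<Longrightarrow> m \<le> p \<Longrightarrow> p \<le> T \<Longrightarrow> c2 * (1 + p\<^sup>2) \<le> lam - H x p"
        by (rule middle_rate[of m T x0 lam]) (use H_less_below_p_plus[OF m(1)] T in auto)
      have cpos: "c * (1 + p\<^sup>2) > 0" if "c > 0" for c p :: real using that by (simp add: add_pos_nonneg)
      have qm: "m \<le> q x" if "\<bar>x - x0\<bar> < d0" "a x > 0" for x
      proof -
        have "m \<le> deriv v x"
          by (rule deriv_ge_of_slopes[OF m(3) _ _ sol_C2_at(1)[OF v that(2)]]) (use that in auto)
        then show ?thesis using qA(1)[OF that(2)] by simp
      qed
      obtain d3 where d3: "d3 > 0" "\<And>x. \<bar>x - x0\<bar> < d3 \<Longrightarrow> a x > 0 \<Longrightarrow> q x \<le> ?P + e"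
      proof (rule barrier_near_zero[OF z u1(2,1), where q=q and q'="\<lambda>x. (lam - H x (q x)) / a x" and T="?P + e"])
        fix x assume x: "\<bar>x - x0\<bar> < d1" "a x > 0"
        show "(q has_real_derivative (lam - H x (q x)) / a x) (at x)" using qA(2)[OF x(2)] .
        show "a x * ((lam - H x (q x)) / a x) \<le> - c1 * (1 + (q x)\<^sup>2)" if "?P + e \<le> q x"
          using u1(3)[OF x(1) that] x by simp
      qed blast
      have d02: "min d0 d2 > 0" using m(2) u2(2) by simp
      obtain d4 where d4: "d4 > 0" "\<And>x. \<bar>x - x0\<bar> < d4 \<Longrightarrow> a x > 0 \<Longrightarrow> - q x \<le> - T"
      proof (rule barrier_near_zero[OF z d02 u2(1), where q="\<lambda>x. - q x"
            and q'="\<lambda>x. - ((lam - H x (q x)) / a x)" and T="- T"])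
        fix x assume x: "\<bar>x - x0\<bar> < min d0 d2" "a x > 0"
        show "((\<lambda>x. - q x) has_real_derivative - ((lam - H x (q x)) / a x)) (at x)"
          by (rule DERIV_minus[OF qA(2)[OF x(2)]])
        show "a x * - ((lam - H x (q x)) / a x) \<le> - c2 * (1 + (- q x)\<^sup>2)" if "- T \<le> - q x"
          using u2(3)[of x "q x"] qm[of x] x that by simp
      qed blast
      define d where "d = min (min d1 d2) (min d3 d4)"
      have "\<bar>q x - ?P\<bar> \<le> e" if x: "\<bar>x - x0\<bar> < d" for x
      proof (cases "a x = 0")
        case True
        note Px = p_plus_props[OF ne[OF True]]
        \<comment> \<open>At another zero near \<open>x0\<close> there is no slope equation to use;
          the same rate estimates locate the upper endpoint there, as \<open>H x\<close> exceeds
          \<open>lam\<close> from \<open>?P + e\<close> on and is below \<open>lam\<close> at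
          \<open>T\<close>.\<close>
        have "q x < ?P + e"
        proof (rule ccontr)
          assume "\<not> q x < ?P + e"
          then have "c1 * (1 + (q x)\<^sup>2) \<le> H x (q x) - lam" using u1(3)[of x "q x"] x by (simp add: d_def)
          moreover have "H x (q x) = lam" using Px(1) True by (simp add: q_def)
          ultimately show False using cpos[OF u1(1), of "q x"] by simp
        qed
        moreover have "T \<le> q x"
        proof -
          have "c2 * (1 + T\<^sup>2) \<le> lam - H x T" using u2(3)[of x T] x T by (simp add: d_def)
          then have "H x T \<le> lam" using cpos[OF u2(1), of T] by simp
          then show ?thesis using Px(3) True by (simp add: q_def)
        qed
        ultimately show ?thesis using T(2) by linarith
      next
        case False
        then have "a x > 0" using a_nonneg[of x] by simp
        then have "q x \<le> ?P + e" "T \<le> q x" using d3(2)[of x] d4(2)[of x] x by (auto simp: d_def)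
        then show ?thesis using T(2) by linarith
      qed
      moreover have "d > 0" using u1 u2 d3 d4 by (simp add: d_def)
      ultimately show ?thesis by blast
    qed
    note close = this
    show ?thesis unfolding continuous_at_eps_delta
    proof (intro allI impI)
      fix e :: real assume "e > 0"
      then obtain d where "d > 0" "\<And>x. \<bar>x - x0\<bar> < d \<Longrightarrow> \<bar>q x - ?P\<bar> \<le> e / 2"
        using close[of "e / 2"] by auto
      then show "\<exists>d>0. \<forall>x'. dist x' x0 < d \<longrightarrow> dist (q x') (q x0) < e"
        using \<open>e > 0\<close> z by (intro exI[of _ d]) (force simp: dist_real_def q_def[of x0])
    qed
  qed
  then have "continuous_on UNIV q" by (simp add: continuous_on_eq_continuous_at)
  then have "profile lam q" unfolding profile_def using qA(2) by (auto simp: q_def)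
  then show ?thesis using that by blast
qed

text \<open>Near the left zero the two upper endpoints leave room for a level \<open>T\<close>
  separating \<open>deriv v\<close> from \<open>q\<close>; comparison carries the weak inequality to
  \<open>x\<close>. Equality at \<open>x\<close> would give \<open>q - deriv v\<close> the
  derivative \<open>(lam - mu) / a x > 0\<close>, hence negative values just before
  \<open>x\<close>.\<close>

lemma profile_above_sol:
  assumes v: "visc_sol a H mu v" and less: "mu < lam" and q: "profile lam q" and ax: "a x > 0"
  shows "deriv v x < q x"
proof -
  obtain z where z: "z < x" "a z = 0" "\<And>y. z < y \<Longrightarrow> y \<le> x \<Longrightarrow> a y > 0" using left_zero[OF ax] by metis
  have qd: "(q has_real_derivative (lam - H y (q y)) / a y) (at y)" if "a y > 0" for y
    using q that by (simp add: profile_def)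
  note ne = level_nonempty[OF v z(2)]
  note P = p_plus_props[OF ne]
  let ?P = "p_plus H mu z" let ?R = "p_plus H lam z"
  have PR: "?P < ?R" by (rule p_plus_strict_mono[OF ne less])
  define T where "T = (?P + ?R) / 2"
  have T: "?P < T" "T < ?R" using PR by (auto simp: T_def)
  obtain d where d: "d > 0" "\<And>s t. z - d < s \<Longrightarrow> s \<le> t \<Longrightarrow> t < z + d \<Longrightarrow> v t - v s \<le> T * (t - s)"
    by (rule sol_slope_le_near_zero[OF v z(2), of T]) (use P(2) T in auto)
  have "isCont q z" using q by (simp add: profile_def continuous_on_eq_continuous_at)
  moreover have "q z = ?R" using q z by (simp add: profile_def)
  ultimately have "(q \<longlongrightarrow> ?R) (at_right z)" by (simp add: isCont_def filterlim_at_split)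
  then have "\<forall>\<^sub>F t in at_right z. T < q t" by (rule order_tendstoD) (rule T(2))
  then obtain b where b: "b > z" "\<And>t. z < t \<Longrightarrow> t < b \<Longrightarrow> T < q t"
    unfolding eventually_at_right_field by blast
  define t where "t = (z + min x (min b (z + d))) / 2"
  have t: "z < t" "t < x" "t < b" "t < z + d" using z(1) b(1) d(1) by (auto simp: t_def min_def)
  have "deriv v t \<le> T"
    by (rule deriv_le_of_slopes[where al="z - d" and be="z + d", OF d(2) _ _ sol_C2_at(1)[OF v z(3)]])
       (use t d(1) in auto)
  then have init: "deriv v t \<le> q t" using b(2)[of t] t by simp
  have cmp: "deriv v y \<le> q y" if y: "t \<le> y" "y \<le> x" for y
    by (rule ode_compare_unclamped[where c=t and mu=mu and lam=lam])
       (use y t z init less in \<open>auto intro!: qd sol_C2_at(2)[OF v]\<close>)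
  show ?thesis
  proof (rule ccontr)
    assume "\<not> ?thesis"
    then have eq: "q x = deriv v x" using cmp[of x] t by simp
    have "((\<lambda>x. q x - deriv v x) has_real_derivative (lam - H x (q x)) / a x - (mu - H x (deriv v x)) / a x) (at x)"
      by (intro DERIV_diff qd sol_C2_at(2)[OF v] ax)
    then have "((\<lambda>x. q x - deriv v x) has_real_derivative (lam - mu) / a x) (at x)"
      using eq by (simp add: diff_divide_distrib)
    moreover have "(lam - mu) / a x > 0" using less ax by simp
    ultimately obtain e where e: "e > 0" "\<And>h. 0 < h \<Longrightarrow> h < e \<Longrightarrow> q (x - h) - deriv v (x - h) < q x - deriv v x"
      using DERIV_pos_inc_left by blast
    define h where "h = min (e / 2) (x - t)"
    have "0 < h" "h < e" "t \<le> x - h" using e t by (auto simp: h_def)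
    then show False using e(2)[of h] cmp[of "x - h"] eq by simp
  qed
qed

lemma sol_above_is_profile:
  assumes w: "visc_sol a H lam w" and v: "visc_sol a H mu v" and less: "mu < lam"
    and mono: "\<And>x y. x \<le> y \<Longrightarrow> v y - v x \<le> w y - w x"
  shows "\<And>x. (w has_real_derivative deriv w x) (at x)" and "profile lam (deriv w)"
proof -
  have tend: "slopes_tend_to w x (p_plus H lam x)" if "a x = 0" for x
    by (rule sol_above_slopes_tend_to_p_plus[OF w v less mono that])
  have z: "(w has_real_derivative p_plus H lam x) (at x)" if "a x = 0" for x
    by (rule slopes_tend_to_imp_deriv[OF tend[OF that]])
  then have dz: "deriv w x = p_plus H lam x" if "a x = 0" for x using that by (simp add: DERIV_imp_deriv)
  show dw: "(w has_real_derivative deriv w x) (at x)" for x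
    using z[of x] dz[of x] sol_C2_at(1)[OF w, of x] a_nonneg[of x] by (cases "a x = 0") auto
  have "isCont (deriv w) x0" for x0
  proof (cases "a x0 = 0")
    case False
    then show ?thesis using sol_C2_at(2)[OF w, of x0] a_nonneg[of x0] DERIV_isCont by force
  next
    case True
    show ?thesis unfolding continuous_at_eps_delta
    proof (intro allI impI)
      fix e :: real assume e: "e > 0"
      then have "e / 2 > 0" by simp
      from slopes_tend_to_imp_deriv_near[OF tend[OF True] this]
      obtain d where "d > 0" "\<And>x. \<bar>x - x0\<bar> < d \<Longrightarrow> \<bar>deriv w x - p_plus H lam x0\<bar> \<le> e / 2" using dw by metis
      then show "\<exists>d>0. \<forall>x'. dist x' x0 < d \<longrightarrow> dist (deriv w x') (deriv w x0) < e"
        using e dz[OF True] by (intro exI[of _ d]) (force simp: dist_real_def)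
    qed
  qed
  then have "continuous_on UNIV (deriv w)" by (simp add: continuous_on_eq_continuous_at)
  then show "profile lam (deriv w)" unfolding profile_def using dz sol_C2_at(2)[OF w] by blast
qed

text \<open>The solution \<open>v\<close> serves to construct \<open>u\<close>; the equivalence is
  then stated for every \<open>v0\<close> at the same level. It thereby carries existence,
  uniqueness and independence of the choice at once.\<close>

lemma unique_upper_solution:
  assumes v: "visc_sol a H mu v" and less: "mu < lam"
  obtains u where
    "\<And>v0 w. visc_sol a H mu v0 \<Longrightarrow>
      (visc_sol a H lam w \<and>
       (AE x in lborel. w differentiable (at x) \<and> v0 differentiable (at x) \<and> deriv w x > deriv v0 x) \<and>
       w 0 = 0) \<longleftrightarrow> w = u"
    "u C1_differentiable_on UNIV" "C2_on {x. a x > 0} u"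
    "\<And>x. a x = 0 \<Longrightarrow> deriv u x = p_plus H lam x"
    "\<And>x. a x * deriv (deriv u) x + H x (deriv u x) = lam"
proof -
  obtain q where q: "profile lam q" using exists_profile[OF v less] by blast
  have qc: "continuous_on S q" for S using q by (auto simp: profile_def intro: continuous_on_subset)
  have qz: "q x = p_plus H lam x" if "a x = 0" for x using q that by (simp add: profile_def)
  have qd: "(q has_real_derivative (lam - H x (q x)) / a x) (at x)" if "a x > 0" for x
    using q that by (simp add: profile_def)
  have lv: "\<exists>p. H x p \<le> mu" if "a x = 0" for x using level_nonempty[OF v that] .
  have ne: "\<exists>p. H x p \<le> lam" if "a x = 0" for x using lv[OF that] less by (meson less_imp_le order_trans)
  have ne': "\<exists>p. H x p < lam" if "a x = 0" for x using lv[OF that] less by (meson le_less_trans)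
  have Hq: "H x (q x) = lam" if "a x = 0" for x using p_plus_props(1)[OF ne[OF that]] qz[OF that] by simp
  obtain u where u0: "u 0 = 0" and ud: "\<And>x. (u has_real_derivative q x) (at x)"
    using antiderivative_UNIV[OF qc] by blast
  have du: "deriv u = q" using ud by (auto intro: DERIV_imp_deriv)
  have us: "visc_sol a H lam u" by (rule classical_imp_sol[OF ud qd Hq])
  show ?thesis
  proof (rule that[of u])
    fix v0 w assume v0: "visc_sol a H mu v0"
    show "(visc_sol a H lam w \<and>
       (AE x in lborel. w differentiable (at x) \<and> v0 differentiable (at x) \<and> deriv w x > deriv v0 x) \<and>
       w 0 = 0) \<longleftrightarrow> w = u"
    proof (intro iffI conjI)
      assume A: "visc_sol a H lam w \<and>
       (AE x in lborel. w differentiable (at x) \<and> v0 differentiable (at x) \<and> deriv w x > deriv v0 x) \<and>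
       w 0 = 0"
      have w: "visc_sol a H lam w" using A by simp
      have mono: "v0 y - v0 x \<le> w y - w x" if "x \<le> y" for x y
        using sol_diff_mono[OF w v0 _ that] A by blast
      note W = sol_above_is_profile[OF w v0 less mono]
      have eq: "deriv w x = q x" for x
        using profile_le[OF W(2) q ne', of x] profile_le[OF q W(2) ne', of x] by simp
      have "((\<lambda>x. w x - u x) has_real_derivative 0) (at x)" for x
        using DERIV_diff[OF W(1)[of x] ud[of x]] eq by simp
      then have "w x - u x = w 0 - u 0" for x using DERIV_isconst_all by blast
      then show "w = u" using A u0 by auto
    next
      assume wu: "w = u"
      show "visc_sol a H lam w" "w 0 = 0" using us u0 wu by auto
      let ?N = "{x. \<not> v0 differentiable (at x)}"
      have "?N \<in> null_sets lborel"
        by (rule countable_imp_null_set_lborel[OF countable_sol_not_differentiable[OF v0]])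
      moreover have "w differentiable (at x) \<and> v0 differentiable (at x) \<and> deriv w x > deriv v0 x"
        if dv: "v0 differentiable (at x)" for x
      proof -
        have "w differentiable (at x)" using ud wu by (auto simp: real_differentiable_def)
        moreover have "deriv v0 x < q x"
        proof (cases "a x = 0")
          case True
          have "deriv v0 x \<le> p_plus H mu x"
            by (rule sol_deriv_le_p_plus[OF v0 True]) (use dv in \<open>simp add: DERIV_deriv_iff_real_differentiable\<close>)
          also have "\<dots> < p_plus H lam x" by (rule p_plus_strict_mono[OF lv[OF True] less])
          finally show ?thesis using qz[OF True] by simp
        next
          case False
          then show ?thesis using profile_above_sol[OF v0 less q] a_nonneg[of x] by simp
        qed
        ultimately show ?thesis using dv du wu by simp
      qed
      then have "{x \<in> space lborel. \<not> (w differentiable (at x) \<and> v0 differentiable (at x) \<and>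
          deriv w x > deriv v0 x)} \<subseteq> ?N" by blast
      ultimately show "AE x in lborel. w differentiable (at x) \<and> v0 differentiable (at x) \<and>
          deriv w x > deriv v0 x" by (rule AE_I')
    qed
  next
    show "u C1_differentiable_on UNIV"
      unfolding C1_differentiable_on_def
      using ud qc by (auto simp: has_real_derivative_iff_has_vector_derivative)
    show "C2_on {x. a x > 0} u"
      unfolding C2_on_def
    proof (intro exI conjI ballI)
      show "(u has_real_derivative q x) (at x)" for x by (rule ud)
      show "(q has_real_derivative (lam - H x (q x)) / a x) (at x)" if "x \<in> {x. a x > 0}" for x
        using qd that by simp
      show "continuous_on {x. a x > 0} (\<lambda>x. (lam - H x (q x)) / a x)"
        by (intro continuous_intros qc continuous_on_subset[OF a_cont]) auto
    qed
    show "deriv u x = p_plus H lam x" if "a x = 0" for x using qz[OF that] du by simp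
    show "a x * deriv (deriv u) x + H x (deriv u x) = lam" for x
    proof (cases "a x = 0")
      case True then show ?thesis using Hq du by simp
    next
      case False
      then have "a x > 0" using a_nonneg[of x] by simp
      then have "deriv (deriv u) x = (lam - H x (q x)) / a x" using qd du by (simp add: DERIV_imp_deriv)
      then show ?thesis using False du by simp
    qed
  qed
qed

end

section \<open>Reflection and the main theorem\<close>

lemma DERIV_reflect:
  fixes f :: "real \<Rightarrow> real"
  assumes "(f has_real_derivative D) (at (- x))"
  shows "((\<lambda>x. f (- x)) has_real_derivative - D) (at x)"
  using assms DERIV_mirror[of f D x] by simp

lemma differentiable_reflect:
  fixes f :: "real \<Rightarrow> real"
  assumes "f differentiable (at (- x))"
  shows "(\<lambda>x. f (- x)) differentiable (at x)" "deriv (\<lambda>x. f (- x)) x = - deriv f (- x)"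
proof -
  have "(f has_real_derivative deriv f (- x)) (at (- x))"
    using assms by (simp add: DERIV_deriv_iff_real_differentiable)
  from DERIV_reflect[OF this]
  show "(\<lambda>x. f (- x)) differentiable (at x)" "deriv (\<lambda>x. f (- x)) x = - deriv f (- x)"
    by (auto simp: real_differentiable_def intro: DERIV_imp_deriv)
qed

lemma AE_deriv_less_reflect:
  fixes w v :: "real \<Rightarrow> real"
  assumes "AE x in lborel. w differentiable (at x) \<and> v differentiable (at x) \<and> deriv w x < deriv v x"
  shows "AE x in lborel. (\<lambda>t. v (- t)) differentiable (at x) \<and> (\<lambda>t. w (- t)) differentiable (at x) \<and>
      deriv (\<lambda>t. v (- t)) x < deriv (\<lambda>t. w (- t)) x"
proof -
  have "AE x in distr lborel borel uminus. w differentiable (at x) \<and> v differentiable (at x) \<and> deriv w x < deriv v x"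
    using assms by (simp only: lborel_distr_uminus)
  from AE_distrD[OF _ this]
  have "AE x in lborel. w differentiable (at (- x)) \<and> v differentiable (at (- x)) \<and> deriv w (- x) < deriv v (- x)"
    by simp
  then show ?thesis by eventually_elim (simp add: differentiable_reflect)
qed

lemma AE_deriv_less_reflect_iff:
  fixes w v :: "real \<Rightarrow> real"
  shows "(AE x in lborel. (\<lambda>t. w (- t)) differentiable (at x) \<and> (\<lambda>t. v (- t)) differentiable (at x) \<and>
      deriv (\<lambda>t. v (- t)) x < deriv (\<lambda>t. w (- t)) x) \<longleftrightarrow>
    (AE x in lborel. w differentiable (at x) \<and> v differentiable (at x) \<and> deriv w x < deriv v x)"
    (is "?L \<longleftrightarrow> ?R")
proof
  assume ?L
  then have "AE x in lborel. (\<lambda>t. v (- t)) differentiable (at x) \<and> (\<lambda>t. w (- t)) differentiable (at x) \<and>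
      deriv (\<lambda>t. v (- t)) x < deriv (\<lambda>t. w (- t)) x"
    by (rule eventually_mono) simp
  from AE_deriv_less_reflect[OF this] show ?R by simp
next
  assume ?R
  from AE_deriv_less_reflect[OF this] show ?L by (rule eventually_mono) simp
qed

context degenerate_hj
begin

lemma sol_reflect_iff:
  "visc_sol (\<lambda>x. a (- x)) (\<lambda>x p. H (- x) (- p)) lam (\<lambda>x. u (- x)) \<longleftrightarrow> visc_sol a H lam u"
  using sol_reflect degenerate_hj.sol_reflect[OF reflect, of lam "\<lambda>x. u (- x)"] by auto

lemma unique_lower_solution:
  assumes v: "visc_sol a H mu v" and less: "mu < lam"
  obtains u where
    "\<And>v0 w. visc_sol a H mu v0 \<Longrightarrow>
      (visc_sol a H lam w \<and>
       (AE x in lborel. w differentiable (at x) \<and> v0 differentiable (at x) \<and> deriv w x < deriv v0 x) \<and>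
       w 0 = 0) \<longleftrightarrow> w = u"
    "u C1_differentiable_on UNIV" "C2_on {x. a x > 0} u"
    "\<And>x. a x = 0 \<Longrightarrow> deriv u x = p_minus H lam x"
    "\<And>x. a x * deriv (deriv u) x + H x (deriv u x) = lam"
proof -
  let ?a = "\<lambda>x. a (- x)" and ?H = "\<lambda>x p. H (- x) (- p)"
  obtain r where r:
    "\<And>v0 w. visc_sol ?a ?H mu v0 \<Longrightarrow>
      (visc_sol ?a ?H lam w \<and>
       (AE x in lborel. w differentiable (at x) \<and> v0 differentiable (at x) \<and> deriv w x > deriv v0 x) \<and>
       w 0 = 0) \<longleftrightarrow> w = r"
    and rC1: "r C1_differentiable_on UNIV" and rz: "\<And>x. ?a x = 0 \<Longrightarrow> deriv r x = p_plus ?H lam x"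
    by (rule degenerate_hj.unique_upper_solution[OF reflect sol_reflect[OF v] less]) blast
  define u where "u x = r (- x)" for x
  obtain D where D: "\<And>x. (r has_real_derivative D x) (at x)" "continuous_on UNIV D"
    using rC1 unfolding C1_differentiable_on_def
    by (auto simp: has_real_derivative_iff_has_vector_derivative)
  have ud: "(u has_real_derivative - D (- x)) (at x)" for x
    unfolding u_def using DERIV_reflect[OF D(1)] .
  have du: "deriv u x = - deriv r (- x)" for x
    using DERIV_imp_deriv[OF ud] DERIV_imp_deriv[OF D(1)] by simp
  have char: "(visc_sol a H lam w \<and>
       (AE x in lborel. w differentiable (at x) \<and> v0 differentiable (at x) \<and> deriv w x < deriv v0 x) \<and>
       w 0 = 0) \<longleftrightarrow> w = u" (is "?L \<longleftrightarrow> _") if v0: "visc_sol a H mu v0" for v0 w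
  proof -
    \<comment> \<open>Reflection sends lower solutions of the original problem to upper solutions of
      the reflected one and preserves the normalisation at 0.\<close>
    have "?L \<longleftrightarrow> visc_sol ?a ?H lam (\<lambda>x. w (- x)) \<and>
       (AE x in lborel. (\<lambda>x. w (- x)) differentiable (at x) \<and> (\<lambda>x. v0 (- x)) differentiable (at x) \<and>
         deriv (\<lambda>x. w (- x)) x > deriv (\<lambda>x. v0 (- x)) x) \<and> w (- 0) = 0"
      unfolding sol_reflect_iff AE_deriv_less_reflect_iff by simp
    also have "\<dots> \<longleftrightarrow> (\<lambda>x. w (- x)) = r" by (rule r) (use v0 sol_reflect_iff in blast)
    also have "\<dots> \<longleftrightarrow> w = u" unfolding u_def fun_eq_iff by (metis minus_minus)
    finally show ?thesis .
  qed
  \<comment> \<open>Taking \<open>w = u\<close> in the characterisation shows that \<open>u\<close>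
    solves the equation; C2 regularity then follows from the interior result for solutions instead
    of being transported from \<open>r\<close>.\<close>
  have us: "visc_sol a H lam u" using char[OF v] by blast
  have uz: "deriv u x = p_minus H lam x" if "a x = 0" for x
    using rz[of "- x"] that by (simp add: du p_minus_reflect)
  show ?thesis
  proof (rule that[OF char])
    show "u C1_differentiable_on UNIV"
      unfolding C1_differentiable_on_def
    proof (intro exI conjI ballI)
      show "(u has_vector_derivative - D (- x)) (at x)" for x
        using ud by (simp add: has_real_derivative_iff_has_vector_derivative)
      show "continuous_on UNIV (\<lambda>x. - D (- x))"
        by (intro continuous_intros continuous_on_compose2[OF D(2)]) auto
    qed
    show "C2_on {x. a x > 0} u"
      unfolding C2_on_def
    proof (intro exI conjI ballI)
      fix x assume "x \<in> {x. a x > 0}"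
      then have ax: "a x > 0" by simp
      show "(u has_real_derivative deriv u x) (at x)" using sol_C2_at(1)[OF us ax] .
      show "(deriv u has_real_derivative (lam - H x (deriv u x)) / a x) (at x)" using sol_C2_at(2)[OF us ax] .
    next
      show "continuous_on {x. a x > 0} (\<lambda>x. (lam - H x (deriv u x)) / a x)"
        by (intro continuous_intros sol_deriv_continuous_on[OF us] continuous_on_subset[OF a_cont]) auto
    qed
    show "deriv u x = p_minus H lam x" if "a x = 0" for x using uz[OF that] .
    show "a x * deriv (deriv u) x + H x (deriv u x) = lam" for x
    proof (cases "a x = 0")
      case True
      then show ?thesis using p_minus_props(1)[OF level_nonempty[OF us True]] uz by simp
    next
      case False
      then have "deriv (deriv u) x = (lam - H x (deriv u x)) / a x"
        using sol_C2_at(2)[OF us, of x] a_nonneg[of x] by (simp add: DERIV_imp_deriv)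
      then show ?thesis using False by simp
    qed
  qed blast
qed

end

section \<open>Verification of the abstract hypotheses and conclusion\<close>

lemma not_bounded_half_lines:
  fixes x :: real
  shows "\<not> bounded {..x}" "\<not> bounded {x..}"
proof -
  show "\<not> bounded {..x}"
  proof
    assume "bounded {..x}"
    then obtain B where "\<And>y. y \<le> x \<Longrightarrow> \<bar>y\<bar> \<le> B" unfolding bounded_iff by auto
    from this[of "min x (- B - 1)"] show False by linarith
  qed
  show "\<not> bounded {x..}"
  proof
    assume "bounded {x..}"
    then obtain B where "\<And>y. x \<le> y \<Longrightarrow> \<bar>y\<bar> \<le> B" unfolding bounded_iff by auto
    from this[of "max x (B + 1)"] show False by linarith
  qed
qed

text \<open>A connected set free of zeros sits in one component of \<open>{a > 0}\<close>. Applied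
  to half-lines, this provides zeros of \<open>a\<close> arbitrarily far out in both
  directions.\<close>

lemma bounded_components_imp_zero:
  fixes a :: "real \<Rightarrow> real"
  assumes a: "\<And>x. 0 \<le> a x"
    and bdd: "\<And>x. a x > 0 \<Longrightarrow> bounded (connected_component_set {y. a y > 0} x)"
    and S: "connected S" "x \<in> S" "\<not> bounded S"
  shows "\<exists>z\<in>S. a z = 0"
proof (rule ccontr)
  assume "\<not> ?thesis"
  then have pos: "a z > 0" if "z \<in> S" for z using a[of z] that by (metis order_le_less)
  then have "S \<subseteq> connected_component_set {y. a y > 0} x"
    by (intro connected_component_maximal S) auto
  then show False using bdd[OF pos[OF S(2)]] S(3) bounded_subset by blast
qed

text \<open>Since \<open>\<gamma> > 2\<close>, the factor
  \<open>\<alpha>0 * \<bar>p\<bar> powr (\<gamma> - 2)\<close> exceeds any constant for large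
  \<open>p\<close>, so \<open>p^2\<close> and all constants are absorbed, for every level
  \<open>lam\<close>.\<close>

lemma H_sqc_coercive:
  assumes H: "H_sqc \<alpha>0 \<alpha>1 \<gamma> \<eta> H" and gam: "\<gamma> > 2"
  shows "\<exists>K. \<forall>x p. K \<le> \<bar>p\<bar> \<longrightarrow> 1 + p\<^sup>2 \<le> H x p - lam"
proof -
  have a0: "\<alpha>0 > 0" and low: "\<alpha>0 * \<bar>p\<bar> powr \<gamma> - 1 / \<alpha>0 \<le> H x p" for x p
    using H unfolding H_sqc_def by (elim conjE, simp)+
  define C where "C = 1 + 1 / \<alpha>0 + \<bar>lam\<bar>"
  have C: "C \<ge> 0" using a0 by (simp add: C_def)
  define R where "R = (1 + C) / \<alpha>0"
  have R: "R > 0" "\<alpha>0 * R = 1 + C" using a0 C by (auto simp: R_def)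
  \<comment> \<open>Beyond this \<open>K\<close> one has
    \<open>\<alpha>0 * \<bar>p\<bar> powr (\<gamma> - 2) \<ge> 1 + C\<close>; the bound 1 ensures
    \<open>C \<le> C * p^2\<close>.\<close>
  define K where "K = max 1 (R powr (1 / (\<gamma> - 2)))"
  have "1 + p\<^sup>2 \<le> H x p - lam" if p: "K \<le> \<bar>p\<bar>" for x p
  proof -
    have p1: "1 \<le> \<bar>p\<bar>" "R powr (1 / (\<gamma> - 2)) \<le> \<bar>p\<bar>" using p by (auto simp: K_def)
    have "R = (R powr (1 / (\<gamma> - 2))) powr (\<gamma> - 2)" using R gam by (simp add: powr_powr)
    also have "\<dots> \<le> \<bar>p\<bar> powr (\<gamma> - 2)" using p1 gam by (intro powr_mono2) auto
    finally have Rp: "R \<le> \<bar>p\<bar> powr (\<gamma> - 2)" .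
    have "\<bar>p\<bar> powr \<gamma> = \<bar>p\<bar> powr (\<gamma> - 2) * \<bar>p\<bar> powr 2" by (subst powr_add[symmetric]) simp
    also have "\<bar>p\<bar> powr 2 = p\<^sup>2" using p1 by (simp add: powr_numeral)
    finally have "\<alpha>0 * \<bar>p\<bar> powr \<gamma> = \<alpha>0 * \<bar>p\<bar> powr (\<gamma> - 2) * p\<^sup>2" by simp
    also have "\<dots> \<ge> \<alpha>0 * R * p\<^sup>2" using Rp a0 by (intro mult_right_mono mult_left_mono) auto
    finally have 1: "(1 + C) * p\<^sup>2 \<le> \<alpha>0 * \<bar>p\<bar> powr \<gamma>" by (simp only: R(2))
    have "1\<^sup>2 \<le> \<bar>p\<bar>\<^sup>2" using p1(1) by (intro power_mono) auto
    then have p2: "1 \<le> p\<^sup>2" by simp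
    have "C * 1 \<le> C * p\<^sup>2" using p2 C by (intro mult_left_mono) auto
    then have "p\<^sup>2 + C \<le> (1 + C) * p\<^sup>2" by (simp add: algebra_simps)
    then have "p\<^sup>2 + C \<le> \<alpha>0 * \<bar>p\<bar> powr \<gamma>" using 1 by simp
    then have "p\<^sup>2 + (1 + 1 / \<alpha>0 + \<bar>lam\<bar>) \<le> \<alpha>0 * \<bar>p\<bar> powr \<gamma>" by (simp only: C_def)
    then show ?thesis using low[of p x] by linarith
  qed
  then show ?thesis by blast
qed

text \<open>At a zero \<open>z\<close> the root \<open>sqrt a\<close> vanishes, so its Lipschitz
  bound squared gives the quadratic bound with constant \<open>\<kappa>^2\<close>; the added 1 makes
  the constant positive outright.\<close>

lemma H_sqc_imp_degenerate_hj:
  fixes a :: "real \<Rightarrow> real" and H :: "real \<Rightarrow> real \<Rightarrow> real"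
  assumes a: "\<And>x. 0 \<le> a x"
    and lip: "\<kappa>-lipschitz_on UNIV (\<lambda>x. sqrt (a x))"
    and comp: "\<And>x. a x > 0 \<Longrightarrow> bounded (connected_component_set {y. a y > 0} x)"
    and H: "H_sqc \<alpha>0 \<alpha>1 \<gamma> \<eta> H" and gam: "\<gamma> > 2"
  shows "degenerate_hj a H (\<kappa>\<^sup>2 + 1)"
proof unfold_locales
  have H': "0 < \<alpha>1 \<and>
      (\<forall>x p q. \<bar>H x p - H x q\<bar> \<le> \<alpha>1 * (\<bar>p\<bar> + \<bar>q\<bar> + 1) powr (\<gamma> - 1) * \<bar>p - q\<bar>) \<and>
      (\<forall>x y p. \<bar>H x p - H y p\<bar> \<le> \<alpha>1 * (\<bar>p\<bar> powr \<gamma> + 1) * \<bar>x - y\<bar>) \<and>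
      (\<forall>x p q t. p \<noteq> q \<and> 0 < t \<and> t < 1 \<longrightarrow> H x (t * p + (1 - t) * q) < max (H x p) (H x q))"
    using H unfolding H_sqc_def by (elim conjE, intro conjI)
  then have a1: "\<alpha>1 > 0"
    and lp: "\<And>x p q. \<bar>H x p - H x q\<bar> \<le> \<alpha>1 * (\<bar>p\<bar> + \<bar>q\<bar> + 1) powr (\<gamma> - 1) * \<bar>p - q\<bar>"
    and lx: "\<And>x y p. \<bar>H x p - H y p\<bar> \<le> \<alpha>1 * (\<bar>p\<bar> powr \<gamma> + 1) * \<bar>x - y\<bar>"
    and qc: "\<And>x p q t. p \<noteq> q \<Longrightarrow> 0 < t \<Longrightarrow> t < 1 \<Longrightarrow> H x (t * p + (1 - t) * q) < max (H x p) (H x q)"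
    by auto
  show "0 \<le> a x" for x by (rule a)
  have sq: "(sqrt (a x))\<^sup>2 = a x" for x using a by simp
  have "continuous_on UNIV (\<lambda>x. (sqrt (a x))\<^sup>2)"
    by (intro continuous_intros lipschitz_on_continuous_on[OF lip])
  then show "continuous_on UNIV a" by (simp only: sq)
  show "\<kappa>\<^sup>2 + 1 > 0" by (simp add: add_nonneg_pos)
  show "a x \<le> (\<kappa>\<^sup>2 + 1) * (x - z)\<^sup>2" if "a z = 0" for x z
  proof -
    have "\<bar>sqrt (a x)\<bar> \<le> \<kappa> * \<bar>x - z\<bar>"
      using lipschitz_onD[OF lip, of x z] that by (simp add: dist_real_def)
    then have "\<bar>sqrt (a x)\<bar>\<^sup>2 \<le> (\<kappa> * \<bar>x - z\<bar>)\<^sup>2" by (intro power_mono) auto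
    then have "(sqrt (a x))\<^sup>2 \<le> (\<kappa> * \<bar>x - z\<bar>)\<^sup>2" by (simp only: power2_abs)
    also have "\<dots> = \<kappa>\<^sup>2 * (x - z)\<^sup>2" by (simp add: power_mult_distrib)
    also have "\<dots> \<le> (\<kappa>\<^sup>2 + 1) * (x - z)\<^sup>2" by (intro mult_right_mono) auto
    finally show ?thesis by (simp only: sq)
  qed
  show "\<exists>z\<le>x. a z = 0" for x
    using bounded_components_imp_zero[OF a comp, of "{..x}" x] not_bounded_half_lines(1)[of x] by auto
  show "\<exists>z\<ge>x. a z = 0" for x
    using bounded_components_imp_zero[OF a comp, of "{x..}" x] not_bounded_half_lines(2)[of x] by auto
  show "\<exists>K. \<forall>x p. K \<le> \<bar>p\<bar> \<longrightarrow> 1 + p\<^sup>2 \<le> H x p - lam" for lam by (rule H_sqc_coercive[OF H gam])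
  show "\<exists>M. \<forall>x y p. \<bar>p\<bar> \<le> K \<longrightarrow> \<bar>H x p - H y p\<bar> \<le> M * \<bar>x - y\<bar>" for K
  proof (intro exI allI impI)
    fix x y p assume p: "\<bar>p\<bar> \<le> K"
    have "\<bar>H x p - H y p\<bar> \<le> \<alpha>1 * (\<bar>p\<bar> powr \<gamma> + 1) * \<bar>x - y\<bar>" by (rule lx)
    also have "\<dots> \<le> \<alpha>1 * (K powr \<gamma> + 1) * \<bar>x - y\<bar>"
      using a1 p gam by (intro mult_right_mono mult_left_mono add_right_mono powr_mono2) auto
    finally show "\<bar>H x p - H y p\<bar> \<le> \<alpha>1 * (K powr \<gamma> + 1) * \<bar>x - y\<bar>" .
  qed
  show "\<exists>M. \<forall>x p q. \<bar>p\<bar> \<le> K \<longrightarrow> \<bar>q\<bar> \<le> K \<longrightarrow> \<bar>H x p - H x q\<bar> \<le> M * \<bar>p - q\<bar>" for K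
  proof (intro exI allI impI)
    fix x p q assume p: "\<bar>p\<bar> \<le> K" "\<bar>q\<bar> \<le> K"
    have "\<bar>H x p - H x q\<bar> \<le> \<alpha>1 * (\<bar>p\<bar> + \<bar>q\<bar> + 1) powr (\<gamma> - 1) * \<bar>p - q\<bar>" by (rule lp)
    also have "\<dots> \<le> \<alpha>1 * (K + K + 1) powr (\<gamma> - 1) * \<bar>p - q\<bar>"
      using a1 p gam by (intro mult_right_mono mult_left_mono powr_mono2) auto
    finally show "\<bar>H x p - H x q\<bar> \<le> \<alpha>1 * (K + K + 1) powr (\<gamma> - 1) * \<bar>p - q\<bar>" .
  qed
  show "H x s < max (H x p) (H x q)" if "p < s" "s < q" for x p q s
  proof -
    define t where "t = (q - s) / (q - p)"
    have t: "0 < t" "t < 1" using that by (auto simp: t_def)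
    have "t * (q - p) = q - s" using that by (simp add: t_def)
    then have "t * p + (1 - t) * q = s" by (simp add: algebra_simps)
    then show ?thesis using qc[of p q t x] t that by simp
  qed
qed

text \<open>The existential over \<open>u\<close> precedes the quantifier over \<open>v0\<close>, so
  the same \<open>u\<close> serves all Lipschitz solutions at the level \<open>lambda0\<close>, and
  \<open>u0\<close> guarantees that there is one. Differentiability is part of the almost everywhere
  condition because \<open>deriv\<close> is total.\<close>

theorem mainTheorem13:
  fixes a :: "real \<Rightarrow> real" and H :: "real \<Rightarrow> real \<Rightarrow> real"
    and \<kappa> \<alpha>0 \<alpha>1 \<gamma> \<eta> lam :: real and u0 :: "real \<Rightarrow> real"
  assumes a_range: "\<forall>x. 0 \<le> a x \<and> a x \<le> 1"
    and a_lip: "\<kappa>-lipschitz_on UNIV (\<lambda>x. sqrt (a x))"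
    and a_nz: "\<exists>x. a x > 0"
    and A_comp: "\<forall>x. a x > 0 \<longrightarrow>
        is_interval (connected_component_set {y. a y > 0} x) \<and>
        bounded (connected_component_set {y. a y > 0} x)"
    and H_cls: "H_sqc \<alpha>0 \<alpha>1 \<gamma> \<eta> H" and gam: "\<gamma> > 2" and eta: "\<eta> > 0"
    and lam: "lam > lambda0 a H"
    and u0_lip: "\<exists>L. L-lipschitz_on UNIV u0"
    and u0_sol: "visc_sol a H (lambda0 a H) u0"
  shows
    "(\<exists>u. (\<forall>v0. (\<exists>L. L-lipschitz_on UNIV v0) \<and> visc_sol a H (lambda0 a H) v0 \<longrightarrow>
            (\<forall>w. (visc_sol a H lam w \<and>
                  (AE x in lborel. w differentiable (at x) \<and> v0 differentiable (at x) \<and>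
                                   deriv w x > deriv v0 x) \<and>
                  w 0 = 0) \<longleftrightarrow> w = u)) \<and>
         u C1_differentiable_on UNIV \<and> C2_on {x. a x > 0} u \<and>
         (\<forall>x. a x = 0 \<longrightarrow> deriv u x = p_plus H lam x) \<and>
         (\<forall>x. a x * deriv (deriv u) x + H x (deriv u x) = lam))
   \<and> (\<exists>u. (\<forall>v0. (\<exists>L. L-lipschitz_on UNIV v0) \<and> visc_sol a H (lambda0 a H) v0 \<longrightarrow>
            (\<forall>w. (visc_sol a H lam w \<and>
                  (AE x in lborel. w differentiable (at x) \<and> v0 differentiable (at x) \<and>
                                   deriv w x < deriv v0 x) \<and>
                  w 0 = 0) \<longleftrightarrow> w = u)) \<and>
         u C1_differentiable_on UNIV \<and> C2_on {x. a x > 0} u \<and>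
         (\<forall>x. a x = 0 \<longrightarrow> deriv u x = p_minus H lam x) \<and>
         (\<forall>x. a x * deriv (deriv u) x + H x (deriv u x) = lam))"
proof -
  interpret degenerate_hj a H "\<kappa>\<^sup>2 + 1"
    by (rule H_sqc_imp_degenerate_hj[OF _ a_lip _ H_cls gam]) (use a_range A_comp in auto)
  show ?thesis
  proof (rule conjI, goal_cases)
    case 1
    show ?case
      by (rule unique_upper_solution[OF u0_sol lam], rule exI, intro conjI allI impI, elim conjE) assumption+
  next
    case 2
    show ?case
      by (rule unique_lower_solution[OF u0_sol lam], rule exI, intro conjI allI impI, elim conjE) assumption+
  qed
qed


end
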